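(* Let $f$ be an edge ordering of $K_n$ chosen uniformly at random from all bijections $E(K_n)\to\{1,2,\dots,\binom n2\}$, and let $H_n$ be the number of $f$-increasing Hamiltonian paths. Then $\mathrm{E}[H_n^2]=(1+o(1))\,e\,n^2$ as $n\to\infty$.
   Context: A Hamiltonian path is regarded as directed, i.e. as a permutation $(v_1,\dots,v_n)$ of the $n$ vertices of $K_n$. It is $f$-increasing if $f(v_1v_2)<f(v_2v_3)<\cdots<f(v_{n-1}v_n)$. *)

theory Defs
  imports
    "HOL-Probability.Probability"
    "HOL-Combinatorics.Multiset_Permutations"
    "HOL-Library.Ramsey"
    "HOL-Library.Landau_Symbols"
begin

definition vertices_K :: "nat \<Rightarrow> nat set" where
  "vertices_K n = {1..n}"

definition edges_K :: "nat \<Rightarrow> nat set set" where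
  "edges_K n = nsets (vertices_K n) 2"

text \<open>The bijections are taken to be \<^const>\<open>undefined\<close> outside of the edge set, so that each
  bijection from the edges is counted exactly once.\<close>

definition edge_orderings :: "nat \<Rightarrow> (nat set \<Rightarrow> nat) set" where
  "edge_orderings n =
     {f \<in> edges_K n \<rightarrow>\<^sub>E {1..n choose 2}. bij_betw f (edges_K n) {1..n choose 2}}"

definition hamiltonian_paths :: "nat \<Rightarrow> nat list set" where
  "hamiltonian_paths n = permutations_of_set (vertices_K n)"

definition increasing_path :: "(nat set \<Rightarrow> nat) \<Rightarrow> nat list \<Rightarrow> bool" where
  "increasing_path f p \<longleftrightarrow>
     (\<forall>i. i + 2 < length p \<longrightarrow> f {p ! i, p ! (i + 1)} < f {p ! (i + 1), p ! (i + 2)})"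

definition num_increasing_paths :: "nat \<Rightarrow> (nat set \<Rightarrow> nat) \<Rightarrow> nat" where
  "num_increasing_paths n f = card {p \<in> hamiltonian_paths n. increasing_path f p}"

definition random_edge_ordering :: "nat \<Rightarrow> (nat set \<Rightarrow> nat) pmf" where
  "random_edge_ordering n = pmf_of_set (edge_orderings n)"

text \<open>The next two facts ensure that \<^const>\<open>pmf_of_set\<close> above is the uniform distribution.\<close>

lemma finite_edges_K: "finite (edges_K n)"
  by (simp add: edges_K_def vertices_K_def finite_imp_finite_nsets)

lemma finite_edge_orderings: "finite (edge_orderings n)"
  unfolding edge_orderings_def using finite_edges_K[of n]
  by (intro finite_subset[OF _ finite_PiE[of "edges_K n" "\<lambda>_. {1..n choose 2}"]]) auto

lemma edge_orderings_nonempty: "edge_orderings n \<noteq> {}"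
proof -
  have "card (edges_K n) = card {1..n choose 2}"
    by (simp add: edges_K_def vertices_K_def)
  then obtain g where g: "bij_betw g (edges_K n) {1..n choose 2}"
    using finite_same_card_bij[OF finite_edges_K[of n]] by blast
  have "bij_betw (restrict g (edges_K n)) (edges_K n) {1..n choose 2}"
    using g by (simp cong: bij_betw_cong)
  moreover have "restrict g (edges_K n) \<in> edges_K n \<rightarrow>\<^sub>E {1..n choose 2}"
    using bij_betw_imp_funcset[OF g] by auto
  ultimately show ?thesis
    unfolding edge_orderings_def by blast
qed

end

(*
  Fix a path P and write any other path as Q = P o sigma.  If P and Q share k edges, then both are
  increasing with probability c / (2n-2-k)!, where c is the number of common linear extensions
  ("merge words") of the two chains of edges.  Hence E[H_n^2] = n! * (sum over merge words W of
  #{sigma : the coincidences of P and Q are those prescribed by W} / |W|!).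

  In a merge word the shared edges form maximal runs.  Q traverses a run in the same direction as P,
  except that a single shared edge may be reversed.  Given a word with r runs and k shared edges,
  the pattern fixes k + r values of sigma up to 2^(number of runs of length 1) choices, and the rest
  of sigma avoids further adjacencies with probability close to exp(-2).  There are about
  (2n)^r / r! * binomial(2N, N) words with given run lengths, N = n-1-k, and the contribution of
  these run lengths to E[H_n^2] / n^2 tends to exp(-2) * (product of the run weights) / r!, where
  a run of l edges has weight 2 for l = 1 and 2^(1-l) for l > 1.  The weights sum to 3, so that
  summing over all lists of run lengths gives exp(-2) * exp(3) = e.  The interchange of limit and
  sum is by dominated convergence, after discarding the words with fewer than n/128 unshared edges
  in each path, which contribute O(1/n).
*)

theory Submission
  imports Defs "HOL-Combinatorics.Combinatorics" "HOL-Real_Asymp.Real_Asymp"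
begin

section \<open>Orderings increasing along two edge sequences\<close>

text \<open>The final sum runs over lists of run lengths, an index set that does not depend on
  \<open>n\<close>; this is what makes dominated convergence applicable. No summable function
  dominates all terms, however: for \<open>n \<ge> 3\<close> the case \<open>Q = P\<close> is a
  single run of \<open>n - 1\<close> edges and contributes exactly \<open>1 / n\<close>, and the sum
  of these values over all \<open>n\<close> diverges. Hence the patterns with few unshared edges are
  split off and their total is estimated for each \<open>n\<close> separately.

  The value exp(-2) is the probability of 0 under the limiting Poisson law, with mean 2, of the
  number of adjacencies in a random permutation. It is needed uniformly for permutations with a
  bounded number of prescribed entries, wherever these lie; this follows from a comparison with
  unrestricted permutations instead of an inclusion-exclusion for each pattern.

  For a general word the pattern yields only an upper bound, because runs that are too close may
  force contradictory values or further shared edges. The lower bound uses words whose consecutive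
  runs are at least two letters of each kind apart; for fixed run lengths the other words form a
  proportion O(1/n).\<close>

definition merges :: "'a list \<Rightarrow> 'a list \<Rightarrow> 'a list set" where
  "merges xs ys = {L \<in> permutations_of_set (set xs \<union> set ys).
     filter (\<lambda>e. e \<in> set xs) L = xs \<and> filter (\<lambda>e. e \<in> set ys) L = ys}"

lemma ex_permutes_map_eq:
  assumes "L \<in> permutations_of_set U" "L' \<in> permutations_of_set U"
  obtains \<pi> where "\<pi> permutes U" "map \<pi> L = L'"
proof -
  have d: "distinct L" "set L = U" "distinct L'" "set L' = U" "length L = length L'"
    using assms by (auto simp: permutations_of_set_def distinct_card[symmetric])
  define \<pi> where "\<pi> x = (case map_of (zip L L') x of None \<Rightarrow> x | Some y \<Rightarrow> y)" for x
  have m: "map \<pi> L = L'"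
    by (rule nth_equalityI) (use d in \<open>auto simp: \<pi>_def map_of_zip_nth\<close>)
  have img: "\<pi> ` U = U" using m d by (metis set_map)
  have "bij_betw \<pi> U U"
    using img d(2) m d(1,3) by (auto simp: bij_betw_def distinct_map)
  moreover have "\<pi> x = x" if "x \<notin> U" for x
    using that d by (auto simp: \<pi>_def split: option.splits dest!: map_of_SomeD in_set_zipE)
  ultimately have "\<pi> permutes U" by (simp add: bij_imp_permutes)
  with m that show ?thesis by blast
qed

lemma edge_orderings_comp_permutes:
  assumes "f \<in> edge_orderings n" "\<pi> permutes U" "U \<subseteq> edges_K n"
  shows "f \<circ> \<pi> \<in> edge_orderings n"
proof -
  have p: "\<pi> permutes edges_K n" using assms(2,3) permutes_subset by blast
  have f: "f \<in> extensional (edges_K n)" "bij_betw f (edges_K n) {1..n choose 2}"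
    using assms(1) by (auto simp: edge_orderings_def PiE_def)
  have "bij_betw (f \<circ> \<pi>) (edges_K n) {1..n choose 2}"
    using bij_betw_trans[OF permutes_imp_bij[OF p] f(2)] .
  moreover have "f \<circ> \<pi> \<in> extensional (edges_K n)"
    using f(1) p by (auto simp: extensional_def permutes_def)
  ultimately show ?thesis
    by (auto simp: edge_orderings_def PiE_def dest: bij_betw_imp_funcset)
qed

lemma inj_on_edge_ordering: "f \<in> edge_orderings n \<Longrightarrow> inj_on f (edges_K n)"
  by (auto simp: edge_orderings_def bij_betw_def)

lemma ex1_sorted_permutation:
  assumes "f \<in> edge_orderings n" "U \<subseteq> edges_K n"
  shows "\<exists>!L. L \<in> permutations_of_set U \<and> sorted_wrt (<) (map f L)"
proof -
  have fin: "finite U" using assms(2) finite_edges_K finite_subset by blast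
  have inj: "inj_on f U" using inj_on_edge_ordering[OF assms(1)] assms(2) inj_on_subset by blast
  define L where "L = map (inv_into U f) (sorted_list_of_set (f ` U))"
  have m: "map f L = sorted_list_of_set (f ` U)"
    unfolding L_def map_map
    by (rule map_idI) (use fin in \<open>auto simp: f_inv_into_f\<close>)
  have "distinct (map f L)" "set L = U"
    unfolding m using fin inj by (auto simp: L_def)
  then have "L \<in> permutations_of_set U" by (auto simp: permutations_of_set_def distinct_map)
  moreover have "sorted_wrt (<) (map f L)" unfolding m by simp
  moreover have "L' = L''" if "L' \<in> permutations_of_set U" "sorted_wrt (<) (map f L')"
     "L'' \<in> permutations_of_set U" "sorted_wrt (<) (map f L'')" for L' L''
  proof -
    have "map f L' = map f L''"
      using that by (intro strict_sorted_equal) (auto simp: permutations_of_set_def)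
    then show ?thesis using that inj
      by (intro map_inj_on[of f L' L'']) (auto simp: permutations_of_set_def)
  qed
  ultimately show ?thesis by blast
qed

text \<open>Precomposition with a permutation of \<open>U\<close> carries the orderings sorted along
  one arrangement of \<open>U\<close> injectively to those sorted along another, so all
  \<open>fact (card U)\<close> arrangements are equally likely. Every ordering is sorted along
  exactly one of them.\<close>

lemma card_orderings_sorted_along:
  assumes "L \<in> permutations_of_set U" "U \<subseteq> edges_K n"
  shows "card {f \<in> edge_orderings n. sorted_wrt (<) (map f L)} * fact (card U)
           = card (edge_orderings n)"
proof -
  let ?F = "\<lambda>L. {f \<in> edge_orderings n. sorted_wrt (<) (map f L)}"
  have fin: "finite U" using assms(2) finite_edges_K finite_subset by blast
  have le: "card (?F L2) \<le> card (?F L1)"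
    if L12: "L1 \<in> permutations_of_set U" "L2 \<in> permutations_of_set U" for L1 L2
  proof -
    obtain \<pi> where \<pi>: "\<pi> permutes U" "map \<pi> L1 = L2" using ex_permutes_map_eq[OF L12] .
    have s: "surj \<pi>" using \<pi>(1) permutes_surj by blast
    show ?thesis
    proof (rule card_inj_on_le[of "\<lambda>f. f \<circ> \<pi>"])
      show "inj_on (\<lambda>f. f \<circ> \<pi>) (?F L2)"
        by (rule inj_onI, rule surj_fun_eq[OF s]) (auto simp: fun_eq_iff)
      show "(\<lambda>f. f \<circ> \<pi>) ` ?F L2 \<subseteq> ?F L1"
        using edge_orderings_comp_permutes[OF _ \<pi>(1) assms(2)] \<pi>(2)
        by (auto simp flip: map_map)
      show "finite (?F L1)" using finite_edge_orderings by auto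
    qed
  qed
  have "edge_orderings n = (\<Union>L'\<in>permutations_of_set U. ?F L')"
    using ex1_sorted_permutation[OF _ assms(2)] by blast
  then have "card (edge_orderings n) = card (\<Union>L'\<in>permutations_of_set U. ?F L')"
    by simp
  also have "\<dots> = (\<Sum>L'\<in>permutations_of_set U. card (?F L'))"
    by (rule card_UN_disjoint)
      (use finite_edge_orderings ex1_sorted_permutation[OF _ assms(2)] in auto)
  also have "\<dots> = (\<Sum>L'\<in>permutations_of_set U. card (?F L))"
    by (rule sum.cong) (use le assms(1) in \<open>auto intro: antisym\<close>)
  finally show ?thesis using fin by (simp add: card_permutations_of_set mult.commute)
qed

text \<open>As \<open>f\<close> increases along \<open>L\<close>, it also increases along the
  arrangement that a subset inherits from \<open>L\<close>, and by injectivity along no other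
  arrangement of that subset.\<close>

lemma sorted_along_iff_filter:
  assumes "f \<in> edge_orderings n" "set L \<subseteq> edges_K n" "sorted_wrt (<) (map f L)"
    and "distinct xs" "set xs \<subseteq> set L"
  shows "sorted_wrt (<) (map f xs) \<longleftrightarrow> filter (\<lambda>e. e \<in> set xs) L = xs"
proof
  have s: "sorted_wrt (<) (map f (filter (\<lambda>e. e \<in> set xs) L))"
    using assms(3) by (simp add: sorted_wrt_map sorted_wrt_filter)
  show "sorted_wrt (<) (map f xs)" if "filter (\<lambda>e. e \<in> set xs) L = xs"
    using s that by simp
  assume "sorted_wrt (<) (map f xs)"
  then have "map f (filter (\<lambda>e. e \<in> set xs) L) = map f xs"
    using s assms(5) by (intro strict_sorted_equal) auto
  moreover have "inj_on f (set L)"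
    using inj_on_edge_ordering[OF assms(1)] assms(2) inj_on_subset by blast
  ultimately show "filter (\<lambda>e. e \<in> set xs) L = xs"
    using assms(5) by (intro map_inj_on[of f]) (auto intro: inj_on_subset)
qed

text \<open>Split the event according to the order in which \<open>f\<close> ranks the union of the
  two edge sets. The admissible orders are the common linear extensions of the two chains, and all
  of them are equally likely.\<close>

lemma card_orderings_increasing_two:
  assumes "distinct xs" "distinct ys" "set xs \<union> set ys \<subseteq> edges_K n"
  shows "card {f \<in> edge_orderings n. sorted_wrt (<) (map f xs) \<and> sorted_wrt (<) (map f ys)}
           * fact (card (set xs \<union> set ys))
         = card (edge_orderings n) * card (merges xs ys)"
proof -
  let ?U = "set xs \<union> set ys"
  let ?F = "\<lambda>L. {f \<in> edge_orderings n. sorted_wrt (<) (map f L)}"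
  have eq: "{f \<in> edge_orderings n. sorted_wrt (<) (map f xs) \<and> sorted_wrt (<) (map f ys)}
     = (\<Union>L\<in>merges xs ys. ?F L)" (is "?A = ?B")
  proof (intro equalityI subsetI)
    fix f assume f: "f \<in> ?A"
    then obtain L where L: "L \<in> permutations_of_set ?U" "sorted_wrt (<) (map f L)"
      using ex1_sorted_permutation[OF _ assms(3)] by blast
    have "set L = ?U" using L by (auto simp: permutations_of_set_def)
    then have "L \<in> merges xs ys"
      using f L assms sorted_along_iff_filter[of f n L xs] sorted_along_iff_filter[of f n L ys]
      by (auto simp: merges_def)
    then show "f \<in> ?B" using f L by auto
  next
    fix f assume "f \<in> ?B"
    then obtain L where L: "L \<in> merges xs ys" "f \<in> ?F L" by auto
    have "set L = ?U" using L by (auto simp: merges_def permutations_of_set_def)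
    then show "f \<in> ?A"
      using L assms sorted_along_iff_filter[of f n L xs] sorted_along_iff_filter[of f n L ys]
      by (auto simp: merges_def)
  qed
  have sub: "merges xs ys \<subseteq> permutations_of_set ?U" by (auto simp: merges_def)
  have "card ?A = (\<Sum>L\<in>merges xs ys. card (?F L))"
    unfolding eq
  proof (rule card_UN_disjoint)
    show "finite (merges xs ys)" using sub by (rule finite_subset) simp
    show "\<forall>i\<in>merges xs ys. finite (?F i)" using finite_edge_orderings by auto
    show "\<forall>i\<in>merges xs ys. \<forall>j\<in>merges xs ys. i \<noteq> j \<longrightarrow> ?F i \<inter> ?F j = {}"
      using sub ex1_sorted_permutation[OF _ assms(3)] by blast
  qed
  then have "card ?A * fact (card ?U) = (\<Sum>L\<in>merges xs ys. card (?F L) * fact (card ?U))"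
    by (simp add: sum_distrib_right)
  also have "\<dots> = (\<Sum>L\<in>merges xs ys. card (edge_orderings n))"
    by (rule sum.cong) (use card_orderings_sorted_along[OF _ assms(3)] sub in auto)
  finally show ?thesis by simp
qed

section \<open>Merge words\<close>

text \<open>A merge word: the next edge belongs only to the first path (\<open>SP\<close>), only to the second one
  (\<open>SQ\<close>), or to both (\<open>SD\<close>), as in a Delannoy path with diagonal steps \<open>SD\<close>.\<close>

datatype step = SP | SQ | SD

text \<open>The side conditions \<open>x \<notin> set ys\<close> and
  \<open>y \<notin> set xs\<close> force an element of both lists to be consumed by
  \<open>SD\<close>, in both lists at once. This makes the encoding unique.\<close>

fun merge_word :: "step list \<Rightarrow> 'a list \<Rightarrow> 'a list \<Rightarrow> bool" where
  "merge_word [] xs ys \<longleftrightarrow> xs = [] \<and> ys = []"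
| "merge_word (SP # w) (x # xs) ys \<longleftrightarrow> x \<notin> set ys \<and> merge_word w xs ys"
| "merge_word (SP # w) [] ys \<longleftrightarrow> False"
| "merge_word (SQ # w) xs (y # ys) \<longleftrightarrow> y \<notin> set xs \<and> merge_word w xs ys"
| "merge_word (SQ # w) xs [] \<longleftrightarrow> False"
| "merge_word (SD # w) (x # xs) (y # ys) \<longleftrightarrow> x = y \<and> merge_word w xs ys"
| "merge_word (SD # w) [] ys \<longleftrightarrow> False"
| "merge_word (SD # w) xs [] \<longleftrightarrow> False"

fun merge_along :: "step list \<Rightarrow> 'a list \<Rightarrow> 'a list \<Rightarrow> 'a list" where
  "merge_along [] xs ys = []"
| "merge_along (SP # w) xs ys = hd xs # merge_along w (tl xs) ys"
| "merge_along (SQ # w) xs ys = hd ys # merge_along w xs (tl ys)"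
| "merge_along (SD # w) xs ys = hd xs # merge_along w (tl xs) (tl ys)"

lemma set_merge_along: "merge_word w xs ys \<Longrightarrow> set (merge_along w xs ys) = set xs \<union> set ys"
  by (induction w xs ys rule: merge_word.induct) auto

lemma merge_along_in_merges:
  "merge_word w xs ys \<Longrightarrow> distinct xs \<Longrightarrow> distinct ys \<Longrightarrow> merge_along w xs ys \<in> merges xs ys"
proof (induction w xs ys rule: merge_word.induct)
  case (2 w x xs ys)
  have s: "set (merge_along w xs ys) = set xs \<union> set ys" using 2 by (intro set_merge_along) auto
  have IH: "merge_along w xs ys \<in> merges xs ys" using 2 by auto
  have "filter (\<lambda>e. e = x \<or> e \<in> set xs) (merge_along w xs ys)
      = filter (\<lambda>e. e \<in> set xs) (merge_along w xs ys)"
    by (rule filter_cong) (use s 2 in auto)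
  then show ?case using IH 2 s by (auto simp: merges_def permutations_of_set_def)
next
  case (4 w xs y ys)
  have s: "set (merge_along w xs ys) = set xs \<union> set ys" using 4 by (intro set_merge_along) auto
  have IH: "merge_along w xs ys \<in> merges xs ys" using 4 by auto
  have "filter (\<lambda>e. e = y \<or> e \<in> set ys) (merge_along w xs ys)
      = filter (\<lambda>e. e \<in> set ys) (merge_along w xs ys)"
    by (rule filter_cong) (use s 4 in auto)
  then show ?case using IH 4 s by (auto simp: merges_def permutations_of_set_def)
next
  case (6 w x xs y ys)
  have s: "set (merge_along w xs ys) = set xs \<union> set ys" using 6 by (intro set_merge_along) auto
  have IH: "merge_along w xs ys \<in> merges xs ys" using 6 by auto
  have "filter (\<lambda>e. e = x \<or> e \<in> set xs) (merge_along w xs ys)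
      = filter (\<lambda>e. e \<in> set xs) (merge_along w xs ys)"
    by (rule filter_cong) (use s 6 in auto)
  moreover have "filter (\<lambda>e. e = x \<or> e \<in> set ys) (merge_along w xs ys)
      = filter (\<lambda>e. e \<in> set ys) (merge_along w xs ys)"
    by (rule filter_cong) (use s 6 in auto)
  ultimately show ?case using IH 6 s by (auto simp: merges_def permutations_of_set_def)
qed (auto simp: merges_def permutations_of_set_def)

lemma merge_word_cases:
  assumes "merge_word w xs ys"
  obtains "w = []" "xs = []" "ys = []"
  | w' x xs' where "w = SP # w'" "xs = x # xs'" "x \<notin> set ys" "merge_word w' xs' ys"
  | w' y ys' where "w = SQ # w'" "ys = y # ys'" "y \<notin> set xs" "merge_word w' xs ys'"
  | w' x xs' ys' where "w = SD # w'" "xs = x # xs'" "ys = x # ys'" "merge_word w' xs' ys'"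
  using assms by (cases "(w, xs, ys)" rule: merge_word.cases) auto

text \<open>The first merged element reveals the first letter: it occurs only in \<open>xs\<close>
  (\<open>SP\<close>), only in \<open>ys\<close> (\<open>SQ\<close>), or in both
  (\<open>SD\<close>).\<close>

lemma merge_along_inj:
  "merge_word w xs ys \<Longrightarrow> merge_word w' xs ys \<Longrightarrow> distinct xs \<Longrightarrow> distinct ys \<Longrightarrow>
   merge_along w xs ys = merge_along w' xs ys \<Longrightarrow> w = w'"
proof (induction w arbitrary: xs ys w')
  case Nil
  from Nil.prems(2) show ?case by (cases rule: merge_word_cases) (use Nil.prems(1) in auto)
next
  case (Cons s w)
  from Cons.prems(1) show ?case
  proof (cases rule: merge_word_cases)
    case (2 v x xs')
    from Cons.prems(2) show ?thesis
    proof (cases rule: merge_word_cases)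
      case (2 v' x' xs'')
      then show ?thesis using Cons.IH[of xs' ys v'] Cons.prems \<open>xs = x # xs'\<close> \<open>s # w = SP # v\<close>
          \<open>merge_word v xs' ys\<close> by simp
    qed (use 2 Cons.prems in auto)
  next
    case (3 v y ys')
    from Cons.prems(2) show ?thesis
    proof (cases rule: merge_word_cases)
      case (3 v' y' ys'')
      then show ?thesis using Cons.IH[of xs ys' v'] Cons.prems \<open>ys = y # ys'\<close> \<open>s # w = SQ # v\<close>
          \<open>merge_word v xs ys'\<close> by simp
    qed (use 3 Cons.prems in auto)
  next
    case (4 v x xs' ys')
    from Cons.prems(2) show ?thesis
    proof (cases rule: merge_word_cases)
      case (4 v' x' xs'' ys'')
      then show ?thesis using Cons.IH[of xs' ys' v'] Cons.prems \<open>xs = x # xs'\<close> \<open>ys = x # ys'\<close>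
          \<open>s # w = SD # v\<close> \<open>merge_word v xs' ys'\<close> by simp
    qed (use 4 Cons.prems in auto)
  qed simp
qed

text \<open>The first element of \<open>L\<close> heads every list that contains it, since filtering
  \<open>L\<close> returns that list. Removing it there preserves both filter equations, and the
  word can be read off recursively.\<close>

lemma ex_merge_word:
  "L \<in> merges xs ys \<Longrightarrow> \<exists>w. merge_word w xs ys \<and> merge_along w xs ys = L"
proof (induction L arbitrary: xs ys)
  case Nil
  then have "xs = []" "ys = []" by (auto simp: merges_def permutations_of_set_def)
  then show ?case by (intro exI[of _ "[]"]) auto
next
  case (Cons e L)
  have d: "e \<notin> set L" "distinct L" "insert e (set L) = set xs \<union> set ys"
    and f: "filter (\<lambda>a. a \<in> set xs) (e # L) = xs" "filter (\<lambda>a. a \<in> set ys) (e # L) = ys"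
    using Cons.prems by (auto simp: merges_def permutations_of_set_def)
  have dis: "distinct xs" "distinct ys"
    using f d by (metis distinct.simps(2) distinct_filter)+
  have sub: "set L = set xs \<union> set ys - {e}" using d by auto
  have step: "\<exists>w. merge_word w xs' ys' \<and> merge_along w xs' ys' = L"
    if xs': "xs' = (if e \<in> set xs then tl xs else xs)" and ys': "ys' = (if e \<in> set ys then tl ys else ys)"
      for xs' ys'
  proof (rule Cons.IH)
    have hx: "xs = e # xs'" if "e \<in> set xs" using f(1) that xs' by (metis filter.simps(2) list.sel(3))
    have hy: "ys = e # ys'" if "e \<in> set ys" using f(2) that ys' by (metis filter.simps(2) list.sel(3))
    have sx: "set xs' = set xs - {e}"
    proof (cases "e \<in> set xs")
      case True
      have "distinct (e # xs')" "set xs = set (e # xs')" using hx[OF True] dis(1) by metis+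
      then show ?thesis by auto
    qed (use xs' in auto)
    have sy: "set ys' = set ys - {e}"
    proof (cases "e \<in> set ys")
      case True
      have "distinct (e # ys')" "set ys = set (e # ys')" using hy[OF True] dis(2) by metis+
      then show ?thesis by auto
    qed (use ys' in auto)
    have fx: "filter (\<lambda>a. a \<in> set xs') L = filter (\<lambda>a. a \<in> set xs) L"
      by (rule filter_cong) (use sx d in auto)
    have fy: "filter (\<lambda>a. a \<in> set ys') L = filter (\<lambda>a. a \<in> set ys) L"
      by (rule filter_cong) (use sy d in auto)
    have "filter (\<lambda>a. a \<in> set xs') L = xs'"
      unfolding fx using f(1) xs' by (metis filter.simps(2) list.sel(3))
    moreover have "filter (\<lambda>a. a \<in> set ys') L = ys'"
      unfolding fy using f(2) ys' by (metis filter.simps(2) list.sel(3))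
    moreover have "set L = set xs' \<union> set ys'" unfolding sx sy sub by auto
    ultimately show "L \<in> merges xs' ys'" using d by (auto simp: merges_def permutations_of_set_def)
  qed
  consider "e \<in> set xs" "e \<in> set ys" | "e \<in> set xs" "e \<notin> set ys" | "e \<notin> set xs" "e \<in> set ys"
    using d(3) by auto
  then show ?case
  proof cases
    case 1
    then obtain xs' ys' where e: "xs = e # xs'" "ys = e # ys'" using f by (metis filter.simps(2))
    from 1 step[of xs' ys'] e obtain w where "merge_word w xs' ys'" "merge_along w xs' ys' = L" by auto
    then show ?thesis unfolding e by (intro exI[of _ "SD # w"]) auto
  next
    case 2
    then obtain xs' where e: "xs = e # xs'" using f by (metis filter.simps(2))
    from 2 step[of xs' ys] e obtain w where "merge_word w xs' ys" "merge_along w xs' ys = L" by auto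
    then show ?thesis using 2 unfolding e by (intro exI[of _ "SP # w"]) auto
  next
    case 3
    then obtain ys' where e: "ys = e # ys'" using f by (metis filter.simps(2))
    from 3 step[of xs ys'] e obtain w where "merge_word w xs ys'" "merge_along w xs ys' = L" by auto
    then show ?thesis using 3 unfolding e by (intro exI[of _ "SQ # w"]) auto
  qed
qed

text \<open>Linear extensions, which mention the edges, are traded for words over three letters, so
  that a single word can later be tested against all permutations.\<close>

lemma card_merges:
  assumes "distinct xs" "distinct ys"
  shows "card (merges xs ys) = card {w. merge_word w xs ys}"
proof -
  have "bij_betw (\<lambda>w. merge_along w xs ys) {w. merge_word w xs ys} (merges xs ys)"
    unfolding bij_betw_def
  proof
    show "inj_on (\<lambda>w. merge_along w xs ys) {w. merge_word w xs ys}"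
      by (rule inj_onI) (blast intro: merge_along_inj[OF _ _ assms])
    show "(\<lambda>w. merge_along w xs ys) ` {w. merge_word w xs ys} = merges xs ys"
      using merge_along_in_merges[OF _ assms] ex_merge_word by blast
  qed
  then show ?thesis using bij_betw_same_card by metis
qed

section \<open>Diagonal cells of a word and coincidences of two lists\<close>

fun cells :: "step list \<Rightarrow> nat \<Rightarrow> nat \<Rightarrow> (nat \<times> nat) set" where
  "cells [] i j = {}"
| "cells (SP # w) i j = cells w (Suc i) j"
| "cells (SQ # w) i j = cells w i (Suc j)"
| "cells (SD # w) i j = insert (i, j) (cells w (Suc i) (Suc j))"

text \<open>The offsets \<open>i\<close> and \<open>j\<close> record how much of each list has been
  consumed, in parallel with the recursion of \<open>cells\<close>.\<close>

definition coincidences :: "'a list \<Rightarrow> 'a list \<Rightarrow> nat \<Rightarrow> nat \<Rightarrow> (nat \<times> nat) set" where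
  "coincidences xs ys i j = {(i + a, j + b) |a b. a < length xs \<and> b < length ys \<and> xs ! a = ys ! b}"

lemma cells_ge: "(a, b) \<in> cells w i j \<Longrightarrow> i \<le> a \<and> j \<le> b"
  by (induction w i j rule: cells.induct) force+

lemma coincidences_Nil [simp]: "coincidences [] ys i j = {}" "coincidences xs [] i j = {}"
  by (auto simp: coincidences_def)

lemma coincidences_swap: "coincidences ys xs j i = prod.swap ` coincidences xs ys i j"
  by (force simp: coincidences_def image_iff)

lemma coincidences_Cons1:
  "coincidences (x # xs) ys i j =
     {(i, j + b) |b. b < length ys \<and> x = ys ! b} \<union> coincidences xs ys (Suc i) j" (is "?A = ?B \<union> ?C")
proof (intro equalityI subsetI)
  fix z assume "z \<in> ?A"
  then obtain a b where ab: "z = (i + a, j + b)" "a < length (x # xs)" "b < length ys"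
    "(x # xs) ! a = ys ! b" by (auto simp: coincidences_def)
  then show "z \<in> ?B \<union> ?C" by (cases a) (auto simp: coincidences_def)
next
  fix z assume "z \<in> ?B \<union> ?C"
  then show "z \<in> ?A"
  proof
    assume "z \<in> ?B"
    then obtain b where "z = (i, j + b)" "b < length ys" "x = ys ! b" by auto
    then show ?thesis by (auto simp: coincidences_def intro!: exI[of _ 0] exI[of _ b])
  next
    assume "z \<in> ?C"
    then obtain a b where "z = (Suc i + a, j + b)" "a < length xs" "b < length ys" "xs ! a = ys ! b"
      by (auto simp: coincidences_def)
    then show ?thesis by (auto simp: coincidences_def intro!: exI[of _ "Suc a"] exI[of _ b])
  qed
qed

lemma coincidences_Cons2:
  "coincidences xs (y # ys) i j =
     {(i + a, j) |a. a < length xs \<and> xs ! a = y} \<union> coincidences xs ys i (Suc j)"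
proof -
  have "coincidences xs (y # ys) i j = prod.swap ` coincidences (y # ys) xs j i"
    by (rule coincidences_swap)
  also have "\<dots> = prod.swap ` {(j, i + b) |b. b < length xs \<and> y = xs ! b}
      \<union> prod.swap ` coincidences ys xs (Suc j) i"
    unfolding coincidences_Cons1 image_Un ..
  also have "prod.swap ` coincidences ys xs (Suc j) i = coincidences xs ys i (Suc j)"
    by (rule coincidences_swap[symmetric])
  finally show ?thesis by (auto simp: image_iff)
qed

text \<open>Only the positions of the common elements matter, not the elements themselves. In the
  cases \<open>SP\<close> and \<open>SQ\<close>, a forbidden coincidence of the consumed head would
  lie in row \<open>i\<close> or column \<open>j\<close>, which the remaining cells avoid by
  \<open>cells_ge\<close>.\<close>

lemma merge_word_iff_cells:
  "distinct xs \<Longrightarrow> distinct ys \<Longrightarrow> merge_word w xs ys \<longleftrightarrow>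
     length (filter (\<lambda>s. s \<noteq> SQ) w) = length xs \<and> length (filter (\<lambda>s. s \<noteq> SP) w) = length ys \<and>
     cells w i j = coincidences xs ys i j"
proof (induction w xs ys arbitrary: i j rule: merge_word.induct)
  case (2 w x xs ys)
  have "x \<notin> set ys" if "cells w (Suc i) j = coincidences (x # xs) ys i j"
  proof
    assume "x \<in> set ys"
    then obtain b where "b < length ys" "x = ys ! b" by (auto simp: in_set_conv_nth)
    then have "(i, j + b) \<in> cells w (Suc i) j" unfolding that coincidences_Cons1 by auto
    then show False using cells_ge by fastforce
  qed
  moreover have "coincidences (x # xs) ys i j = coincidences xs ys (Suc i) j" if "x \<notin> set ys"
    using that by (auto simp: coincidences_Cons1)
  ultimately show ?case using 2 by auto
next
  case (4 w xs y ys)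
  have "y \<notin> set xs" if "cells w i (Suc j) = coincidences xs (y # ys) i j"
  proof
    assume "y \<in> set xs"
    then obtain b where "b < length xs" "xs ! b = y" by (auto simp: in_set_conv_nth)
    then have "(i + b, j) \<in> cells w i (Suc j)" unfolding that coincidences_Cons2 by auto
    then show False using cells_ge by fastforce
  qed
  moreover have "coincidences xs (y # ys) i j = coincidences xs ys i (Suc j)" if "y \<notin> set xs"
    using that by (auto simp: coincidences_Cons2)
  ultimately show ?case using 4 by auto
next
  case (6 w x xs y ys)
  have ge: "(a, b) \<in> coincidences xs ys i' j' \<Longrightarrow> i' \<le> a \<and> j' \<le> b" for a b i' j'
    by (auto simp: coincidences_def)
  have "x = y" if "cells (SD # w) i j = coincidences (x # xs) (y # ys) i j"
  proof -
    have "(i, j) \<in> coincidences (x # xs) (y # ys) i j" using that by auto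
    then show ?thesis by (auto simp: coincidences_def)
  qed
  moreover have "coincidences (x # xs) (y # ys) i j = insert (i, j) (coincidences xs ys (Suc i) (Suc j))"
    if "x = y"
  proof -
    have "{(i, j + b) |b. b < length (y # ys) \<and> x = (y # ys) ! b} = {(i, j)}"
    proof -
      have "b = 0" if "b < length (y # ys)" "x = (y # ys) ! b" for b
        using nth_eq_iff_index_eq[OF 6(3) that(1), of 0] that(2) \<open>x = y\<close> by auto
      then show ?thesis using that by fastforce
    qed
    moreover have "coincidences xs (y # ys) (Suc i) j = coincidences xs ys (Suc i) (Suc j)"
      using that 6(2) by (auto simp: coincidences_Cons2)
    ultimately show ?thesis unfolding coincidences_Cons1 by auto
  qed
  moreover have "insert (i, j) (cells w (Suc i) (Suc j)) = insert (i, j) (coincidences xs ys (Suc i) (Suc j))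
     \<longleftrightarrow> cells w (Suc i) (Suc j) = coincidences xs ys (Suc i) (Suc j)"
    using cells_ge[of i j w "Suc i" "Suc j"] ge[of i j "Suc i" "Suc j"] by (intro insert_ident) auto
  ultimately show ?case using 6 by auto
qed auto

text \<open>\<open>LS l\<close> stands for a maximal run of \<open>Suc l\<close> shared edges.\<close>

datatype letter = LP | LQ | LS nat

section \<open>Run-length encoding of merge words\<close>

fun expand :: "letter list \<Rightarrow> step list" where
  "expand [] = []"
| "expand (LP # V) = SP # expand V"
| "expand (LQ # V) = SQ # expand V"
| "expand (LS l # V) = replicate (Suc l) SD @ expand V"

fun starts_shared :: "letter list \<Rightarrow> bool" where
  "starts_shared (LS l # V) \<longleftrightarrow> True"
| "starts_shared _ \<longleftrightarrow> False"

text \<open>Normality expresses that runs are maximal: two neighbouring run letters would expand to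
  the same steps as one longer run.\<close>

fun normal :: "letter list \<Rightarrow> bool" where
  "normal [] \<longleftrightarrow> True"
| "normal (LS l # V) \<longleftrightarrow> \<not> starts_shared V \<and> normal V"
| "normal (_ # V) \<longleftrightarrow> normal V"

fun compress :: "step list \<Rightarrow> letter list" where
  "compress [] = []"
| "compress (SP # w) = LP # compress w"
| "compress (SQ # w) = LQ # compress w"
| "compress (SD # w) = (case compress w of LS l # V \<Rightarrow> LS (Suc l) # V | V \<Rightarrow> LS 0 # V)"

lemma expand_compress: "expand (compress w) = w"
proof (induction w rule: compress.induct)
  case (4 w)
  then show ?case by (cases "compress w" rule: starts_shared.cases) auto
qed auto

lemma normal_compress: "normal (compress w)"
proof (induction w rule: compress.induct)
  case (4 w)
  then show ?case by (cases "compress w" rule: starts_shared.cases) auto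
qed auto

lemma compress_shared_run:
  "\<not> starts_shared (compress w) \<Longrightarrow> compress (replicate (Suc l) SD @ w) = LS l # compress w"
proof (induction l)
  case 0
  then show ?case by (cases "compress w" rule: starts_shared.cases) auto
qed auto

lemma compress_expand: "normal V \<Longrightarrow> compress (expand V) = V"
proof (induction V rule: expand.induct)
  case (4 l V)
  then show ?case using compress_shared_run[of "expand V" l] by simp
qed auto

lemma bij_betw_expand: "bij_betw expand {V. normal V} UNIV"
  by (rule bij_betw_byWitness[where f' = compress])
    (auto simp: expand_compress normal_compress compress_expand)

section \<open>Adjacencies in a random permutation extending a partial injection\<close>

definition exts :: "nat \<Rightarrow> nat set \<Rightarrow> (nat \<Rightarrow> nat) \<Rightarrow> (nat \<Rightarrow> nat) set" where
  "exts n D g = {Q. Q permutes {..<n} \<and> (\<forall>x\<in>D. Q x = g x)}"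

definition pinj :: "nat \<Rightarrow> nat set \<Rightarrow> (nat \<Rightarrow> nat) \<Rightarrow> bool" where
  "pinj n D g \<longleftrightarrow> D \<subseteq> {..<n} \<and> inj_on g D \<and> g ` D \<subseteq> {..<n}"

lemma pinj_finite: "pinj n D g \<Longrightarrow> finite D"
  by (auto simp: pinj_def intro: finite_subset)

lemma finite_ext: "finite (exts n D g)"
  by (rule finite_subset[of _ "{Q. Q permutes {..<n}}"]) (auto simp: exts_def finite_permutations)

lemma pinj_insert:
  assumes "pinj n D g" "x < n" "x \<notin> D" "y < n" "y \<notin> g ` D"
  shows "pinj n (insert x D) (g(x := y))"
  using assms by (auto simp: pinj_def inj_on_def)

lemma ext_insert: "x \<notin> D \<Longrightarrow> exts n (insert x D) (g(x := y)) = {Q \<in> exts n D g. Q x = y}"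
  by (auto simp: exts_def)

lemma pinj_card_le: "pinj n D g \<Longrightarrow> card D \<le> n"
  unfolding pinj_def by (metis card_lessThan card_mono finite_lessThan)

text \<open>Fix one extension \<open>Q0\<close>. The extensions are then exactly the maps
  \<open>Q0 \<circ> \<sigma>\<close> with \<open>\<sigma>\<close> fixing \<open>D\<close>
  pointwise.\<close>

lemma card_ext:
  assumes "pinj n D g"
  shows "card (exts n D g) = fact (n - card D)"
proof -
  have D: "D \<subseteq> {..<n}" "inj_on g D" "g ` D \<subseteq> {..<n}" "finite D"
    using assms pinj_finite by (auto simp: pinj_def)
  have "card ({..<n} - D) = card ({..<n} - g ` D)"
    using D by (simp add: card_Diff_subset card_image)
  then obtain h where h: "bij_betw h ({..<n} - D) ({..<n} - g ` D)"
    using finite_same_card_bij by (metis finite_Diff finite_lessThan)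
  define Q0 where "Q0 x = (if x \<in> D then g x else if x < n then h x else x)" for x
  have "bij_betw Q0 (D \<union> ({..<n} - D)) (g ` D \<union> ({..<n} - g ` D))"
  proof (rule bij_betw_combine)
    show "bij_betw Q0 D (g ` D)"
      using D by (auto simp: Q0_def bij_betw_def inj_on_def)
    show "bij_betw Q0 ({..<n} - D) ({..<n} - g ` D)"
      by (subst bij_betw_cong[where g = h]) (use h in \<open>auto simp: Q0_def\<close>)
  qed auto
  moreover have "D \<union> ({..<n} - D) = {..<n}" "g ` D \<union> ({..<n} - g ` D) = {..<n}" using D by auto
  ultimately have Q0: "Q0 permutes {..<n}"
    using D by (intro bij_imp_permutes) (auto simp: Q0_def)
  have "exts n D g = (\<lambda>\<sigma>. Q0 \<circ> \<sigma>) ` {\<sigma>. \<sigma> permutes ({..<n} - D)}" (is "_ = ?R")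
  proof (intro equalityI subsetI)
    fix Q assume Q: "Q \<in> exts n D g"
    have "inv Q0 \<circ> Q permutes {..<n}"
      using Q Q0 by (auto simp: exts_def intro: permutes_compose permutes_inv)
    moreover have "(inv Q0 \<circ> Q) x = x" if "x \<in> D" for x
    proof -
      have "Q x = Q0 x" using Q that by (auto simp: exts_def Q0_def)
      then show ?thesis using permutes_inverses(2)[OF Q0] by simp
    qed
    ultimately have "inv Q0 \<circ> Q permutes ({..<n} - D)"
      by (auto intro: permutes_superset)
    moreover have "Q = Q0 \<circ> (inv Q0 \<circ> Q)"
      using permutes_inverses(1)[OF Q0] by (auto simp: fun_eq_iff)
    ultimately show "Q \<in> ?R" by blast
  next
    fix Q assume "Q \<in> ?R"
    then obtain \<sigma> where \<sigma>: "\<sigma> permutes ({..<n} - D)" "Q = Q0 \<circ> \<sigma>" by auto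
    have "\<sigma> permutes {..<n}" using \<sigma>(1) by (rule permutes_subset) auto
    moreover have "\<sigma> x = x" if "x \<in> D" for x using \<sigma>(1) that by (auto simp: permutes_def)
    ultimately show "Q \<in> exts n D g"
      using \<sigma>(2) Q0 by (auto simp: exts_def Q0_def intro: permutes_compose)
  qed
  moreover have "inj_on (\<lambda>\<sigma>. Q0 \<circ> \<sigma>) {\<sigma>. \<sigma> permutes ({..<n} - D)}"
    using permutes_inj[OF Q0] by (auto simp: inj_on_def fun_eq_iff)
  ultimately have "card (exts n D g) = card {\<sigma>. \<sigma> permutes ({..<n} - D)}"
    by (simp add: card_image)
  also have "\<dots> = fact (card ({..<n} - D))" by (rule card_permutations) auto
  also have "card ({..<n} - D) = n - card D" using D by (simp add: card_Diff_subset)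
  finally show ?thesis .
qed

lemma ext_inj: "Q \<in> exts n D g \<Longrightarrow> Q a = Q b \<longleftrightarrow> a = b"
  by (auto simp: exts_def dest: permutes_inj injD)

lemma ext_lt: "Q \<in> exts n D g \<Longrightarrow> Q a < n \<longleftrightarrow> a < n"
  unfolding exts_def using permutes_in_image[of Q "{..<n}" a] by auto

lemma ext_notin: "Q \<in> exts n D g \<Longrightarrow> a \<notin> D \<Longrightarrow> Q a \<notin> g ` D"
  using ext_inj[of Q n D g] by (auto simp: exts_def) metis

lemma card_ext_fix1:
  assumes "pinj n D g" "x < n" "x \<notin> D"
  shows "card {Q \<in> exts n D g. Q x = y} \<le> fact (n - card D - 1)"
proof (cases "y < n \<and> y \<notin> g ` D")
  case True
  have "card (exts n (insert x D) (g(x := y))) = fact (n - card (insert x D))"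
    using card_ext[OF pinj_insert[OF assms]] True by blast
  then show ?thesis using assms pinj_finite[OF assms(1)] by (simp add: ext_insert)
next
  case False
  then have e: "{Q \<in> exts n D g. Q x = y} = {}" using ext_lt ext_notin assms by blast
  show ?thesis unfolding e by simp
qed

lemma card_ext_fix2:
  assumes "pinj n D g" "x < n" "x \<notin> D" "x' < n" "x' \<notin> D" "x \<noteq> x'"
  shows "card {Q \<in> exts n D g. Q x = y \<and> Q x' = y'} \<le> fact (n - card D - 2)"
proof (cases "y < n \<and> y \<notin> g ` D")
  case True
  have "card {Q \<in> exts n (insert x D) (g(x := y)). Q x' = y'} \<le> fact (n - card (insert x D) - 1)"
    by (rule card_ext_fix1) (use pinj_insert assms True in auto)
  moreover have "{Q \<in> exts n (insert x D) (g(x := y)). Q x' = y'} = {Q \<in> exts n D g. Q x = y \<and> Q x' = y'}"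
    using assms by (auto simp: ext_insert)
  ultimately show ?thesis using assms pinj_finite[OF assms(1)]
    by (simp add: numeral_2_eq_2)
next
  case False
  then have e: "{Q \<in> exts n D g. Q x = y \<and> Q x' = y'} = {}" using ext_lt ext_notin assms by blast
  show ?thesis unfolding e by simp
qed

section \<open>Probability of single adjacencies\<close>

definition adj :: "nat \<Rightarrow> nat \<Rightarrow> bool" where
  "adj a b \<longleftrightarrow> a = Suc b \<or> b = Suc a"

lemma adj_sym: "adj a b \<longleftrightarrow> adj b a" by (auto simp: adj_def)

text \<open>Absorbs the choice of one of \<open>m\<close> values or positions into a factorial step,
  at the cost of a factor 2.\<close>

lemma mult_fact_le:
  assumes "2 \<le> m" shows "m * fact (m - 2) \<le> 2 * (fact (m - 1) :: nat)"
proof -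
  have "fact (m - 1) = (m - 1) * (fact (m - 2) :: nat)"
    using assms by (subst fact_reduce) (auto simp: numeral_2_eq_2)
  moreover have "m \<le> 2 * (m - 1)" using assms by simp
  ultimately show ?thesis by (metis mult.assoc mult_le_mono1)
qed

lemma card_le_fixed_union:
  assumes "finite B" "\<And>b. b \<in> B \<Longrightarrow> card {Q \<in> S. P b Q} \<le> c" "A \<subseteq> {Q \<in> S. \<exists>b\<in>B. P b Q}" "finite S"
  shows "card A \<le> card B * c"
proof -
  have "A \<subseteq> (\<Union>b\<in>B. {Q \<in> S. P b Q})" using assms(3) by auto
  then have "card A \<le> card (\<Union>b\<in>B. {Q \<in> S. P b Q})" using assms by (intro card_mono) auto
  also have "\<dots> \<le> (\<Sum>b\<in>B. card {Q \<in> S. P b Q})" using assms by (intro card_UN_le)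
  also have "\<dots> \<le> card B * c" using assms(2) sum_bounded_above[of B "\<lambda>b. card {Q \<in> S. P b Q}" c] by auto
  finally show ?thesis .
qed

text \<open>Among the extensions an adjacency at \<open>x\<close>, \<open>x'\<close> has probability
  O(1/m) with \<open>m = n - card D\<close>. If \<open>x\<close> is prescribed, at most two values
  remain for \<open>x'\<close>; otherwise there are at most \<open>2 * m\<close> pairs of values,
  each attained by at most \<open>fact (m - 2)\<close> extensions.\<close>

lemma card_ext_adj:
  assumes "pinj n D g" "x < n" "x' < n" "x \<noteq> x'" "x' \<notin> D"
  shows "card {Q \<in> exts n D g. adj (Q x) (Q x')} \<le> 4 * fact (n - card D - 1)"
proof (cases "x \<in> D")
  case True
  have "card {Q \<in> exts n D g. adj (Q x) (Q x')} \<le> card {Suc (g x), g x - 1} * fact (n - card D - 1)"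
  proof (rule card_le_fixed_union)
    show "{Q \<in> exts n D g. adj (Q x) (Q x')} \<subseteq> {Q \<in> exts n D g. \<exists>b\<in>{Suc (g x), g x - 1}. Q x' = b}"
      using True by (auto simp: adj_def exts_def)
  qed (use assms card_ext_fix1 finite_ext in auto)
  also have "\<dots> \<le> 4 * fact (n - card D - 1)"
    by (intro mult_right_mono) (auto simp: card_insert_if)
  finally show ?thesis .
next
  case False
  let ?m = "n - card D"
  have fin: "finite D" using assms(1) pinj_finite by blast
  have Dn: "D \<subseteq> {..<n}" "inj_on g D" "g ` D \<subseteq> {..<n}" using assms(1) by (auto simp: pinj_def)
  have "card (insert x (insert x' D)) \<le> card {..<n}"
    using Dn assms by (intro card_mono) auto
  then have m2: "2 \<le> ?m" using False assms fin by simp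
  let ?B = "{..<n} - g ` D"
  have cB: "card ?B = ?m" using Dn fin by (simp add: card_Diff_subset card_image)
  have "card {Q \<in> exts n D g. adj (Q x) (Q x')} \<le>
     card (?B \<times> {0, 1 :: nat}) * fact (?m - 2)"
  \<comment> \<open>The bit \<open>i\<close> tells whether \<open>Q x'\<close> lies above or below
    \<open>Q x\<close>. For \<open>v = 0\<close> the truncated \<open>v - 1\<close> does no harm in
    a union bound.\<close>
  proof (rule card_le_fixed_union[where P = "\<lambda>b Q. case b of (v, i::nat) \<Rightarrow> Q x = v \<and> Q x' = (if i = 0 then Suc v else v - 1)"])
    show "{Q \<in> exts n D g. adj (Q x) (Q x')} \<subseteq> {Q \<in> exts n D g. \<exists>b\<in>?B \<times> {0, 1::nat}.
        case b of (v, i) \<Rightarrow> Q x = v \<and> Q x' = (if i = 0 then Suc v else v - 1)}"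
      using assms False ext_notin[of _ n D g x] ext_lt[of _ n D g x] by (auto simp: adj_def)
  qed (use assms False card_ext_fix2 finite_ext in auto)
  also have "\<dots> = 2 * (?m * fact (?m - 2))" by (simp add: cB card_cartesian_product)
  also have "\<dots> \<le> 4 * fact (?m - 1)" using mult_fact_le[OF m2] by simp
  finally show ?thesis .
qed

text \<open>Counting only pairs with both positions outside \<open>D\<close> ensures that one more
  prescribed position \<open>x\<close> affects at most the two pairs containing
  \<open>x\<close>.\<close>

definition free_adj :: "nat \<Rightarrow> nat set \<Rightarrow> (nat \<Rightarrow> nat) \<Rightarrow> nat set" where
  "free_adj n D Q = {b. Suc b < n \<and> b \<notin> D \<and> Suc b \<notin> D \<and> adj (Q b) (Q (Suc b))}"

lemma finite_free_adj [simp]: "finite (free_adj n D Q)"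
  by (rule finite_subset[of _ "{..<n}"]) (auto simp: free_adj_def)

text \<open>A free adjacency involving the value \<open>y\<close> fixes two entries: at most
  \<open>n - card D\<close> positions \<open>b\<close>, combined with the four value pairs in
  \<open>?C\<close>. This bounds the exceptional set when two values are exchanged.\<close>

lemma card_ext_adj_value:
  assumes "pinj n D g"
  shows "card {Q \<in> exts n D g. \<exists>b\<in>free_adj n D Q. Q b = y \<or> Q (Suc b) = y}
           \<le> 8 * fact (n - card D - 1)" (is "card ?A \<le> _")
proof -
  let ?m = "n - card D"
  let ?B = "{b. Suc b < n \<and> b \<notin> D \<and> Suc b \<notin> D}"
  let ?C = "{(y, Suc y), (y, y - 1), (Suc y, y), (y - 1, y)}"
  have fin: "finite D" using assms(1) pinj_finite by blast
  have Dn: "D \<subseteq> {..<n}" using assms(1) by (auto simp: pinj_def)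
  have "?B \<subseteq> {..<n} - D" by auto
  then have cB: "card ?B \<le> ?m" using Dn fin
    by (metis card_Diff_subset card_lessThan card_mono finite_Diff finite_lessThan)
  have finB: "finite ?B" by (rule finite_subset[of _ "{..<n}"]) auto
  have "card ?A \<le> card (?B \<times> ?C) * fact (?m - 2)"
  proof (rule card_le_fixed_union[where P = "\<lambda>b Q. case b of (b, v, v') \<Rightarrow> Q b = v \<and> Q (Suc b) = v'"])
    show "?A \<subseteq> {Q \<in> exts n D g. \<exists>b\<in>?B \<times> ?C. case b of (b, v, v') \<Rightarrow> Q b = v \<and> Q (Suc b) = v'}"
      by (auto simp: free_adj_def adj_def)
    show "\<And>b. b \<in> ?B \<times> ?C \<Longrightarrow> card {Q \<in> exts n D g. case b of (b, v, v') \<Rightarrow> Q b = v \<and> Q (Suc b) = v'}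
         \<le> fact (?m - 2)"
      using card_ext_fix2[OF assms] by (auto split: prod.splits)
  qed (use finB finite_ext in auto)
  also have "card (?B \<times> ?C) \<le> card ?B * 4"
    unfolding card_cartesian_product by (intro mult_left_mono) (auto simp: card_insert_if)
  also have "card ?B * 4 * fact (?m - 2) \<le> 8 * fact (?m - 1)"
  proof (cases "?B = {}")
    case True
    then show ?thesis unfolding True by simp
  next
    case False
    then obtain b where b: "Suc b < n" "b \<notin> D" "Suc b \<notin> D" by auto
    have "card (insert b (insert (Suc b) D)) \<le> card {..<n}"
      using Dn b by (intro card_mono) auto
    then have "2 \<le> ?m" using b fin by simp
    then have "4 * (?m * fact (?m - 2)) \<le> 8 * fact (?m - 1)" using mult_fact_le[of ?m] by simp
    moreover have "card ?B * 4 * fact (?m - 2) \<le> 4 * (?m * fact (?m - 2))"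
      using cB by simp
    ultimately show ?thesis by linarith
  qed
  finally show ?thesis by simp
qed

section \<open>The adjacency count hardly depends on the prescribed values\<close>

definition adj_count :: "nat \<Rightarrow> nat \<Rightarrow> nat set \<Rightarrow> (nat \<Rightarrow> nat) \<Rightarrow> nat" where
  "adj_count j n D g = card {Q \<in> exts n D g. card (free_adj n D Q) = j}"

text \<open>Exchanging the values \<open>y\<close> and \<open>y'\<close> changes the adjacencies only where one of these two values is
  involved, which has probability \<open>O(1/n)\<close>; so the value prescribed at \<open>x\<close> hardly matters.\<close>

lemma cnt_swap_le:
  assumes "pinj n D g" "x < n" "x \<notin> D" "y < n" "y \<notin> g ` D" "y' < n" "y' \<notin> g ` D"
  shows "adj_count j n (insert x D) (g(x := y)) \<le> adj_count j n (insert x D) (g(x := y')) + 16 * fact (n - card D - 2)"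
proof -
  let ?D = "insert x D"
  let ?E = "\<lambda>y. exts n ?D (g(x := y))"
  let ?s = "Transposition.transpose y y'"
  define bad where "bad y y' = {Q \<in> ?E y. \<exists>b\<in>free_adj n ?D Q. Q b = y' \<or> Q (Suc b) = y'}" for y y'
  let ?A = "\<lambda>y. {Q \<in> ?E y. card (free_adj n ?D Q) = j}"
  have cD: "card ?D = Suc (card D)" using assms pinj_finite by auto
  have cb: "card (bad z z') \<le> 8 * fact (n - card D - 2)" if "z < n" "z \<notin> g ` D" for z z'
    using card_ext_adj_value[OF pinj_insert[OF assms(1,2,3) that], of z'] cD
    by (simp add: bad_def numeral_2_eq_2)
  have fin: "finite (bad z z')" for z z' by (auto simp: bad_def finite_ext)
  have maps: "?s \<circ> Q \<in> ?E y'" if "Q \<in> ?E y" for Q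
  proof -
    have "Q permutes {..<n}" "?s permutes {..<n}"
      using that assms by (auto simp: exts_def intro: permutes_swap_id)
    then have "?s \<circ> Q permutes {..<n}" by (rule permutes_compose)
    moreover have Qg: "Q a = g a" if "a \<in> D" for a
      using \<open>Q \<in> ?E y\<close> that assms by (auto simp: exts_def)
    moreover have "Q a \<noteq> y" "Q a \<noteq> y'" if "a \<in> D" for a
      using Qg[OF that] that assms by (metis image_eqI)+
    moreover have "Q x = y" using that by (auto simp: exts_def)
    ultimately show ?thesis using assms by (auto simp: exts_def)
  qed
  have "(\<lambda>Q. ?s \<circ> Q) ` (?A y - bad y y') \<subseteq> ?A y' \<union> bad y' y"
  proof
    fix R assume "R \<in> (\<lambda>Q. ?s \<circ> Q) ` (?A y - bad y y')"
    then obtain Q where Q: "R = ?s \<circ> Q" "Q \<in> ?E y" "card (free_adj n ?D Q) = j" "Q \<notin> bad y y'"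
      by auto
    have R: "R \<in> ?E y'" using maps Q by auto
    show "R \<in> ?A y' \<union> bad y' y"
    proof (cases "R \<in> bad y' y")
      case False
      have Qx: "Q x = y" and Rx: "R x = y'" using Q(2) R by (auto simp: exts_def)
      have ne1: "Q a \<noteq> y" if "a \<noteq> x" for a using Qx ext_inj[OF Q(2), of a x] that by auto
      have ne2: "R a \<noteq> y'" if "a \<noteq> x" for a using Rx ext_inj[OF R, of a x] that by auto
      have "free_adj n ?D R = free_adj n ?D Q"
      proof (intro equalityI subsetI)
        fix b assume b: "b \<in> free_adj n ?D Q"
        then have "b \<noteq> x" "Suc b \<noteq> x" by (auto simp: free_adj_def)
        moreover have "Q b \<noteq> y'" "Q (Suc b) \<noteq> y'" using Q b by (auto simp: bad_def)
        ultimately have "R b = Q b" "R (Suc b) = Q (Suc b)" using ne1 Q(1) by auto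
        then show "b \<in> free_adj n ?D R" using b by (auto simp: free_adj_def)
      next
        fix b assume b: "b \<in> free_adj n ?D R"
        then have "b \<noteq> x" "Suc b \<noteq> x" by (auto simp: free_adj_def)
        moreover have "R b \<noteq> y" "R (Suc b) \<noteq> y" using R b False by (auto simp: bad_def)
        moreover have "Q a = ?s (R a)" for a using Q(1) by simp
        ultimately have "R b = Q b" "R (Suc b) = Q (Suc b)" using ne2 by auto
        then show "b \<in> free_adj n ?D Q" using b by (auto simp: free_adj_def)
      qed
      then show ?thesis using Q R by auto
    qed auto
  qed
  then have "card (?A y - bad y y') \<le> card (?A y' \<union> bad y' y)"
  proof (rule card_inj_on_le[rotated])
    show "inj_on (\<lambda>Q. ?s \<circ> Q) (?A y - bad y y')"
      by (rule inj_on_inverseI[where g = "\<lambda>Q. ?s \<circ> Q"]) (simp add: fun_eq_iff)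
    show "finite (?A y' \<union> bad y' y)" using fin finite_ext by auto
  qed
  also have "\<dots> \<le> card (?A y') + card (bad y' y)" by (rule card_Un_le)
  finally have 1: "card (?A y - bad y y') \<le> card (?A y') + card (bad y' y)" .
  have "?A y \<subseteq> (?A y - bad y y') \<union> bad y y'" by auto
  then have "card (?A y) \<le> card ((?A y - bad y y') \<union> bad y y')"
    using fin finite_ext by (intro card_mono) auto
  also have "\<dots> \<le> card (?A y - bad y y') + card (bad y y')" by (rule card_Un_le)
  finally show ?thesis using 1 cb[of y y'] cb[of y' y] assms unfolding adj_count_def by linarith
qed

lemma card_diff_le_exceptions:
  assumes "finite S" "card {Q \<in> S. R Q} \<le> c" "\<And>Q. Q \<in> S \<Longrightarrow> \<not> R Q \<Longrightarrow> P1 Q \<longleftrightarrow> P2 Q"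
  shows "\<bar>real (card {Q \<in> S. P1 Q}) - real (card {Q \<in> S. P2 Q})\<bar> \<le> real c"
proof -
  have *: "card {Q \<in> S. P Q} \<le> card {Q \<in> S. P' Q} + c"
    if "\<And>Q. Q \<in> S \<Longrightarrow> \<not> R Q \<Longrightarrow> P Q \<longleftrightarrow> P' Q" for P P'
  proof -
    have "card {Q \<in> S. P Q} \<le> card ({Q \<in> S. P' Q} \<union> {Q \<in> S. R Q})"
      using assms(1) that by (intro card_mono) auto
    also have "\<dots> \<le> card {Q \<in> S. P' Q} + card {Q \<in> S. R Q}" by (rule card_Un_le)
    finally show ?thesis using assms(2) by linarith
  qed
  have "card {Q \<in> S. P1 Q} \<le> card {Q \<in> S. P2 Q} + c" "card {Q \<in> S. P2 Q} \<le> card {Q \<in> S. P1 Q} + c"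
    using assms(3) by (auto intro!: *)
  then show ?thesis by linarith
qed

text \<open>By \<open>card_ext\<close> the denominator is the number of extensions, so under
  \<open>pinj n D g\<close> this is the probability of exactly \<open>j\<close> free
  adjacencies.\<close>

definition adj_freq :: "nat \<Rightarrow> nat \<Rightarrow> nat set \<Rightarrow> (nat \<Rightarrow> nat) \<Rightarrow> real" where
  "adj_freq j n D g = real (adj_count j n D g) / fact (n - card D)"

text \<open>On a fixed set of extensions, the two counts differ only where one of the pairs
  containing \<open>x\<close> is adjacent. The 8 stems from two such pairs with the bound 4 of
  \<open>card_ext_adj\<close> each.\<close>

lemma cnt_insert_approx:
  assumes "pinj n D g" "x < n" "x \<notin> D" "y < n" "y \<notin> g ` D"
  shows "\<bar>real (card {Q \<in> exts n (insert x D) (g(x := y)). card (free_adj n D Q) = j})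
           - real (adj_count j n (insert x D) (g(x := y)))\<bar> \<le> 8 * fact (n - card D - 2)"
proof -
  let ?D = "insert x D"
  let ?E = "exts n ?D (g(x := y))"
  have P: "pinj n ?D (g(x := y))" using pinj_insert[OF assms] .
  have cD: "card ?D = Suc (card D)" using assms pinj_finite by auto
  let ?R = "\<lambda>b Q. Suc b < n \<and> (b = x \<and> Suc x \<notin> D \<or> Suc b = x \<and> b \<notin> D) \<and> adj (Q b) (Q (Suc b))"
  have c1: "card {Q \<in> ?E. ?R b Q} \<le> 4 * fact (n - card D - 2)" for b
  proof -
    consider "b = x" "Suc b < n" "Suc b \<notin> D" | "Suc b = x" "Suc b < n" "b \<notin> D" | "{Q \<in> ?E. ?R b Q} = {}" by blast
    then show ?thesis
    proof cases
      case 1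
      then have "card {Q \<in> ?E. adj (Q b) (Q (Suc b))} \<le> 4 * fact (n - card ?D - 1)"
        by (intro card_ext_adj[OF P]) auto
      moreover have "{Q \<in> ?E. ?R b Q} = {Q \<in> ?E. adj (Q b) (Q (Suc b))}" using 1 by auto
      ultimately show ?thesis using cD by (simp add: numeral_2_eq_2)
    next
      case 2
      then have "card {Q \<in> ?E. adj (Q (Suc b)) (Q b)} \<le> 4 * fact (n - card ?D - 1)"
        by (intro card_ext_adj[OF P]) auto
      moreover have "{Q \<in> ?E. ?R b Q} = {Q \<in> ?E. adj (Q (Suc b)) (Q b)}" using 2 by (auto simp: adj_sym)
      ultimately show ?thesis using cD by (simp add: numeral_2_eq_2)
    next
      case 3
      then show ?thesis by (metis card.empty le0)
    qed
  qed
  have "card {Q \<in> ?E. \<exists>b\<in>{x, x - 1}. ?R b Q} \<le> card {x, x - 1} * (4 * fact (n - card D - 2))"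
    using c1 finite_ext by (intro card_le_fixed_union[where P = ?R]) auto
  also have "\<dots> \<le> 2 * (4 * fact (n - card D - 2))"
    by (intro mult_right_mono) (auto simp: card_insert_if)
  finally have c: "card {Q \<in> ?E. \<exists>b\<in>{x, x - 1}. ?R b Q} \<le> 8 * fact (n - card D - 2)" by simp
  have "\<bar>real (card {Q \<in> ?E. card (free_adj n D Q) = j}) - real (card {Q \<in> ?E. card (free_adj n ?D Q) = j})\<bar>
      \<le> real (8 * fact (n - card D - 2))"
  proof (rule card_diff_le_exceptions[OF finite_ext c])
    fix Q assume "\<not> (\<exists>b\<in>{x, x - 1}. ?R b Q)"
    then have "free_adj n D Q = free_adj n ?D Q"
      by (auto simp: free_adj_def)
    then show "card (free_adj n D Q) = j \<longleftrightarrow> card (free_adj n ?D Q) = j" by simp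
  qed
  then show ?thesis by (simp add: adj_count_def)
qed

text \<open>Condition on the value \<open>z\<close> taken at \<open>x\<close>. Each of the
  \<open>n - card D\<close> conditional counts differs from the count for \<open>y\<close> by at
  most \<open>24 * fact (n - card D - 2)\<close>, namely 8 from \<open>cnt_insert_approx\<close>
  plus 16 from \<open>cnt_swap_le\<close>.\<close>

lemma frq_insert:
  assumes "pinj n D g" "x < n" "x \<notin> D" "y < n" "y \<notin> g ` D" "card D + 2 \<le> n"
  shows "\<bar>adj_freq j n D g - adj_freq j n (insert x D) (g(x := y))\<bar> \<le> 24 / (real n - real (card D) - 1)"
proof -
  let ?m = "n - card D"
  let ?c = "\<lambda>z. real (card {Q \<in> exts n (insert x D) (g(x := z)). card (free_adj n D Q) = j})"
  let ?k = "\<lambda>z. real (adj_count j n (insert x D) (g(x := z)))"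
  let ?B = "{..<n} - g ` D"
  have fin: "finite D" using assms(1) pinj_finite by blast
  have Dn: "D \<subseteq> {..<n}" "inj_on g D" "g ` D \<subseteq> {..<n}" using assms(1) by (auto simp: pinj_def)
  have cB: "card ?B = ?m" using Dn fin by (simp add: card_Diff_subset card_image)
  have d: "\<bar>?c z - ?k y\<bar> \<le> 24 * fact (?m - 2)" if "z \<in> ?B" for z
  proof -
    have z: "z < n" "z \<notin> g ` D" using that by auto
    have "real (adj_count j n (insert x D) (g(x := z))) \<le> real (adj_count j n (insert x D) (g(x := y)) + 16 * fact (?m - 2))"
      using cnt_swap_le[OF assms(1-3) z assms(4,5), of j] by (simp only: of_nat_le_iff)
    moreover have "real (adj_count j n (insert x D) (g(x := y))) \<le> real (adj_count j n (insert x D) (g(x := z)) + 16 * fact (?m - 2))"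
      using cnt_swap_le[OF assms(1-5) z, of j] by (simp only: of_nat_le_iff)
    ultimately show ?thesis using cnt_insert_approx[OF assms(1-3) z, of j] by simp
  qed
  have "{Q \<in> exts n D g. card (free_adj n D Q) = j}
      = (\<Union>z\<in>?B. {Q \<in> exts n (insert x D) (g(x := z)). card (free_adj n D Q) = j})"
    using assms ext_notin[of _ n D g x] ext_lt[of _ n D g x] by (auto simp: ext_insert)
  then have "adj_count j n D g = card (\<Union>z\<in>?B. {Q \<in> exts n (insert x D) (g(x := z)). card (free_adj n D Q) = j})"
    by (simp add: adj_count_def)
  also have "\<dots> = (\<Sum>z\<in>?B. card {Q \<in> exts n (insert x D) (g(x := z)). card (free_adj n D Q) = j})"
    by (rule card_UN_disjoint) (use finite_ext assms in \<open>auto simp: ext_insert\<close>)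
  finally have "real (adj_count j n D g) - real ?m * ?k y = (\<Sum>z\<in>?B. ?c z - ?k y)"
    using cB by (simp add: sum_subtractf)
  then have "\<bar>real (adj_count j n D g) - real ?m * ?k y\<bar> \<le> (\<Sum>z\<in>?B. \<bar>?c z - ?k y\<bar>)" by simp
  also have "\<dots> \<le> (\<Sum>z\<in>?B. 24 * fact (?m - 2))" by (rule sum_mono) (use d in auto)
  also have "\<dots> = real ?m * (24 * fact (?m - 2))" using cB by simp
  finally have *: "\<bar>real (adj_count j n D g) - real ?m * ?k y\<bar> \<le> real ?m * (24 * fact (?m - 2))" .
  define q where "q = n - card D - 2"
  have q: "?m = Suc (Suc q)" using assms(6) by (simp add: q_def)
  have cD: "n - card (insert x D) = Suc q" using q assms fin by auto
  have f: "fact ?m = real ?m * fact (Suc q)" "fact (Suc q) = real (Suc q) * fact (?m - 2)" unfolding q by simp_all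
  have "adj_freq j n D g - adj_freq j n (insert x D) (g(x := y)) = (real (adj_count j n D g) - real ?m * ?k y) / fact ?m"
  proof -
    have *: "a / (M * F) - k / F = (a - M * k) / (M * F)" if "M \<noteq> 0" "F \<noteq> 0" for a k M F :: real
      using that by (simp add: field_simps)
    show ?thesis unfolding adj_freq_def cD f(1) by (rule *) (use q in auto)
  qed
  then have "\<bar>adj_freq j n D g - adj_freq j n (insert x D) (g(x := y))\<bar> \<le> real ?m * (24 * fact (?m - 2)) / fact ?m"
    using * by (simp add: divide_right_mono)
  also have "\<dots> = 24 / real (Suc q)"
  proof -
    have *: "M * (24 * F) / (M * (b * F)) = 24 / b" if "M \<noteq> 0" "F \<noteq> 0" for M F b :: real
      using that by simp
    show ?thesis unfolding f by (rule *) (use q in auto)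
  qed
  also have "real (Suc q) = real n - real (card D) - 1" using q assms(6) by simp
  finally show ?thesis .
qed

text \<open>Prescribe the values one at a time. The error \<open>24 / (n - card D)\<close> of the
  last step bounds that of all earlier steps, whence the factor \<open>card D\<close>.\<close>

lemma frq_approx_empty:
  assumes "pinj n D g" "card D < n"
  shows "\<bar>adj_freq j n D g - adj_freq j n {} g'\<bar> \<le> 24 * real (card D) / (real n - real (card D))"
proof -
  have "finite D" using assms pinj_finite by blast
  have e: "adj_freq j n {} h = adj_freq j n {} h'" for h h' by (simp add: adj_freq_def adj_count_def exts_def)
  show ?thesis using \<open>finite D\<close> assms
  proof (induction D rule: finite_induct)
    case empty
    then show ?case using e[of g g'] by simp
  next
    case (insert x D)
    have P: "pinj n D g" "x < n" "g x < n" "g x \<notin> g ` D" using insert by (auto simp: pinj_def inj_on_def)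
    have c: "card (insert x D) = Suc (card D)" using insert by auto
    have lt: "card D + 2 \<le> n" using insert c by auto
    let ?b = "real n - real (card (insert x D))"
    have b: "?b > 0" using insert by auto
    have "\<bar>adj_freq j n D g - adj_freq j n (insert x D) (g(x := g x))\<bar> \<le> 24 / ?b"
      using frq_insert[OF P(1,2) insert(2) P(3,4) lt, of j] c by (simp add: algebra_simps)
    moreover have "24 * real (card D) / (real n - real (card D)) \<le> 24 * real (card D) / ?b"
      using b c by (intro divide_left_mono) auto
    moreover have "\<bar>adj_freq j n D g - adj_freq j n {} g'\<bar> \<le> 24 * real (card D) / (real n - real (card D))"
      using insert P lt by auto
    moreover have "24 * real (card (insert x D)) / ?b = 24 * real (card D) / ?b + 24 / ?b"
      unfolding c by (simp add: add_divide_distrib[symmetric] algebra_simps)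
    ultimately show ?case by simp
  qed
qed

section \<open>Poisson limit of the adjacency count\<close>

lemma card_Suc_less:
  "card {v. Suc v < n} = n - 1"
proof -
  have "{v. Suc v < n} = {..<n - 1}" by auto
  then show ?thesis by simp
qed

lemma free_adj_empty_card:
  assumes "b \<in> free_adj n {} Q" "\<not> (Suc (Suc b) < n \<and> adj (Q (Suc b)) (Q (Suc (Suc b))))"
    "\<not> (\<exists>a. Suc a = b \<and> adj (Q a) (Q b))"
  shows "card (free_adj n {} Q) = Suc (card (free_adj n {b, Suc b} Q))"
proof -
  have "free_adj n {} Q = insert b (free_adj n {b, Suc b} Q)"
    using assms by (fastforce simp: free_adj_def)
  moreover have "b \<notin> free_adj n {b, Suc b} Q" by (simp add: free_adj_def)
  ultimately show ?thesis by simp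
qed

text \<open>Given an adjacency at \<open>b\<close> with values \<open>v\<close>, \<open>v'\<close>,
  exactly \<open>j\<close> further ones occur with almost the unconditional frequency. The 56 is 8
  for an adjacency in one of the two pairs overlapping the pair at \<open>b\<close>, plus 48 = 24 *
  2 for dropping two prescribed values.\<close>

lemma cnt_pair_approx:
  assumes b: "Suc b < n" and v: "v < n" "v' < n" "adj v v'" and n: "n \<ge> 3"
  shows "\<bar>real (card {Q \<in> exts n {} g. Q b = v \<and> Q (Suc b) = v' \<and> card (free_adj n {} Q) = Suc j})
           - fact (n - 2) * adj_freq j n {} g\<bar> \<le> 56 * fact (n - 3)"
proof -
  define h where "h = (\<lambda>x. if x = b then v else v')"
  let ?D = "{b, Suc b}"
  have P: "pinj n ?D h" using b v by (auto simp: pinj_def h_def adj_def)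
  have cD: "card ?D = 2" by simp
  have E: "exts n ?D h = {Q \<in> exts n {} g. Q b = v \<and> Q (Suc b) = v'}"
    by (auto simp: exts_def h_def)
  let ?R1 = "\<lambda>Q. Suc (Suc b) < n \<and> adj (Q (Suc b)) (Q (Suc (Suc b)))"
  let ?R2 = "\<lambda>Q. \<exists>a. Suc a = b \<and> adj (Q a) (Q b)"
  have r1: "card {Q \<in> exts n ?D h. ?R1 Q} \<le> 4 * fact (n - 3)"
  proof (cases "Suc (Suc b) < n")
    case True
    then show ?thesis using card_ext_adj[OF P, of "Suc b" "Suc (Suc b)"] cD
      by (simp add: numeral_3_eq_3 numeral_2_eq_2)
  qed simp
  have r2: "card {Q \<in> exts n ?D h. ?R2 Q} \<le> 4 * fact (n - 3)"
  proof (cases b)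
    case (Suc a)
    then have "card {Q \<in> exts n ?D h. adj (Q b) (Q a)} \<le> 4 * fact (n - card ?D - 1)"
      using b by (intro card_ext_adj[OF P]) auto
    then show ?thesis using Suc cD
      by (simp add: adj_sym[of _ "_ a"] numeral_3_eq_3 numeral_2_eq_2)
  qed simp
  have "card {Q \<in> exts n ?D h. ?R1 Q \<or> ?R2 Q} \<le> card ({Q \<in> exts n ?D h. ?R1 Q} \<union> {Q \<in> exts n ?D h. ?R2 Q})"
    using finite_ext by (intro card_mono) auto
  also have "\<dots> \<le> 8 * fact (n - 3)"
    using r1 r2 card_Un_le[of "{Q \<in> exts n ?D h. ?R1 Q}" "{Q \<in> exts n ?D h. ?R2 Q}"] by linarith
  finally have r: "card {Q \<in> exts n ?D h. ?R1 Q \<or> ?R2 Q} \<le> 8 * fact (n - 3)" .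
  have "\<bar>real (card {Q \<in> exts n ?D h. card (free_adj n {} Q) = Suc j})
     - real (card {Q \<in> exts n ?D h. card (free_adj n ?D Q) = j})\<bar> \<le> real (8 * fact (n - 3))"
  proof (rule card_diff_le_exceptions[OF finite_ext r])
    fix Q assume Q: "Q \<in> exts n ?D h" "\<not> (?R1 Q \<or> ?R2 Q)"
    have "b \<in> free_adj n {} Q" using Q(1) b v by (auto simp: free_adj_def exts_def h_def)
    then show "card (free_adj n {} Q) = Suc j \<longleftrightarrow> card (free_adj n ?D Q) = j"
      using free_adj_empty_card[of b n Q] Q(2) by auto
  qed
  moreover have "{Q \<in> exts n ?D h. card (free_adj n {} Q) = Suc j}
      = {Q \<in> exts n {} g. Q b = v \<and> Q (Suc b) = v' \<and> card (free_adj n {} Q) = Suc j}"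
    unfolding E by auto
  ultimately have 1: "\<bar>real (card {Q \<in> exts n {} g. Q b = v \<and> Q (Suc b) = v' \<and> card (free_adj n {} Q) = Suc j})
     - real (adj_count j n ?D h)\<bar> \<le> 8 * fact (n - 3)"
    by (simp add: adj_count_def)
  have "\<bar>adj_freq j n ?D h - adj_freq j n {} g\<bar> \<le> 24 * real (card ?D) / (real n - real (card ?D))"
    using P n by (intro frq_approx_empty) auto
  then have "\<bar>fact (n - 2) * (adj_freq j n ?D h - adj_freq j n {} g)\<bar> \<le> fact (n - 2) * (48 / (real n - 2))"
    unfolding abs_mult by (intro mult_mono) auto
  also have "fact (n - 2) * (48 / (real n - 2)) = 48 * fact (n - 3)"
  proof -
    have "fact (n - 2) = (real (n - 2)) * fact (n - 3)"
      using n by (subst fact_reduce) (auto simp: numeral_3_eq_3 numeral_2_eq_2)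
    moreover have "real (n - 2) = real n - 2" using n by simp
    ultimately show ?thesis using n by simp
  qed
  also have "fact (n - 2) * (adj_freq j n ?D h - adj_freq j n {} g) = real (adj_count j n ?D h) - fact (n - 2) * adj_freq j n {} g"
    by (simp add: adj_freq_def right_diff_distrib flip: numeral_2_eq_2)
  finally show ?thesis using 1 by linarith
qed

lemma sum_card_free_adj:
  assumes "finite S"
  shows "(\<Sum>Q\<in>S. card (free_adj n D Q)) = (\<Sum>b | Suc b < n. card {Q \<in> S. b \<in> free_adj n D Q})"
proof -
  have fin: "finite {b. Suc b < n}" by (rule finite_subset[of _ "{..<n}"]) auto
  have "(\<Sum>Q\<in>S. card (free_adj n D Q)) = (\<Sum>Q\<in>S. \<Sum>b | Suc b < n. if b \<in> free_adj n D Q then 1 else 0)"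
  proof (rule sum.cong)
    fix Q
    have "{b. Suc b < n} \<inter> {b. b \<in> free_adj n D Q} = free_adj n D Q" by (auto simp: free_adj_def)
    then show "card (free_adj n D Q) = (\<Sum>b | Suc b < n. if b \<in> free_adj n D Q then 1 else 0)"
      using fin by (simp add: sum.If_cases)
  qed simp
  also have "\<dots> = (\<Sum>b | Suc b < n. \<Sum>Q\<in>S. if b \<in> free_adj n D Q then 1 else 0)"
    by (rule sum.swap)
  also have "\<dots> = (\<Sum>b | Suc b < n. card {Q \<in> S. b \<in> free_adj n D Q})"
    using assms by (simp add: sum.If_cases Int_def)
  finally show ?thesis .
qed

text \<open>The two sums collect ascending and descending adjacencies. Their number is the source of
  the mean 2 in the Poisson limit.\<close>

lemma card_free_adj_split:
  assumes "Suc b < n"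
  shows "card {Q \<in> exts n {} g. P Q \<and> b \<in> free_adj n {} Q}
    = (\<Sum>v | Suc v < n. card {Q \<in> exts n {} g. Q b = v \<and> Q (Suc b) = Suc v \<and> P Q})
    + (\<Sum>v | Suc v < n. card {Q \<in> exts n {} g. Q b = Suc v \<and> Q (Suc b) = v \<and> P Q})"
proof -
  have fin: "finite {b. Suc b < n}" by (rule finite_subset[of _ "{..<n}"]) auto
  let ?A = "\<lambda>v. {Q \<in> exts n {} g. Q b = v \<and> Q (Suc b) = Suc v \<and> P Q}"
  let ?B = "\<lambda>v. {Q \<in> exts n {} g. Q b = Suc v \<and> Q (Suc b) = v \<and> P Q}"
  have "{Q \<in> exts n {} g. P Q \<and> b \<in> free_adj n {} Q}
     = (\<Union>v\<in>{v. Suc v < n}. ?A v) \<union> (\<Union>v\<in>{v. Suc v < n}. ?B v)" (is "?L = ?U \<union> ?W")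
  proof (intro equalityI subsetI)
    fix Q assume Q: "Q \<in> ?L"
    then have "Q b < n" "Q (Suc b) < n" using ext_lt[of Q n "{}" g] assms by auto
    then show "Q \<in> ?U \<union> ?W" using Q by (auto simp: free_adj_def adj_def)
  next
    fix Q assume "Q \<in> ?U \<union> ?W"
    then show "Q \<in> ?L" using assms by (auto simp: free_adj_def adj_def)
  qed
  then have "card ?L = card (?U \<union> ?W)" by (rule arg_cong)
  also have "\<dots> = card ?U + card ?W"
  proof (rule card_Un_disjoint)
    show "finite ?U" by (rule finite_subset[of _ "exts n {} g"]) (auto simp: finite_ext)
    show "finite ?W" by (rule finite_subset[of _ "exts n {} g"]) (auto simp: finite_ext)
    have False if "Q \<in> ?U" "Q \<in> ?W" for Q
    proof -
      from that(1) have "Q (Suc b) = Suc (Q b)" by auto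
      moreover from that(2) have "Q b = Suc (Q (Suc b))" by auto
      ultimately show False by simp
    qed
    then show "?U \<inter> ?W = {}" by blast
  qed
  also have "card ?U = (\<Sum>v | Suc v < n. card (?A v))"
  proof (rule card_UN_disjoint[OF fin])
    show "\<forall>i\<in>{v. Suc v < n}. finite (?A i)" using finite_ext by simp
  qed blast
  also have "card ?W = (\<Sum>v | Suc v < n. card (?B v))"
  proof (rule card_UN_disjoint[OF fin])
    show "\<forall>i\<in>{v. Suc v < n}. finite (?B i)" using finite_ext by simp
  qed blast
  finally show ?thesis .
qed

text \<open>Counting pairs of a permutation and one of its adjacencies in two ways gives the Poisson recursion
  \<open>(j + 1) p\<^sub>j\<^sub>+\<^sub>1 \<approx> 2 p\<^sub>j\<close> for the probability \<open>p\<^sub>j\<close> of exactly \<open>j\<close> adjacencies. The normalization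
  \<open>\<Sum>p\<^sub>j = 1\<close> then determines the limit of \<open>p\<^sub>0\<close>.\<close>

lemma frq_rec:
  assumes n: "n \<ge> 3"
  shows "\<bar>real (Suc j) * adj_freq (Suc j) n {} g - 2 * adj_freq j n {} g * (real n - 1) / real n\<bar> \<le> 112 / (real n - 2)"
proof -
  have fin: "finite {b. Suc b < n}" by (rule finite_subset[of _ "{..<n}"]) auto
  have cb: "real (card {b. Suc b < n}) = real n - 1" using n by (simp add: card_Suc_less)
  let ?S = "{Q \<in> exts n {} g. card (free_adj n {} Q) = Suc j}"
  let ?c = "\<lambda>b v v'. real (card {Q \<in> exts n {} g. Q b = v \<and> Q (Suc b) = v' \<and> card (free_adj n {} Q) = Suc j})"
  let ?F = "fact (n - 2) * adj_freq j n {} g"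
  have "Suc j * adj_count (Suc j) n {} g = (\<Sum>Q\<in>?S. card (free_adj n {} Q))"
    by (simp add: adj_count_def)
  also have "\<dots> = (\<Sum>b | Suc b < n. card {Q \<in> ?S. b \<in> free_adj n {} Q})"
    by (rule sum_card_free_adj) (simp add: finite_ext)
  also have "\<dots> = (\<Sum>b | Suc b < n. card {Q \<in> exts n {} g. card (free_adj n {} Q) = Suc j \<and> b \<in> free_adj n {} Q})"
    by (intro sum.cong arg_cong[where f = card]) auto
  finally have "real (Suc j) * real (adj_count (Suc j) n {} g) = real (\<Sum>b | Suc b < n. card {Q \<in> exts n {} g. card (free_adj n {} Q) = Suc j \<and> b \<in> free_adj n {} Q})"
    by (metis of_nat_mult)
  also have "\<dots> = (\<Sum>b | Suc b < n. (\<Sum>v | Suc v < n. ?c b v (Suc v)) + (\<Sum>v | Suc v < n. ?c b (Suc v) v))"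
    unfolding of_nat_sum by (intro sum.cong refl) (simp add: card_free_adj_split)
  also have "\<dots> = (\<Sum>b | Suc b < n. \<Sum>v | Suc v < n. ?c b v (Suc v) + ?c b (Suc v) v)"
    by (simp add: sum.distrib)
  finally have e: "real (Suc j) * real (adj_count (Suc j) n {} g) = (\<Sum>b | Suc b < n. \<Sum>v | Suc v < n. ?c b v (Suc v) + ?c b (Suc v) v)" .
  have X: "real (Suc j) * real (adj_count (Suc j) n {} g) - (real n - 1) * ((real n - 1) * (2 * ?F))
     = (\<Sum>b | Suc b < n. \<Sum>v | Suc v < n. ?c b v (Suc v) + ?c b (Suc v) v - 2 * ?F)"
    unfolding e by (simp add: sum_subtractf cb)
  have "\<bar>real (Suc j) * real (adj_count (Suc j) n {} g) - (real n - 1) * ((real n - 1) * (2 * ?F))\<bar>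
     \<le> (\<Sum>b | Suc b < n. \<Sum>v | Suc v < n. 112 * fact (n - 3))"
    unfolding X
  proof (rule order.trans[OF sum_abs], intro sum_mono order.trans[OF sum_abs])
    fix b v assume "b \<in> {b. Suc b < n}" "v \<in> {v. Suc v < n}"
    then have "\<bar>?c b v (Suc v) - ?F\<bar> \<le> 56 * fact (n - 3)" "\<bar>?c b (Suc v) v - ?F\<bar> \<le> 56 * fact (n - 3)"
      using n by (auto intro!: cnt_pair_approx simp: adj_def)
    then show "\<bar>?c b v (Suc v) + ?c b (Suc v) v - 2 * ?F\<bar> \<le> 112 * fact (n - 3)" by linarith
  qed
  also have "\<dots> = (real n - 1) * ((real n - 1) * (112 * fact (n - 3)))" unfolding sum_constant cb ..
  finally have main: "\<bar>real (Suc j) * real (adj_count (Suc j) n {} g) - (real n - 1) * ((real n - 1) * (2 * ?F))\<bar>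
    \<le> (real n - 1) * ((real n - 1) * (112 * fact (n - 3)))" .
  define q where "q = n - 3"
  have q: "n = Suc (Suc (Suc q))" using n by (simp add: q_def)
  have f: "fact n = real n * ((real n - 1) * fact (n - 2))" "fact (n - 2) = (real n - 2) * fact (n - 3)"
    unfolding q by simp_all
  have pos: "real n > 0" "real n - 1 > 0" "real n - 2 > 0" "fact (n - 3) > (0::real)" unfolding q by simp_all
  have "real (Suc j) * adj_freq (Suc j) n {} g - 2 * adj_freq j n {} g * (real n - 1) / real n
     = (real (Suc j) * real (adj_count (Suc j) n {} g) - (real n - 1) * ((real n - 1) * (2 * ?F))) / fact n"
    unfolding adj_freq_def[of "Suc j"] using pos by (simp add: f(1) field_simps)
  then have "\<bar>real (Suc j) * adj_freq (Suc j) n {} g - 2 * adj_freq j n {} g * (real n - 1) / real n\<bar>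
     \<le> (real n - 1) * ((real n - 1) * (112 * fact (n - 3))) / fact n"
    using main by (simp add: divide_right_mono)
  also have "\<dots> = 112 / (real n - 2) * ((real n - 1) / real n)"
  proof -
    have *: "a * (a * (112 * F)) / (N * (a * (b * F))) = 112 / b * (a / N)"
      if "a > 0" "F > 0" for a F N b :: real
      using that by (simp add: mult.commute)
    show ?thesis unfolding f using pos by (intro *) auto
  qed
  also have "\<dots> \<le> 112 / (real n - 2) * 1"
    using pos by (intro mult_left_mono) auto
  finally show ?thesis by simp
qed

lemma frq_bounds: "0 \<le> adj_freq j n {} g" "adj_freq j n {} g \<le> 1"
proof -
  have "pinj n {} g" by (simp add: pinj_def)
  then have "card (exts n {} g) = fact n" using card_ext[of n "{}" g] by simp
  moreover have "adj_count j n {} g \<le> card (exts n {} g)"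
    unfolding adj_count_def by (rule card_mono[OF finite_ext]) auto
  ultimately have "adj_count j n {} g \<le> fact n" by simp
  then have "real (adj_count j n {} g) \<le> fact n" by (metis of_nat_fact of_nat_le_iff)
  then show "adj_freq j n {} g \<le> 1" by (simp add: adj_freq_def)
qed (simp add: adj_freq_def)

text \<open>Markov's inequality: the expected number of adjacencies is at most 2, so the probability
  of \<open>J\<close> or more is at most \<open>2 / J\<close>. This tightness keeps mass from
  escaping to infinity in the Poisson limit.\<close>

lemma sum_frq_bounds:
  assumes "n \<ge> 2" "J > 0"
  shows "(\<Sum>j<J. adj_freq j n {} g) \<le> 1" "(\<Sum>j<J. adj_freq j n {} g) \<ge> 1 - 2 / real J"
proof -
  let ?E = "exts n {} g"
  have P: "pinj n {} g" by (simp add: pinj_def)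
  have cE: "card ?E = fact n" using card_ext[OF P] by simp
  let ?L = "{Q \<in> ?E. card (free_adj n {} Q) < J}" and ?G = "{Q \<in> ?E. card (free_adj n {} Q) \<ge> J}"
  have "?L = (\<Union>j<J. {Q \<in> ?E. card (free_adj n {} Q) = j})" by auto
  also have "card \<dots> = (\<Sum>j<J. adj_count j n {} g)"
    unfolding adj_count_def using finite_ext by (intro card_UN_disjoint) auto
  finally have L: "(\<Sum>j<J. adj_freq j n {} g) = real (card ?L) / fact n"
    by (simp add: adj_freq_def sum_divide_distrib)
  have "card ?L + card ?G = card (?L \<union> ?G)" using finite_ext by (intro card_Un_disjoint[symmetric]) auto
  also have "?L \<union> ?G = ?E" by auto
  finally have LG: "card ?L + card ?G = fact n" using cE by simp
  have "J * card ?G = (\<Sum>Q\<in>?G. J)" by simp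
  also have "\<dots> \<le> (\<Sum>Q\<in>?G. card (free_adj n {} Q))" by (rule sum_mono) auto
  also have "\<dots> \<le> (\<Sum>Q\<in>?E. card (free_adj n {} Q))"
    using finite_ext by (intro sum_mono2) auto
  also have "\<dots> = (\<Sum>b | Suc b < n. card {Q \<in> ?E. True \<and> b \<in> free_adj n {} Q})"
    using sum_card_free_adj[OF finite_ext] by simp
  also have "\<dots> \<le> (\<Sum>b | Suc b < n. (\<Sum>v | Suc v < n. fact (n - 2)) + (\<Sum>v | Suc v < n. fact (n - 2)))"
  proof (rule sum_mono)
    fix b assume b: "b \<in> {b. Suc b < n}"
    then have *: "card {Q \<in> ?E. Q b = v \<and> Q (Suc b) = v' \<and> True} \<le> fact (n - 2)" for v v'
      using card_ext_fix2[OF P, of b "Suc b" v v'] by simp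
    show "card {Q \<in> ?E. True \<and> b \<in> free_adj n {} Q} \<le> (\<Sum>v | Suc v < n. fact (n - 2)) + (\<Sum>v | Suc v < n. fact (n - 2))"
      using b unfolding card_free_adj_split[OF b[unfolded mem_Collect_eq]]
      by (intro add_mono sum_mono *)
  qed
  also have "\<dots> = 2 * (n - 1) * ((n - 1) * fact (n - 2))" by (simp add: card_Suc_less)
  also have "(n - 1) * fact (n - 2) = fact (n - 1)"
    using assms(1) by (subst (2) fact_reduce) (auto simp: numeral_2_eq_2)
  also have "2 * (n - 1) * fact (n - 1) \<le> 2 * (n * fact (n - 1))" by simp
  also have "n * fact (n - 1) = fact n" using assms(1) by (subst (2) fact_reduce) auto
  finally have "real (J * card ?G) \<le> real (2 * fact n)" by (simp only: of_nat_le_iff)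
  then have G: "real (card ?G) / fact n \<le> 2 / real J" using assms(2) by (simp add: field_simps)
  have "real (card ?L) + real (card ?G) = fact n" using arg_cong[OF LG, of real] by (simp only: of_nat_add of_nat_fact)
  then have "real (card ?L) / fact n + real (card ?G) / fact n = 1"
    by (simp add: add_divide_distrib[symmetric])
  moreover have "real (card ?G) / fact n \<ge> 0" by simp
  ultimately show "(\<Sum>j<J. adj_freq j n {} g) \<le> 1" "(\<Sum>j<J. adj_freq j n {} g) \<ge> 1 - 2 / real J"
    using G L by linarith+
qed

text \<open>Iterating the recursion of \<open>frq_rec\<close> expresses all frequencies through the
  one for \<open>j = 0\<close>, up to an error that vanishes for fixed \<open>j\<close>.\<close>

lemma frq_ratio_tendsto: "(\<lambda>n. adj_freq j n {} g - 2 ^ j / fact j * adj_freq 0 n {} g) \<longlonglongrightarrow> 0"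
proof (induction j)
  case (Suc j)
  have lim: "(\<lambda>n. 112 / (real n - 2) + 2 * (1 / real n)) \<longlonglongrightarrow> 0" by real_asymp
  have "(\<lambda>n. real (Suc j) * adj_freq (Suc j) n {} g - 2 * adj_freq j n {} g) \<longlonglongrightarrow> 0"
  proof (rule Lim_null_comparison[OF _ lim])
    show "\<forall>\<^sub>F n in sequentially. norm (real (Suc j) * adj_freq (Suc j) n {} g - 2 * adj_freq j n {} g)
       \<le> 112 / (real n - 2) + 2 * (1 / real n)"
      using eventually_ge_at_top[of 3]
    proof eventually_elim
      case (elim n)
      have "2 * adj_freq j n {} g - 2 * adj_freq j n {} g * (real n - 1) / real n = 2 * (adj_freq j n {} g / real n)"
        using elim by (simp add: field_simps)
      moreover have "0 \<le> adj_freq j n {} g / real n" "adj_freq j n {} g / real n \<le> 1 / real n"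
        using frq_bounds[of j n g] by (auto intro: divide_right_mono)
      ultimately show ?case using frq_rec[OF elim, of j g] unfolding real_norm_def by linarith
    qed
  qed
  then have A: "(\<lambda>n. (real (Suc j) * adj_freq (Suc j) n {} g - 2 * adj_freq j n {} g
      + 2 * (adj_freq j n {} g - 2 ^ j / fact j * adj_freq 0 n {} g)) / real (Suc j)) \<longlonglongrightarrow> (0 + 2 * 0) / real (Suc j)"
    by (intro tendsto_intros Suc) auto
  have B: "(real (Suc j) * adj_freq (Suc j) n {} g - 2 * adj_freq j n {} g
      + 2 * (adj_freq j n {} g - 2 ^ j / fact j * adj_freq 0 n {} g)) / real (Suc j)
     = adj_freq (Suc j) n {} g - 2 ^ Suc j / fact (Suc j) * adj_freq 0 n {} g" for n
  proof -
    have *: "(k * A - 2 * B + 2 * (B - x / y * p)) / k = A - (2 * x) / (k * y) * p"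
      if "k \<noteq> 0" "y \<noteq> 0" for k A B x y p :: real
      using that by (simp add: field_simps)
    show ?thesis unfolding power_Suc fact_Suc by (rule *) auto
  qed
  from A show ?case unfolding B by simp
qed simp

text \<open>By \<open>sum_frq_bounds\<close> and \<open>frq_ratio_tendsto\<close>, the product of
  \<open>s J\<close> and the frequency is within \<open>2 / J + o(1)\<close> of 1, and
  \<open>s J\<close> tends to \<open>exp 2\<close>. The cutoff \<open>J\<close> is fixed before
  \<open>n\<close> grows.\<close>

lemma frq_0_tendsto: "(\<lambda>n. adj_freq 0 n {} g) \<longlonglongrightarrow> exp (- 2)"
proof (rule LIMSEQ_I)
  fix \<epsilon> :: real assume \<epsilon>: "\<epsilon> > 0"
  define s where "s J = (\<Sum>j<J. 2 ^ j / fact j :: real)" for J :: nat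
  have s: "s \<longlonglongrightarrow> exp 2"
    using exp_converges[of "2::real"] unfolding sums_def s_def by (simp add: divide_inverse mult.commute scaleR_conv_of_real)
  \<comment> \<open>This expression bounds the error due to the cutoff \<open>J\<close>: the defect
    of the exponential series and the Markov tail.\<close>
  have "(\<lambda>J. \<bar>1 - exp (-2) * s J\<bar> + exp (-2) * (2 / real J)) \<longlonglongrightarrow> \<bar>1 - exp (-2) * exp 2\<bar> + exp (-2) * 0"
    by (intro tendsto_intros s)
  then have "(\<lambda>J. \<bar>1 - exp (-2) * s J\<bar> + exp (-2) * (2 / real J)) \<longlonglongrightarrow> 0"
    by (simp flip: exp_add)
  then have "\<forall>\<^sub>F J in sequentially. \<bar>1 - exp (-2) * s J\<bar> + exp (-2) * (2 / real J) < \<epsilon> / 2"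
    using \<epsilon> by (intro order_tendstoD) auto
  then have "\<forall>\<^sub>F J in sequentially. J > 0 \<and> \<bar>1 - exp (-2) * s J\<bar> + exp (-2) * (2 / real J) < \<epsilon> / 2"
    using eventually_gt_at_top[of 0] by eventually_elim auto
  then obtain J where J: "J > 0" "\<bar>1 - exp (-2) * s J\<bar> + exp (-2) * (2 / real J) < \<epsilon> / 2"
    by (auto dest: eventually_happens)
  have "(\<lambda>n. \<Sum>j<J. (adj_freq j n {} g - 2 ^ j / fact j * adj_freq 0 n {} g)) \<longlonglongrightarrow> (\<Sum>j<J. 0)"
    by (intro tendsto_sum frq_ratio_tendsto)
  then have "(\<lambda>n. (\<Sum>j<J. adj_freq j n {} g) - s J * adj_freq 0 n {} g) \<longlonglongrightarrow> 0"
    by (simp add: sum_subtractf s_def sum_distrib_right)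
  then have "\<forall>\<^sub>F n in sequentially. \<bar>(\<Sum>j<J. adj_freq j n {} g) - s J * adj_freq 0 n {} g\<bar> < \<epsilon> / 2"
    using \<epsilon> by (auto dest!: tendstoD[of _ _ _ "\<epsilon> / 2"] simp: dist_real_def)
  then have "\<forall>\<^sub>F n in sequentially. norm (adj_freq 0 n {} g - exp (- 2)) < \<epsilon>"
    using eventually_ge_at_top[of 2]
  proof eventually_elim
    case (elim n)
    let ?p = "adj_freq 0 n {} g"
    have "\<bar>(\<Sum>j<J. adj_freq j n {} g) - 1\<bar> \<le> 2 / real J"
      using sum_frq_bounds[OF elim(2) J(1), of g] by (simp add: abs_le_iff)
    then have "\<bar>s J * ?p - 1\<bar> \<le> 2 / real J + \<epsilon> / 2" using elim(1) by linarith
    then have "exp (-2) * \<bar>s J * ?p - 1\<bar> \<le> exp (-2) * (2 / real J + \<epsilon> / 2)" by simp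
    also have "\<dots> \<le> exp (-2) * (2 / real J) + 1 * (\<epsilon> / 2)"
      unfolding distrib_left using \<epsilon> by (intro add_mono mult_right_mono) auto
    finally have 1: "\<bar>exp (-2) * (s J * ?p - 1)\<bar> \<le> exp (-2) * (2 / real J) + \<epsilon> / 2"
      by (simp add: abs_mult)
    have "\<bar>?p * (1 - exp (-2) * s J)\<bar> \<le> 1 * \<bar>1 - exp (-2) * s J\<bar>"
      unfolding abs_mult using frq_bounds[of 0 n g] by (intro mult_right_mono) auto
    moreover have *: "a + b < \<epsilon>" if "a \<le> 1 * c" "b \<le> x + \<epsilon> / 2" "c + x < \<epsilon> / 2" for a b c x :: real
      using that by linarith
    ultimately have "\<bar>?p * (1 - exp (-2) * s J)\<bar> + \<bar>exp (-2) * (s J * ?p - 1)\<bar> < \<epsilon>"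
      using 1 J(2) by blast
    moreover have "?p - exp (-2) = ?p * (1 - exp (-2) * s J) + exp (-2) * (s J * ?p - 1)"
      by (simp add: algebra_simps)
    ultimately show ?case unfolding real_norm_def
      by (metis abs_triangle_ineq order_le_less_trans)
  qed
  then show "\<exists>no. \<forall>n\<ge>no. norm (adj_freq 0 n {} g - exp (- 2)) < \<epsilon>"
    by (simp add: eventually_sequentially)
qed

text \<open>The uniformity in \<open>D\<close> and \<open>g\<close> is essential: \<open>D\<close>
  and \<open>g\<close> vary from word to word, while \<open>d\<close> will depend on the run lengths
  only.\<close>

lemma card_ext_no_free_adj_approx:
  assumes "\<epsilon> > 0"
  shows "\<forall>\<^sub>F n in sequentially. \<forall>D g. pinj n D g \<and> card D = d \<longrightarrow>
    \<bar>real (card {Q \<in> exts n D g. free_adj n D Q = {}}) / fact (n - d) - exp (- 2)\<bar> \<le> \<epsilon>"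
proof -
  have "(\<lambda>n. 24 * real d / (real n - real d)) \<longlonglongrightarrow> 0" by real_asymp
  then have "\<forall>\<^sub>F n in sequentially. 24 * real d / (real n - real d) < \<epsilon> / 2"
    using assms by (intro order_tendstoD) auto
  moreover have "\<forall>\<^sub>F n in sequentially. \<bar>adj_freq 0 n {} (\<lambda>x. x) - exp (- 2)\<bar> < \<epsilon> / 2"
    using frq_0_tendsto[of "\<lambda>x. x"] assms by (auto dest!: tendstoD[of _ _ _ "\<epsilon> / 2"] simp: dist_real_def)
  ultimately show ?thesis
    using eventually_gt_at_top[of d]
  proof eventually_elim
    case (elim n)
    show ?case
    proof (intro allI impI)
      fix D g assume D: "pinj n D g \<and> card D = d"
      have "\<bar>adj_freq 0 n D g - adj_freq 0 n {} (\<lambda>x. x)\<bar> \<le> 24 * real d / (real n - real d)"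
        using frq_approx_empty[of n D g 0 "\<lambda>x. x"] D elim by auto
      moreover have "adj_freq 0 n D g = real (card {Q \<in> exts n D g. free_adj n D Q = {}}) / fact (n - d)"
        using D by (simp add: adj_freq_def adj_count_def)
      ultimately show "\<bar>real (card {Q \<in> exts n D g. free_adj n D Q = {}}) / fact (n - d) - exp (- 2)\<bar> \<le> \<epsilon>"
        using elim by linarith
    qed
  qed
qed

section \<open>Adjacencies that touch prescribed positions\<close>

text \<open>Absence of free adjacencies is necessary for realizing a pattern. Absence of these
  adjacencies is sufficient for generic words and has the same asymptotic probability.\<close>

definition outer_adj :: "nat \<Rightarrow> nat set \<Rightarrow> (nat \<Rightarrow> nat) \<Rightarrow> nat set" where
  "outer_adj n D Q = {b. Suc b < n \<and> \<not> (b \<in> D \<and> Suc b \<in> D) \<and> adj (Q b) (Q (Suc b))}"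

text \<open>The two conditions differ only through pairs with exactly one position in
  \<open>D\<close>. There are at most \<open>2 * card D\<close> of these, each adjacent in at most
  \<open>4 * fact (n - card D - 1)\<close> extensions.\<close>

lemma card_ext_no_outer_adj:
  assumes P: "pinj n D g"
  shows "card {Q \<in> exts n D g. free_adj n D Q = {}}
    \<le> card {Q \<in> exts n D g. outer_adj n D Q = {}} + 8 * card D * fact (n - card D - 1)"
proof -
  let ?T = "{(x, x'). x \<in> D \<and> x' < n \<and> x' \<notin> D \<and> (x' = Suc x \<or> Suc x' = x)}"
  let ?bad = "{Q \<in> exts n D g. \<exists>t\<in>?T. adj (Q (fst t)) (Q (snd t))}"
  have fin: "finite D" using pinj_finite[OF P] .
  have sub: "?T \<subseteq> (\<lambda>x. (x, Suc x)) ` D \<union> (\<lambda>x. (x, x - 1)) ` D" by auto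
  have finT: "finite ?T" by (rule finite_subset[OF sub]) (use fin in auto)
  have "card ?T \<le> card ((\<lambda>x. (x, Suc x)) ` D \<union> (\<lambda>x. (x, x - 1)) ` D)"
    using fin by (intro card_mono sub) auto
  also have "\<dots> \<le> card ((\<lambda>x. (x, Suc x)) ` D) + card ((\<lambda>x. (x, x - 1)) ` D)" by (rule card_Un_le)
  also have "\<dots> \<le> card D + card D" using fin by (intro add_mono card_image_le)
  finally have cT: "card ?T \<le> 2 * card D" by simp
  have "card ?bad \<le> card ?T * (4 * fact (n - card D - 1))"
  proof (rule card_le_fixed_union[OF finT _ order.refl finite_ext])
    fix t assume "t \<in> ?T"
    then show "card {Q \<in> exts n D g. adj (Q (fst t)) (Q (snd t))} \<le> 4 * fact (n - card D - 1)"
      using P by (intro card_ext_adj[OF P]) (auto simp: pinj_def)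
  qed
  also have "\<dots> \<le> 2 * card D * (4 * fact (n - card D - 1))" using cT by (rule mult_right_mono) simp
  finally have b: "card ?bad \<le> 8 * card D * fact (n - card D - 1)" by simp
  have "{Q \<in> exts n D g. free_adj n D Q = {}} \<subseteq> {Q \<in> exts n D g. outer_adj n D Q = {}} \<union> ?bad"
  proof
    fix Q assume Q: "Q \<in> {Q \<in> exts n D g. free_adj n D Q = {}}"
    show "Q \<in> {Q \<in> exts n D g. outer_adj n D Q = {}} \<union> ?bad"
    proof (cases "outer_adj n D Q = {}")
      case False
      then obtain b where b: "Suc b < n" "\<not> (b \<in> D \<and> Suc b \<in> D)" "adj (Q b) (Q (Suc b))"
        by (auto simp: outer_adj_def)
      moreover have "b \<in> D \<or> Suc b \<in> D" using Q b by (auto simp: free_adj_def)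
      ultimately have "(b, Suc b) \<in> ?T \<and> adj (Q b) (Q (Suc b)) \<or> (Suc b, b) \<in> ?T \<and> adj (Q (Suc b)) (Q b)"
        by (auto simp: adj_sym)
      then have "\<exists>t\<in>?T. adj (Q (fst t)) (Q (snd t))"
      proof
        assume "(b, Suc b) \<in> ?T \<and> adj (Q b) (Q (Suc b))"
        then show ?thesis by (intro bexI[of _ "(b, Suc b)"]) auto
      next
        assume "(Suc b, b) \<in> ?T \<and> adj (Q (Suc b)) (Q b)"
        then show ?thesis by (intro bexI[of _ "(Suc b, b)"]) auto
      qed
      then show ?thesis using Q by blast
    qed (use Q in auto)
  qed
  then have "card {Q \<in> exts n D g. free_adj n D Q = {}} \<le> card ({Q \<in> exts n D g. outer_adj n D Q = {}} \<union> ?bad)"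
    using finite_ext by (intro card_mono) auto
  also have "\<dots> \<le> card {Q \<in> exts n D g. outer_adj n D Q = {}} + card ?bad" by (rule card_Un_le)
  finally show ?thesis using b by linarith
qed

section \<open>Permutations with a prescribed pattern of shared edges\<close>

text \<open>\<open>(i, j) \<in> shared n Q\<close> says that edge \<open>i\<close> of the path \<open>0, 1, \<dots>, n - 1\<close> is edge \<open>j\<close> of the path
  \<open>Q 0, Q 1, \<dots>, Q (n - 1)\<close>.\<close>

definition shared :: "nat \<Rightarrow> (nat \<Rightarrow> nat) \<Rightarrow> (nat \<times> nat) set" where
  "shared n Q = {(i, j). Suc i < n \<and> Suc j < n \<and> {Q j, Q (Suc j)} = {i, Suc i}}"

definition blocks :: "nat \<Rightarrow> nat \<Rightarrow> nat \<Rightarrow> (nat \<times> nat) list set" where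
  "blocks l i j = insert (map (\<lambda>t. (j + t, i + t)) [0..<Suc (Suc l)])
     (if l = 0 then {[(j, Suc i), (Suc j, i)]} else {})"

text \<open>The pairs (position, value) that a pattern of runs forces on a permutation. Only an isolated shared
  edge leaves a choice: it can be traversed in both directions.\<close>

fun assigns :: "letter list \<Rightarrow> nat \<Rightarrow> nat \<Rightarrow> (nat \<times> nat) list set" where
  "assigns [] i j = {[]}"
| "assigns (LP # V) i j = assigns V (Suc i) j"
| "assigns (LQ # V) i j = assigns V i (Suc j)"
| "assigns (LS l # V) i j = (\<lambda>(a, b). a @ b) ` (blocks l i j \<times> assigns V (Suc (i + l)) (Suc (j + l)))"

fun run_lens :: "letter list \<Rightarrow> nat list" where
  "run_lens [] = []"
| "run_lens (LS l # V) = l # run_lens V"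
| "run_lens (_ # V) = run_lens V"

definition num_orient :: "nat list \<Rightarrow> nat" where
  "num_orient ls = prod_list (map (\<lambda>l. if l = 0 then 2 else 1) ls)"

text \<open>A letter \<open>LS l\<close> carries \<open>Suc l\<close> edges, hence the summand
  \<open>length ls\<close>. In \<open>num_fixed\<close> it is added once more, since a run has one
  vertex more than it has edges.\<close>

definition num_shared :: "nat list \<Rightarrow> nat" where
  "num_shared ls = sum_list ls + length ls"

abbreviation num_fixed :: "nat list \<Rightarrow> nat" where
  "num_fixed ls \<equiv> num_shared ls + length ls"

definition follows :: "(nat \<times> nat) list \<Rightarrow> (nat \<Rightarrow> nat) \<Rightarrow> bool" where
  "follows \<phi> Q \<longleftrightarrow> (\<forall>x y. (x, y) \<in> set \<phi> \<longrightarrow> Q x = y)"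

lemma follows_append [simp]: "follows (a @ b) Q \<longleftrightarrow> follows a Q \<and> follows b Q"
  by (auto simp: follows_def)

lemma length_blocks: "a \<in> blocks l i j \<Longrightarrow> length a = Suc (Suc l)"
  by (auto simp: blocks_def split: if_splits)

lemma fst_blocks: "a \<in> blocks l i j \<Longrightarrow> fst ` set a = {j..Suc (j + l)}"
  by (auto simp: blocks_def image_image split: if_splits)

lemma snd_blocks: "a \<in> blocks l i j \<Longrightarrow> snd ` set a = {i..Suc (i + l)}"
  by (auto simp: blocks_def image_image split: if_splits)

lemma distinct_blocks: "a \<in> blocks l i j \<Longrightarrow> distinct (map fst a) \<and> distinct (map snd a)"
  by (auto simp: blocks_def distinct_map inj_on_def split: if_splits)

lemma finite_blocks [simp]: "finite (blocks l i j)"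
  by (auto simp: blocks_def)

lemma card_blocks: "card (blocks l i j) = (if l = 0 then 2 else 1)"
  by (auto simp: blocks_def card_insert_if)

lemma finite_assigns [simp]: "finite (assigns V i j)"
  by (induction V i j rule: assigns.induct) auto

lemma card_assigns: "card (assigns V i j) = num_orient (run_lens V)"
proof (induction V i j rule: assigns.induct)
  case (4 l V i j)
  have "inj_on (\<lambda>(a, b). a @ b) (blocks l i j \<times> assigns V (Suc (i + l)) (Suc (j + l)))"
    by (rule inj_onI) (auto dest!: length_blocks)
  then show ?case using 4 by (simp add: card_image card_cartesian_product card_blocks num_orient_def)
qed (auto simp: num_orient_def)

lemma length_assigns: "\<phi> \<in> assigns V i j \<Longrightarrow> length \<phi> = num_fixed (run_lens V)"
  by (induction V i j arbitrary: \<phi> rule: assigns.induct) (auto simp: num_shared_def dest!: length_blocks)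

lemma cells_run:
  "cells (replicate (Suc l) SD @ w) i j
    = {(i + t, j + t) |t. t \<le> l} \<union> cells w (Suc (i + l)) (Suc (j + l))"
proof (induction l arbitrary: i j)
  case (Suc l)
  have "{(i + t, j + t) |t. t \<le> Suc l} = insert (i, j) {(Suc i + t, Suc j + t) |t. t \<le> l}"
  proof (intro equalityI subsetI)
    fix z assume "z \<in> {(i + t, j + t) |t. t \<le> Suc l}"
    then obtain t where "z = (i + t, j + t)" "t \<le> Suc l" by auto
    then show "z \<in> insert (i, j) {(Suc i + t, Suc j + t) |t. t \<le> l}" by (cases t) auto
  next
    fix z assume "z \<in> insert (i, j) {(Suc i + t, Suc j + t) |t. t \<le> l}"
    then show "z \<in> {(i + t, j + t) |t. t \<le> Suc l}"
    proof
      assume "z = (i, j)" then show ?thesis by (auto intro!: exI[of _ 0])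
    next
      assume "z \<in> {(Suc i + t, Suc j + t) |t. t \<le> l}"
      then obtain t where "z = (Suc i + t, Suc j + t)" "t \<le> l" by auto
      then show ?thesis by (auto intro!: exI[of _ "Suc t"])
    qed
  qed
  then show ?case using Suc[of "Suc i" "Suc j"] by simp
qed auto

text \<open>The first edge decides the direction. If it is reversed, then
  \<open>Q (Suc j) = i\<close> would have to belong to a second edge
  \<open>{Suc i, Suc (Suc i)}\<close>, so a run of at least two edges is traversed forwards.\<close>

lemma follows_block:
  assumes "inj Q" "\<And>t. t \<le> l \<Longrightarrow> {Q (j + t), Q (Suc (j + t))} = {i + t, Suc (i + t)}"
  shows "\<exists>a\<in>blocks l i j. follows a Q"
proof (cases "Q j = i")
  case True
  have "Q (j + t) = i + t" if "t \<le> Suc l" for t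
    using that
  proof (induction t)
    case (Suc t)
    then show ?case using assms(2)[of t] by (auto simp: doubleton_eq_iff)
  qed (use True in auto)
  then show ?thesis
    by (intro bexI[of _ "map (\<lambda>t. (j + t, i + t)) [0..<Suc (Suc l)]"])
      (auto simp: follows_def blocks_def simp del: upt_Suc)
next
  case False
  then have q: "Q j = Suc i" "Q (Suc j) = i" using assms(2)[of 0] by (auto simp: doubleton_eq_iff)
  have "l = 0"
  proof (rule ccontr)
    assume "l \<noteq> 0"
    then have "{Q (Suc j), Q (Suc (Suc j))} = {Suc i, Suc (Suc i)}" using assms(2)[of 1] by auto
    then show False using q by (auto simp: doubleton_eq_iff)
  qed
  then show ?thesis using q
    by (intro bexI[of _ "[(j, Suc i), (Suc j, i)]"]) (auto simp: follows_def blocks_def)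
qed

lemma ex_assigns_follows:
  "inj Q \<Longrightarrow> cells (expand V) i j \<subseteq> shared n Q \<Longrightarrow>
   \<exists>\<phi>\<in>assigns V i j. follows \<phi> Q \<and> fst ` set \<phi> \<subseteq> {..<n}"
proof (induction V i j rule: assigns.induct)
  case (4 l V i j)
  have c: "(i + t, j + t) \<in> shared n Q" if "t \<le> l" for t
    using 4(3) that unfolding expand.simps cells_run by auto
  have "cells (expand V) (Suc (i + l)) (Suc (j + l)) \<subseteq> shared n Q"
    using 4(3) unfolding expand.simps cells_run by auto
  then obtain b where b: "b \<in> assigns V (Suc (i + l)) (Suc (j + l))" "follows b Q" "fst ` set b \<subseteq> {..<n}"
    using 4 by blast
  have "\<exists>a\<in>blocks l i j. follows a Q"
    by (rule follows_block[OF 4(2)]) (use c in \<open>auto simp: shared_def\<close>)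
  then obtain a where a: "a \<in> blocks l i j" "follows a Q" by blast
  have "fst ` set a \<subseteq> {..<n}" using fst_blocks[OF a(1)] c[of l] by (auto simp: shared_def)
  with a b show ?case by (intro bexI[of _ "a @ b"]) auto
qed (auto simp: follows_def)

lemma assigns_ge: "\<phi> \<in> assigns V i j \<Longrightarrow> (x, y) \<in> set \<phi> \<Longrightarrow> i \<le> y \<and> j \<le> x"
proof (induction V i j arbitrary: \<phi> rule: assigns.induct)
  case (4 l V i j)
  then obtain a b where ab: "\<phi> = a @ b" "a \<in> blocks l i j" "b \<in> assigns V (Suc (i + l)) (Suc (j + l))"
    by auto
  show ?case
  proof (cases "(x, y) \<in> set a")
    case True
    then have "x \<in> fst ` set a" "y \<in> snd ` set a" by force+
    then show ?thesis using fst_blocks snd_blocks ab by auto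
  next
    case False
    then have "(x, y) \<in> set b" using 4 ab by auto
    then show ?thesis using 4(1)[OF ab(3)] by auto
  qed
qed (force simp: Suc_le_eq)+

text \<open>Normality puts a letter between consecutive runs: \<open>LQ\<close> moves the later
  positions past the current block, \<open>LP\<close> the later values. In the second case blocks
  may share a position, but with different values, which contradicts
  \<open>follows \<phi> Q\<close>.\<close>

lemma distinct_fst_assigns:
  "normal V \<Longrightarrow> \<phi> \<in> assigns V i j \<Longrightarrow> follows \<phi> Q \<Longrightarrow> distinct (map fst \<phi>)"
proof (induction V i j arbitrary: \<phi> rule: assigns.induct)
  case (4 l V i j)
  then obtain a b where ab: "\<phi> = a @ b" "a \<in> blocks l i j" "b \<in> assigns V (Suc (i + l)) (Suc (j + l))"
    by auto
  have "False" if x: "x \<in> fst ` set a" "x \<in> fst ` set b" for x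
  proof -
    obtain y where y: "(x, y) \<in> set a" using x(1) by auto
    obtain z where z: "(x, z) \<in> set b" using x(2) by auto
    have yz: "y = z" using 4(4) y z ab by (auto simp: follows_def)
    have y_in: "y \<in> snd ` set a" using y by force
    have xy: "x \<le> Suc (j + l)" "y \<le> Suc (i + l)"
      using fst_blocks[OF ab(2)] snd_blocks[OF ab(2)] x(1) y_in by auto
    consider "V = []" | V' where "V = LP # V'" | V' where "V = LQ # V'"
      using 4(2) by (cases V rule: starts_shared.cases) auto
    then show False
    proof cases
      case 1
      then show ?thesis using ab z by auto
    next
      case 2
      then have "Suc (Suc (i + l)) \<le> z" using assigns_ge[of b V' "Suc (Suc (i + l))"] ab z by auto
      then show ?thesis using xy yz by simp
    next
      case 3
      then have "Suc (Suc (j + l)) \<le> x" using assigns_ge[of b V' _ "Suc (Suc (j + l))"] ab z by auto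
      then show ?thesis using xy by simp
    qed
  qed
  moreover have "distinct (map fst b)" using 4(1)[OF _ ab(3)] 4(2,4) ab by auto
  ultimately show ?case using distinct_blocks[OF ab(2)] ab by auto
qed auto

lemma cells_in_assigns:
  "\<phi> \<in> assigns V i j \<Longrightarrow> (a, b) \<in> cells (expand V) i j \<Longrightarrow> b \<in> fst ` set \<phi> \<and> Suc b \<in> fst ` set \<phi>"
proof (induction V i j arbitrary: \<phi> rule: assigns.induct)
  case (4 l V i j)
  then obtain c d where cd: "\<phi> = c @ d" "c \<in> blocks l i j" "d \<in> assigns V (Suc (i + l)) (Suc (j + l))"
    by auto
  from 4(3) consider t where "(a, b) = (i + t, j + t)" "t \<le> l" | "(a, b) \<in> cells (expand V) (Suc (i + l)) (Suc (j + l))"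
    unfolding expand.simps cells_run by auto
  then show ?case
  proof cases
    case 1
    then show ?thesis using fst_blocks[OF cd(2)] cd by (auto simp: image_Un)
  next
    case 2
    then show ?thesis using 4(1)[OF cd(3)] cd by (auto simp: image_Un)
  qed
qed auto

definition assign_fun :: "(nat \<times> nat) list \<Rightarrow> nat \<Rightarrow> nat" where
  "assign_fun \<phi> x = the (map_of \<phi> x)"

abbreviation assign_dom :: "(nat \<times> nat) list \<Rightarrow> nat set" where
  "assign_dom \<phi> \<equiv> fst ` set \<phi>"

lemma assigns_fun_eq: "distinct (map fst \<phi>) \<Longrightarrow> (x, y) \<in> set \<phi> \<Longrightarrow> assign_fun \<phi> x = y"
  by (simp add: assign_fun_def)

lemma ext_assigns_iff:
  "distinct (map fst \<phi>) \<Longrightarrow> Q \<in> exts n (assign_dom \<phi>) (assign_fun \<phi>) \<longleftrightarrow> Q permutes {..<n} \<and> follows \<phi> Q"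
  by (auto simp: exts_def follows_def assigns_fun_eq)

lemma card_assigns_supp: "distinct (map fst \<phi>) \<Longrightarrow> card (assign_dom \<phi>) = length \<phi>"
  by (metis distinct_card length_map set_map)

lemma shared_adj: "(i, j) \<in> shared n Q \<Longrightarrow> adj (Q j) (Q (Suc j))"
  by (auto simp: shared_def adj_def doubleton_eq_iff)

lemma adj_shared:
  "Q permutes {..<n} \<Longrightarrow> adj (Q j) (Q (Suc j)) \<Longrightarrow> Suc j < n \<Longrightarrow> (min (Q j) (Q (Suc j)), j) \<in> shared n Q"
  using permutes_in_image[of Q "{..<n}" j] permutes_in_image[of Q "{..<n}" "Suc j"]
  by (auto simp: shared_def adj_def min_def)

section \<open>Compatible permutations: upper bound\<close>

definition compat_perms :: "nat \<Rightarrow> letter list \<Rightarrow> (nat \<Rightarrow> nat) set" where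
  "compat_perms n V = {Q. Q permutes {..<n} \<and> shared n Q = cells (expand V) 0 0}"

lemma finite_compat_perms: "finite (compat_perms n V)"
  by (rule finite_subset[of _ "{Q. Q permutes {..<n}}"])
    (auto simp: compat_perms_def finite_permutations)

text \<open>The shared edges of \<open>Q\<close> force one of the assignments. A free adjacency
  would be a shared edge, but all shared edges are prescribed by \<open>V\<close> and lie at
  positions of the assignment.\<close>

lemma compat_perm_assigns:
  assumes "normal V" "Q \<in> compat_perms n V"
  obtains \<phi> where "\<phi> \<in> assigns V 0 0" "distinct (map fst \<phi>)" "pinj n (assign_dom \<phi>) (assign_fun \<phi>)"
    "card (assign_dom \<phi>) = num_fixed (run_lens V)" "Q \<in> exts n (assign_dom \<phi>) (assign_fun \<phi>)"
    "free_adj n (assign_dom \<phi>) Q = {}"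
proof -
  have Q: "Q permutes {..<n}" "shared n Q = cells (expand V) 0 0"
    using assms(2) by (auto simp: compat_perms_def)
  obtain \<phi> where \<phi>: "\<phi> \<in> assigns V 0 0" "follows \<phi> Q" "assign_dom \<phi> \<subseteq> {..<n}"
    using ex_assigns_follows[of Q V 0 0 n] permutes_inj[OF Q(1)] Q(2) by auto
  have d: "distinct (map fst \<phi>)" using distinct_fst_assigns[OF assms(1) \<phi>(1,2)] .
  have e: "Q \<in> exts n (assign_dom \<phi>) (assign_fun \<phi>)" using ext_assigns_iff[OF d] Q(1) \<phi>(2) by auto
  have eq: "assign_fun \<phi> x = Q x" if "x \<in> assign_dom \<phi>" for x using e that by (auto simp: exts_def)
  have "pinj n (assign_dom \<phi>) (assign_fun \<phi>)"
    unfolding pinj_def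
  proof (intro conjI)
    show "inj_on (assign_fun \<phi>) (assign_dom \<phi>)"
      by (rule inj_onI) (metis eq permutes_inj[OF Q(1)] injD)
    show "assign_fun \<phi> ` assign_dom \<phi> \<subseteq> {..<n}"
      using eq permutes_in_image[OF Q(1)] \<phi>(3) by (metis image_subsetI subsetD)
  qed (rule \<phi>(3))
  moreover have "free_adj n (assign_dom \<phi>) Q = {}"
  proof (rule ccontr)
    assume "free_adj n (assign_dom \<phi>) Q \<noteq> {}"
    then obtain b where b: "Suc b < n" "b \<notin> assign_dom \<phi>" "adj (Q b) (Q (Suc b))"
      by (auto simp: free_adj_def)
    then have "(min (Q b) (Q (Suc b)), b) \<in> cells (expand V) 0 0"
      using adj_shared[OF Q(1)] Q(2) by auto
    then show False using cells_in_assigns[OF \<phi>(1)] b by auto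
  qed
  ultimately show ?thesis using that d e \<phi>(1) card_assigns_supp[OF d] length_assigns[OF \<phi>(1)] by metis
qed

lemma compat_perms_nonempty: "normal V \<Longrightarrow> compat_perms n V \<noteq> {} \<Longrightarrow> num_fixed (run_lens V) \<le> n"
  using compat_perm_assigns pinj_card_le by (metis all_not_in_conv)

text \<open>Union bound over the assignments, which differ only in the orientation of isolated
  shared edges.\<close>

lemma card_compat_perms_le:
  fixes C :: real
  assumes V: "normal V" and C: "C \<ge> 0"
    "\<And>D g. pinj n D g \<Longrightarrow> card D = num_fixed (run_lens V) \<Longrightarrow> real (card {Q \<in> exts n D g. free_adj n D Q = {}}) \<le> C"
  shows "real (card (compat_perms n V)) \<le> num_orient (run_lens V) * C"
proof -
  let ?S = "\<lambda>\<phi>. {Q \<in> exts n (assign_dom \<phi>) (assign_fun \<phi>). free_adj n (assign_dom \<phi>) Q = {}}"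
  let ?B = "{\<phi> \<in> assigns V 0 0. pinj n (assign_dom \<phi>) (assign_fun \<phi>) \<and> card (assign_dom \<phi>) = num_fixed (run_lens V)}"
  have "compat_perms n V \<subseteq> (\<Union>\<phi>\<in>?B. ?S \<phi>)"
  proof
    fix Q assume "Q \<in> compat_perms n V"
    from compat_perm_assigns[OF V this] show "Q \<in> (\<Union>\<phi>\<in>?B. ?S \<phi>)" by blast
  qed
  then have "card (compat_perms n V) \<le> card (\<Union>\<phi>\<in>?B. ?S \<phi>)"
    by (intro card_mono) (auto simp: finite_ext)
  also have "\<dots> \<le> (\<Sum>\<phi>\<in>?B. card (?S \<phi>))" by (rule card_UN_le) simp
  finally have "real (card (compat_perms n V)) \<le> (\<Sum>\<phi>\<in>?B. real (card (?S \<phi>)))"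
    unfolding of_nat_sum[symmetric] by (rule of_nat_mono)
  also have "\<dots> \<le> (\<Sum>\<phi>\<in>?B. C)" using C by (intro sum_mono) auto
  also have "\<dots> \<le> (\<Sum>\<phi>\<in>assigns V 0 0. C)" using C by (intro sum_mono2) auto
  finally show ?thesis by (simp add: card_assigns)
qed

section \<open>Generic words: lower bound\<close>

fun gap_P :: "letter list \<Rightarrow> nat" where
  "gap_P (LP # V) = Suc (gap_P V)"
| "gap_P (LQ # V) = gap_P V"
| "gap_P _ = 0"

fun gap_Q :: "letter list \<Rightarrow> nat" where
  "gap_Q (LP # V) = gap_Q V"
| "gap_Q (LQ # V) = Suc (gap_Q V)"
| "gap_Q _ = 0"

text \<open>Gaps of length at least 2 between consecutive runs ensure that the forced values create no
  adjacency between two different runs.\<close>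

fun generic :: "letter list \<Rightarrow> bool" where
  "generic [] \<longleftrightarrow> True"
| "generic (LS l # V) \<longleftrightarrow> generic V \<and> (run_lens V = [] \<or> gap_P V \<ge> 2 \<and> gap_Q V \<ge> 2)"
| "generic (_ # V) \<longleftrightarrow> generic V"

lemma generic_normal: "generic V \<Longrightarrow> normal V"
proof (induction V rule: generic.induct)
  case (2 l V)
  then show ?case by (cases V rule: starts_shared.cases) auto
qed auto

lemma assigns_ge_gap: "\<phi> \<in> assigns V i j \<Longrightarrow> (x, y) \<in> set \<phi> \<Longrightarrow> i + gap_P V \<le> y \<and> j + gap_Q V \<le> x"
  using assigns_ge[of \<phi> V i j x y]
  by (induction V i j rule: assigns.induct) (auto dest: assigns_ge)

lemma assigns_le:
  "\<phi> \<in> assigns V i j \<Longrightarrow> (x, y) \<in> set \<phi> \<Longrightarrow>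
     y \<le> i + count_list V LP + num_shared (run_lens V) \<and> x \<le> j + count_list V LQ + num_shared (run_lens V)"
proof (induction V i j arbitrary: \<phi> rule: assigns.induct)
  case (4 l V i j)
  then obtain a b where ab: "\<phi> = a @ b" "a \<in> blocks l i j" "b \<in> assigns V (Suc (i + l)) (Suc (j + l))"
    by auto
  show ?case
  proof (cases "(x, y) \<in> set a")
    case True
    then have "x \<in> fst ` set a" "y \<in> snd ` set a" by force+
    then show ?thesis using fst_blocks snd_blocks ab by (auto simp: num_shared_def)
  next
    case False
    then have "(x, y) \<in> set b" using 4 ab by auto
    then show ?thesis using 4(1)[OF ab(3)] by (auto simp: num_shared_def)
  qed
qed force+

lemma assigns_lens_Nil: "run_lens V = [] \<Longrightarrow> \<phi> \<in> assigns V i j \<Longrightarrow> \<phi> = []"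
  using length_assigns[of \<phi> V i j] by (simp add: num_shared_def)

lemma generic_distinct:
  "generic V \<Longrightarrow> \<phi> \<in> assigns V i j \<Longrightarrow> distinct (map fst \<phi>) \<and> distinct (map snd \<phi>)"
proof (induction V i j arbitrary: \<phi> rule: assigns.induct)
  case (4 l V i j)
  then obtain a b where ab: "\<phi> = a @ b" "a \<in> blocks l i j" "b \<in> assigns V (Suc (i + l)) (Suc (j + l))"
    by auto
  have "Suc (Suc (i + l)) \<le> y \<and> Suc (Suc (j + l)) \<le> x" if "(x, y) \<in> set b" for x y
  proof -
    have "run_lens V \<noteq> []" using assigns_lens_Nil ab that by force
    then show ?thesis using assigns_ge_gap[OF ab(3) that] 4(2) by auto
  qed
  then have "fst ` set a \<inter> fst ` set b = {}" "snd ` set a \<inter> snd ` set b = {}"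
    unfolding fst_blocks[OF ab(2)] snd_blocks[OF ab(2)] by fastforce+
  then show ?case using distinct_blocks[OF ab(2)] ab 4(1)[OF _ ab(3)] 4(2) by auto
qed auto

lemma follows_block_cells:
  assumes "a \<in> blocks l i j" "follows a Q" "t \<le> l"
  shows "{Q (j + t), Q (Suc (j + t))} = {i + t, Suc (i + t)}"
proof -
  consider "a = map (\<lambda>t. (j + t, i + t)) [0..<Suc (Suc l)]" | "l = 0" "a = [(j, Suc i), (Suc j, i)]"
    using assms(1) by (auto simp: blocks_def split: if_splits)
  then show ?thesis
  proof cases
    case 1
    have "Q (j + s) = i + s" if "s < Suc (Suc l)" for s
      using assms(2) that unfolding 1 follows_def by (auto simp del: upt_Suc)
    from this[of t] this[of "Suc t"] assms(3) show ?thesis by auto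
  next
    case 2
    then show ?thesis using assms by (auto simp: follows_def)
  qed
qed

lemma follows_cells:
  "\<phi> \<in> assigns V i j \<Longrightarrow> follows \<phi> Q \<Longrightarrow> (a, b) \<in> cells (expand V) i j \<Longrightarrow> {Q b, Q (Suc b)} = {a, Suc a}"
proof (induction V i j arbitrary: \<phi> rule: assigns.induct)
  case (4 l V i j)
  then obtain c d where cd: "\<phi> = c @ d" "c \<in> blocks l i j" "d \<in> assigns V (Suc (i + l)) (Suc (j + l))"
    by auto
  from 4(4) consider t where "a = i + t" "b = j + t" "t \<le> l" | "(a, b) \<in> cells (expand V) (Suc (i + l)) (Suc (j + l))"
    unfolding expand.simps cells_run by auto
  then show ?case
  proof cases
    case 1
    then show ?thesis using follows_block_cells[OF cd(2)] 4(3) cd(1) by auto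
  next
    case 2
    then show ?thesis using 4(1)[OF cd(3)] 4(3) cd by auto
  qed
qed auto

text \<open>For a generic word a later block starts at least two positions beyond the end of the
  current one. Consecutive prescribed positions therefore lie in one block and form one of its
  edges.\<close>

lemma generic_inner_cells:
  "generic V \<Longrightarrow> \<phi> \<in> assigns V i j \<Longrightarrow> x \<in> assign_dom \<phi> \<Longrightarrow> Suc x \<in> assign_dom \<phi> \<Longrightarrow>
    \<exists>a. (a, x) \<in> cells (expand V) i j"
proof (induction V i j arbitrary: \<phi> rule: assigns.induct)
  case (4 l V i j)
  then obtain a b where ab: "\<phi> = a @ b" "a \<in> blocks l i j" "b \<in> assigns V (Suc (i + l)) (Suc (j + l))"
    by auto
  have b: "Suc (Suc (Suc (j + l))) \<le> x" if "x \<in> assign_dom b" for x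
  proof -
    obtain y where y: "(x, y) \<in> set b" using \<open>x \<in> assign_dom b\<close> by auto
    then have "run_lens V \<noteq> []" using assigns_lens_Nil ab by force
    then show ?thesis using assigns_ge_gap[OF ab(3) y] 4(2) by auto
  qed
  have a: "assign_dom a = {j..Suc (j + l)}" using fst_blocks[OF ab(2)] .
  have x: "x \<in> assign_dom a \<or> x \<in> assign_dom b" "Suc x \<in> assign_dom a \<or> Suc x \<in> assign_dom b"
    using 4(4,5) ab by (auto simp: image_Un)
  show ?case
  proof (cases "Suc x \<in> assign_dom a")
    case True
    then have "x \<in> assign_dom a" using x b[of x] a by auto
    then have "j \<le> x" "x \<le> j + l" using True a by auto
    then have "(i + (x - j), x) \<in> {(i + t, j + t) |t. t \<le> l}" by (intro CollectI exI[of _ "x - j"]) auto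
    then show ?thesis unfolding expand.simps cells_run by blast
  next
    case False
    then have s: "Suc x \<in> assign_dom b" using x by auto
    then have "x \<in> assign_dom b" using x b[of "Suc x"] a by auto
    then show ?thesis using 4(1)[OF _ ab(3)] s 4(2) unfolding expand.simps cells_run by auto
  qed
qed auto

lemma follows_eq_map: "follows \<phi> Q \<Longrightarrow> \<phi> = map (\<lambda>x. (x, Q x)) (map fst \<phi>)"
  by (auto simp: follows_def intro!: map_idI[symmetric])

lemma map_fst_blocks: "a \<in> blocks l i j \<Longrightarrow> map fst a = map (\<lambda>t. j + t) [0..<Suc (Suc l)]"
  by (auto simp: blocks_def split: if_splits)

text \<open>All assignments of a word prescribe the same positions in the same order, so the values
  of \<open>Q\<close> determine which one it follows.\<close>

lemma assigns_unique:
  "\<phi> \<in> assigns V i j \<Longrightarrow> \<phi>' \<in> assigns V i j \<Longrightarrow> follows \<phi> Q \<Longrightarrow> follows \<phi>' Q \<Longrightarrow> \<phi> = \<phi>'"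
proof (induction V i j arbitrary: \<phi> \<phi>' rule: assigns.induct)
  case (4 l V i j)
  obtain a b where ab: "\<phi> = a @ b" "a \<in> blocks l i j" "b \<in> assigns V (Suc (i + l)) (Suc (j + l))"
    using 4(2) by auto
  obtain a' b' where ab': "\<phi>' = a' @ b'" "a' \<in> blocks l i j" "b' \<in> assigns V (Suc (i + l)) (Suc (j + l))"
    using 4(3) by auto
  have "b = b'" using 4(1)[OF ab(3) ab'(3)] 4(4,5) ab ab' by auto
  moreover have "a = a'"
    using 4(4,5) ab(1) ab'(1) follows_eq_map[of a Q] follows_eq_map[of a' Q]
      map_fst_blocks[OF ab(2)] map_fst_blocks[OF ab'(2)] by simp
  ultimately show ?case using ab ab' by simp
qed auto

text \<open>Genericity makes every orientation a partial injection, and the bounds on the letter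
  counts keep its entries below \<open>n\<close>. Without outer adjacencies, all shared edges lie
  inside blocks and are thus the prescribed ones. By \<open>assigns_unique\<close> the contributions
  of different orientations are disjoint and add up.\<close>

lemma card_compat_perms_ge:
  fixes C :: real
  assumes V: "generic V" and n: "count_list V LP + num_shared (run_lens V) < n" "count_list V LQ + num_shared (run_lens V) < n"
    and C: "\<And>D g. pinj n D g \<Longrightarrow> card D = num_fixed (run_lens V) \<Longrightarrow> C \<le> real (card {Q \<in> exts n D g. outer_adj n D Q = {}})"
  shows "num_orient (run_lens V) * C \<le> real (card (compat_perms n V))"
proof -
  let ?S = "\<lambda>\<phi>. {Q \<in> exts n (assign_dom \<phi>) (assign_fun \<phi>). outer_adj n (assign_dom \<phi>) Q = {}}"
  have P: "pinj n (assign_dom \<phi>) (assign_fun \<phi>)" "card (assign_dom \<phi>) = num_fixed (run_lens V)" "distinct (map fst \<phi>)"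
    if \<phi>: "\<phi> \<in> assigns V 0 0" for \<phi>
  proof -
    have d: "distinct (map fst \<phi>)" "distinct (map snd \<phi>)" using generic_distinct[OF V \<phi>] by auto
    show "distinct (map fst \<phi>)" by fact
    show "card (assign_dom \<phi>) = num_fixed (run_lens V)" using card_assigns_supp[OF d(1)] length_assigns[OF \<phi>] by simp
    have le: "x < n \<and> y < n" if "(x, y) \<in> set \<phi>" for x y using assigns_le[OF \<phi> that] n by auto
    show "pinj n (assign_dom \<phi>) (assign_fun \<phi>)"
      unfolding pinj_def
    proof (intro conjI inj_onI subsetI)
      fix x x' assume x: "x \<in> assign_dom \<phi>" "x' \<in> assign_dom \<phi>" and eq: "assign_fun \<phi> x = assign_fun \<phi> x'"
      obtain y y' where y: "(x, y) \<in> set \<phi>" "(x', y') \<in> set \<phi>" using x by auto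
      then have "y = y'" using eq assigns_fun_eq[OF d(1)] by metis
      then have "(x, y) = (x', y')" using y d(2) by (intro inj_onD[of snd "set \<phi>"]) (auto simp: distinct_map)
      then show "x = x'" by simp
    qed (use le assigns_fun_eq[OF d(1)] in force)+
  qed
  have sub: "?S \<phi> \<subseteq> compat_perms n V" if \<phi>: "\<phi> \<in> assigns V 0 0" for \<phi>
  proof
    fix Q assume Q: "Q \<in> ?S \<phi>"
    have Qp: "Q permutes {..<n}" "follows \<phi> Q" using Q ext_assigns_iff[OF P(3)[OF \<phi>]] by auto
    have "shared n Q = cells (expand V) 0 0"
    proof (intro equalityI subsetI)
      fix z assume z: "z \<in> shared n Q"
      obtain a b where ab: "z = (a, b)" by (cases z)
      then have b: "Suc b < n" "adj (Q b) (Q (Suc b))" "{Q b, Q (Suc b)} = {a, Suc a}"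
        using z shared_adj by (auto simp: shared_def)
      then have "b \<in> assign_dom \<phi>" "Suc b \<in> assign_dom \<phi>" using Q by (auto simp: outer_adj_def)
      then obtain a' where a': "(a', b) \<in> cells (expand V) 0 0" using generic_inner_cells[OF V \<phi>] by blast
      then have "{Q b, Q (Suc b)} = {a', Suc a'}" using follows_cells[OF \<phi> Qp(2)] by blast
      then have "a' = a" using b(3) by (auto simp: doubleton_eq_iff)
      then show "z \<in> cells (expand V) 0 0" using a' ab by simp
    next
      fix z assume z: "z \<in> cells (expand V) 0 0"
      obtain a b where ab: "z = (a, b)" by (cases z)
      have e: "{Q b, Q (Suc b)} = {a, Suc a}" using follows_cells[OF \<phi> Qp(2)] z ab by blast
      have "b \<in> assign_dom \<phi>" "Suc b \<in> assign_dom \<phi>" using cells_in_assigns[OF \<phi>] z ab by auto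
      then have n: "b < n" "Suc b < n" using P(1)[OF \<phi>] by (auto simp: pinj_def)
      then have "Q b < n" "Q (Suc b) < n" using permutes_in_image[OF Qp(1)] by auto
      then have "Suc a < n" using e by (auto simp: doubleton_eq_iff)
      then show "z \<in> shared n Q" using e n ab by (auto simp: shared_def)
    qed
    then show "Q \<in> compat_perms n V" using Qp by (auto simp: compat_perms_def)
  qed
  have "real (num_orient (run_lens V)) * C = (\<Sum>\<phi>\<in>assigns V 0 0. C)" by (simp add: card_assigns)
  also have "\<dots> \<le> (\<Sum>\<phi>\<in>assigns V 0 0. real (card (?S \<phi>)))"
    using C P by (intro sum_mono) auto
  also have "\<dots> = real (card (\<Union>\<phi>\<in>assigns V 0 0. ?S \<phi>))"
  proof (subst card_UN_disjoint)
    show "\<forall>\<phi>\<in>assigns V 0 0. \<forall>\<phi>'\<in>assigns V 0 0. \<phi> \<noteq> \<phi>' \<longrightarrow> ?S \<phi> \<inter> ?S \<phi>' = {}"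
    proof (intro ballI impI)
      fix \<phi> \<phi>' assume a: "\<phi> \<in> assigns V 0 0" "\<phi>' \<in> assigns V 0 0" "\<phi> \<noteq> \<phi>'"
      have False if "Q \<in> ?S \<phi>" "Q \<in> ?S \<phi>'" for Q
        using assigns_unique[OF a(1,2), of Q] that a(3) ext_assigns_iff P(3)[OF a(1)] P(3)[OF a(2)] by auto
      then show "?S \<phi> \<inter> ?S \<phi>' = {}" by blast
    qed
  qed (auto simp: finite_ext)
  also have "\<dots> \<le> real (card (compat_perms n V))"
    using sub finite_compat_perms by (intro of_nat_mono card_mono) auto
  finally show ?thesis .
qed

section \<open>Counting merge words\<close>

text \<open>Normality is not imposed, so that the cardinality is a product of two binomial
  coefficients. Words violating it are among the nongeneric ones by
  \<open>generic_normal\<close>.\<close>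

definition words :: "nat \<Rightarrow> nat list \<Rightarrow> letter list set" where
  "words N ls = {V. count_list V LP = N \<and> count_list V LQ = N \<and> run_lens V = ls}"

lemma shuffles_replicate_eq:
  assumes "d \<notin> set z"
  shows "shuffles z (replicate N d) = {V. filter (\<lambda>x. x \<noteq> d) V = z \<and> count_list V d = N}" (is "?A = ?B")
proof (intro equalityI subsetI)
  fix V assume V: "V \<in> ?A"
  have dis: "set z \<inter> set (replicate N d) = {}" using assms by auto
  have "set V = set z \<union> set (replicate N d)" using V by (simp add: set_shuffles)
  then have "filter (\<lambda>x. x \<noteq> d) V = filter (\<lambda>x. x \<in> set z) V"
    by (intro filter_cong) (use assms in \<open>auto split: if_splits\<close>)
  moreover have "filter (\<lambda>x. x \<in> set z) V = z" "filter (\<lambda>x. x \<notin> set z) V = replicate N d"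
    using filter_shuffles_disjoint1[OF dis V] by auto
  moreover have "filter (\<lambda>x. x \<notin> set z) V = filter (\<lambda>x. d = x) V"
    using \<open>set V = _\<close> by (intro filter_cong) (use assms in \<open>auto split: if_splits\<close>)
  ultimately show "V \<in> ?B" by (simp add: count_list_eq_length_filter)
next
  fix V assume V: "V \<in> ?B"
  have "filter (\<lambda>x. \<not> x \<noteq> d) V = replicate N d"
  proof -
    have "filter (\<lambda>x. \<not> x \<noteq> d) V = filter ((=) d) V" by (rule filter_cong) auto
    also have "\<dots> = replicate (length (filter ((=) d) V)) d"
      by (rule replicate_length_same[symmetric]) auto
    finally show ?thesis using V by (simp add: count_list_eq_length_filter)
  qed
  then show "V \<in> ?A" using partition_in_shuffles[of V "\<lambda>x. x \<noteq> d"] V by simp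
qed

lemma card_shuffles_replicate:
  assumes "d \<notin> set z"
  shows "card (shuffles z (replicate N d)) = (length z + N) choose length z"
proof -
  have "set z \<inter> set (replicate N d) = {}" using assms by auto
  from card_disjoint_shuffles[OF this] show ?thesis by simp
qed

lemma choose_double: "(N + r + N) choose (N + r) = (2 * N + r) choose N"
  using binomial_symmetric[of N "2 * N + r"] by (simp add: mult_2 add.commute add.left_commute)

lemma length_eq_counts: "length V = count_list V LP + count_list V LQ + length (run_lens V)"
  by (induction V rule: run_lens.induct) auto

lemma map_LS_lens: "filter (\<lambda>x. x \<noteq> LP) (filter (\<lambda>x. x \<noteq> LQ) V) = map LS (run_lens V)"
  by (induction V rule: run_lens.induct) auto

lemma count_list_filter_neq: "x \<noteq> d \<Longrightarrow> count_list (filter (\<lambda>x. x \<noteq> d) V) x = count_list V x"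
  by (induction V) auto

text \<open>Insert the letters \<open>LP\<close> into the sequence of runs and then the letters
  \<open>LQ\<close> into the result; deleting \<open>LQ\<close> recovers the intermediate
  word.\<close>

lemma words_eq_UN:
  "words N ls = (\<Union>z\<in>shuffles (map LS ls) (replicate N LP). shuffles z (replicate N LQ))" (is "_ = ?R")
proof -
  have Z: "shuffles (map LS ls) (replicate N LP) = {z. filter (\<lambda>x. x \<noteq> LP) z = map LS ls \<and> count_list z LP = N}"
    by (rule shuffles_replicate_eq) auto
  have S: "shuffles z (replicate N LQ) = {V. filter (\<lambda>x. x \<noteq> LQ) V = z \<and> count_list V LQ = N}"
    if z: "z \<in> shuffles (map LS ls) (replicate N LP)" for z
  proof (rule shuffles_replicate_eq)
    have "set z = set (map LS ls) \<union> set (replicate N LP)" using z by (simp add: set_shuffles)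
    then show "LQ \<notin> set z" by (auto split: if_splits)
  qed
  have "V \<in> words N ls \<longleftrightarrow> V \<in> ?R" for V
  proof
    assume V: "V \<in> words N ls"
    let ?z = "filter (\<lambda>x. x \<noteq> LQ) V"
    have z: "?z \<in> shuffles (map LS ls) (replicate N LP)"
      unfolding Z using V map_LS_lens[of V] count_list_filter_neq[of LP LQ V] by (auto simp: words_def)
    moreover have "V \<in> shuffles ?z (replicate N LQ)"
      unfolding S[OF z] using V by (auto simp: words_def)
    ultimately show "V \<in> ?R" by blast
  next
    assume "V \<in> ?R"
    then obtain z where z: "z \<in> shuffles (map LS ls) (replicate N LP)" "V \<in> shuffles z (replicate N LQ)"
      by auto
    have f: "filter (\<lambda>x. x \<noteq> LQ) V = z" "count_list V LQ = N" using z(2) unfolding S[OF z(1)] by auto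
    have "map LS (run_lens V) = map LS ls" using map_LS_lens[of V] f z(1) unfolding Z by auto
    then have "run_lens V = ls" by (simp add: inj_map_eq_map inj_def)
    then show "V \<in> words N ls" using f z(1) count_list_filter_neq[of LP LQ V] unfolding Z by (auto simp: words_def)
  qed
  then show ?thesis by blast
qed

lemma finite_words: "finite (words N ls)"
  unfolding words_eq_UN by auto

lemma card_words:
  "card (words N ls) = ((N + length ls) choose length ls) * ((2 * N + length ls) choose N)"
proof -
  let ?Z = "shuffles (map LS ls) (replicate N LP)"
  have noQ: "LQ \<notin> set z" if "z \<in> ?Z" for z
  proof -
    have "set z = set (map LS ls) \<union> set (replicate N LP)" using that by (simp add: set_shuffles)
    then show ?thesis by (auto split: if_splits)
  qed
  have S: "shuffles z (replicate N LQ) = {V. filter (\<lambda>x. x \<noteq> LQ) V = z \<and> count_list V LQ = N}"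
    if "z \<in> ?Z" for z using shuffles_replicate_eq[OF noQ[OF that]] .
  have "card (words N ls) = (\<Sum>z\<in>?Z. card (shuffles z (replicate N LQ)))"
    unfolding words_eq_UN
  proof (rule card_UN_disjoint)
    show "\<forall>z\<in>?Z. \<forall>z'\<in>?Z. z \<noteq> z' \<longrightarrow> shuffles z (replicate N LQ) \<inter> shuffles z' (replicate N LQ) = {}"
    proof (intro ballI impI)
      fix z z' assume z: "z \<in> ?Z" "z' \<in> ?Z" "z \<noteq> z'"
      show "shuffles z (replicate N LQ) \<inter> shuffles z' (replicate N LQ) = {}"
        unfolding S[OF z(1)] S[OF z(2)] using z(3) by auto
    qed
  qed auto
  also have "\<dots> = (\<Sum>z\<in>?Z. ((2 * N + length ls) choose N))"
  proof (rule sum.cong)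
    fix z assume z: "z \<in> ?Z"
    have "card (shuffles z (replicate N LQ)) = (length z + N) choose length z"
      by (rule card_shuffles_replicate[OF noQ[OF z]])
    also have "length z = N + length ls" using length_shuffles[OF z] by simp
    also have "(N + length ls + N) choose (N + length ls) = (2 * N + length ls) choose N"
      by (rule choose_double)
    finally show "card (shuffles z (replicate N LQ)) = (2 * N + length ls) choose N" .
  qed simp
  also have "\<dots> = card ?Z * ((2 * N + length ls) choose N)" by simp
  also have "card ?Z = (length ls + N) choose length ls"
    using card_shuffles_replicate[of LP "map LS ls" N] by auto
  finally show ?thesis by (simp add: add.commute)
qed

section \<open>Gap vectors and the proportion of nongeneric words\<close>

text \<open>The runs cut the word into \<open>Suc (length (run_lens V))\<close> gaps. The gaps
  before the first and after the last run are included, so that the entries sum to the number of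
  letters \<open>c\<close>.\<close>

fun gaps :: "letter \<Rightarrow> letter list \<Rightarrow> nat list" where
  "gaps c [] = [0]"
| "gaps c (LS l # V) = 0 # gaps c V"
| "gaps c (x # V) = (if x = c then Suc (hd (gaps c V)) # tl (gaps c V) else gaps c V)"

lemma length_gaps: "length (gaps c V) = Suc (length (run_lens V))"
  by (induction c V rule: gaps.induct) auto

lemma gaps_nonempty [simp]: "gaps c V \<noteq> []"
  using length_gaps[of c V] by auto

lemma hd_gaps: "hd (gaps LP V) = gap_P V" "hd (gaps LQ V) = gap_Q V"
  by (induction V rule: gap_P.induct) auto

lemma sum_gaps: "c = LP \<or> c = LQ \<Longrightarrow> sum_list (gaps c V) = count_list V c"
proof (induction c V rule: gaps.induct)
  case ("3_1" c V)
  then show ?case by (cases "gaps c V") auto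
next
  case ("3_2" c V)
  then show ?case by (cases "gaps c V") auto
qed auto

lemma nth_gaps_Cons: "x = LP \<or> x = LQ \<Longrightarrow> t > 0 \<Longrightarrow> gaps c (x # V) ! t = gaps c V ! t"
  by (cases "gaps c V"; cases t) auto

lemma genericI:
  "(\<And>t. 0 < t \<Longrightarrow> t < length (run_lens V) \<Longrightarrow> gaps LP V ! t \<ge> 2 \<and> gaps LQ V ! t \<ge> 2) \<Longrightarrow> generic V"
proof (induction V rule: generic.induct)
  case (2 l V)
  have "generic V"
    by (rule 2(1)) (use 2(2)[of "Suc _"] in auto)
  moreover have "gap_P V \<ge> 2 \<and> gap_Q V \<ge> 2" if "run_lens V \<noteq> []"
    using 2(2)[of 1] that hd_gaps[of V] by (auto simp: hd_conv_nth)
  ultimately show ?case by auto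
next
  case ("3_1" V)
  have "generic V" by (rule "3_1"(1)) (use "3_1"(2) in \<open>force simp: nth_gaps_Cons simp del: gaps.simps\<close>)
  then show ?case by simp
next
  case ("3_2" V)
  have "generic V" by (rule "3_2"(1)) (use "3_2"(2) in \<open>force simp: nth_gaps_Cons simp del: gaps.simps\<close>)
  then show ?case by simp
qed auto

text \<open>Reconstructs a word from its runs and the gap vector of \<open>c\<close>, up to the
  placement of the other letter.\<close>

fun from_gaps :: "letter \<Rightarrow> nat list \<Rightarrow> nat list \<Rightarrow> letter list" where
  "from_gaps c (a # as) [] = replicate a c"
| "from_gaps c (a # as) (l # ls) = replicate a c @ LS l # from_gaps c as ls"
| "from_gaps c [] ls = []"

lemma from_gaps_Suc: "as \<noteq> [] \<Longrightarrow> from_gaps c (Suc (hd as) # tl as) ls = c # from_gaps c as ls"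
  by (cases as; cases ls) auto

lemma filter_eq_from_gaps:
  "c = LP \<and> d = LQ \<or> c = LQ \<and> d = LP \<Longrightarrow> filter (\<lambda>x. x \<noteq> d) V = from_gaps c (gaps c V) (run_lens V)"
  by (induction c V rule: gaps.induct) (auto simp: from_gaps_Suc)

text \<open>The gap vector determines the word with all \<open>d\<close> deleted; only the insertion
  of the \<open>N\<close> letters \<open>d\<close> remains to be chosen.\<close>

lemma card_words_gaps:
  assumes cd: "c = LP \<and> d = LQ \<or> c = LQ \<and> d = LP"
  shows "card {V \<in> words N ls. gaps c V = as} \<le> (2 * N + length ls) choose N"
proof (cases "{V \<in> words N ls. gaps c V = as} = {}")
  case True
  then show ?thesis by (metis card.empty le0)
next
  case False
  let ?z = "from_gaps c as ls"
  have sub: "{V \<in> words N ls. gaps c V = as} \<subseteq> {V. filter (\<lambda>x. x \<noteq> d) V = ?z \<and> count_list V d = N}"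
    using filter_eq_from_gaps[OF cd] cd by (auto simp: words_def)
  obtain V where V: "V \<in> words N ls" "filter (\<lambda>x. x \<noteq> d) V = ?z" "count_list V d = N"
    using False sub by blast
  have dz: "d \<notin> set ?z" unfolding V(2)[symmetric] by auto
  have "length ?z = length V - count_list V d"
  proof -
    have "(\<lambda>x. x \<noteq> d) = (\<lambda>x. \<not> d = x)" by auto
    then show ?thesis
      unfolding V(2)[symmetric] count_list_eq_length_filter
      using sum_length_filter_compl[of "(=) d" V] by simp
  qed
  then have l: "length ?z = N + length ls"
    using V(1,3) length_eq_counts[of V] by (auto simp: words_def)
  have "card {V \<in> words N ls. gaps c V = as} \<le> card (shuffles ?z (replicate N d))"
    by (rule card_mono[OF finite_shuffles]) (use sub in \<open>simp only: shuffles_replicate_eq[OF dz]\<close>)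
  also have "\<dots> = (length ?z + N) choose length ?z"
    by (rule card_shuffles_replicate[OF dz])
  also have "\<dots> = (2 * N + length ls) choose N"
    unfolding l by (rule choose_double)
  finally show ?thesis .
qed

text \<open>Deleting the prescribed entry leaves \<open>r\<close> entries with sum
  \<open>N - v\<close>, which are counted by stars and bars.\<close>

lemma card_gap_vectors_le:
  assumes "t < r"
  shows "card {as :: nat list. length as = Suc r \<and> sum_list as = N \<and> as ! t = v} \<le> (N + r - 1) choose (r - 1)"
    and "finite {as :: nat list. length as = Suc r \<and> sum_list as = N \<and> as ! t = v}"
proof -
  let ?A = "{as :: nat list. length as = Suc r \<and> sum_list as = N \<and> as ! t = v}"
  let ?B = "{as :: nat list. length as = r \<and> sum_list as = N - v}"
  let ?f = "\<lambda>as :: nat list. take t as @ drop (Suc t) as"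
  have split: "as = take t as @ v # drop (Suc t) as" if "as \<in> ?A" for as
    using that assms by (auto intro!: id_take_nth_drop[of t])
  have "finite {as :: nat list. set as \<subseteq> {..N} \<and> length as = Suc r}" by (rule finite_lists_length_eq) simp
  then show fin: "finite ?A" by (rule rev_finite_subset) (auto dest: member_le_sum_list)
  show "card ?A \<le> (N + r - 1) choose (r - 1)"
  proof (cases "?A = {}")
    case True
    then show ?thesis by (metis card.empty le0)
  next
    case False
    then obtain as where "as \<in> ?A" by blast
    then have vN: "v \<le> N" using assms elem_le_sum_list[of t as] by auto
    have finB: "finite ?B"
    proof -
      have "finite {as :: nat list. set as \<subseteq> {..N} \<and> length as = r}" by (rule finite_lists_length_eq) simp
      then show ?thesis by (rule rev_finite_subset) (auto dest: member_le_sum_list)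
    qed
    have "card ?A \<le> card ?B"
    proof (rule card_inj_on_le[OF _ _ finB])
      show "inj_on ?f ?A"
      proof (rule inj_onI)
        fix as bs assume a: "as \<in> ?A" "bs \<in> ?A" and e: "?f as = ?f bs"
        have "take t as = take t bs \<and> drop (Suc t) as = drop (Suc t) bs"
          using e a assms by (subst (asm) append_eq_append_conv) auto
        then show "as = bs" using split[OF a(1)] split[OF a(2)] by metis
      qed
      show "?f ` ?A \<subseteq> ?B"
      proof
        fix bs assume "bs \<in> ?f ` ?A"
        then obtain as where as: "as \<in> ?A" "bs = ?f as" by auto
        have "sum_list as = sum_list (take t as) + v + sum_list (drop (Suc t) as)"
          using arg_cong[OF split[OF as(1)], of sum_list] by simp
        then show "bs \<in> ?B" using as assms by auto
      qed
    qed
    also have "card ?B = (N - v + r - 1) choose (N - v)" by (rule card_length_sum_list)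
    also have "\<dots> = (N - v + (r - 1)) choose (r - 1)"
      using assms by (subst binomial_symmetric) auto
    also have "\<dots> \<le> (N + r - 1) choose (r - 1)"
      using assms by (intro binomial_right_mono) auto
    finally show ?thesis .
  qed
qed

text \<open>A gap of prescribed length costs a factor \<open>O(r/N)\<close>, as the vector of gap lengths loses a free entry.\<close>

lemma card_not_generic:
  assumes "r = length ls"
  shows "(N + r) * card {V \<in> words N ls. \<not> generic V} \<le> 4 * r ^ 2 * card (words N ls)"
proof -
  let ?C = "(2 * N + r) choose N" and ?G = "(N + r - 1) choose (r - 1)"
  let ?I = "{LP, LQ} \<times> {1..<r} \<times> {0, 1 :: nat}"
  have one: "card {V \<in> words N ls. gaps c V ! t = v} \<le> ?G * ?C"
    if c: "c = LP \<and> d = LQ \<or> c = LQ \<and> d = LP" and t: "t < r" for c d t v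
  proof -
    let ?A = "{as :: nat list. length as = Suc r \<and> sum_list as = N \<and> as ! t = v}"
    have "card {V \<in> words N ls. gaps c V ! t = v} \<le> card ?A * ?C"
    proof (rule card_le_fixed_union[where S = "words N ls" and P = "\<lambda>as V. gaps c V = as"])
      show "finite ?A" using card_gap_vectors_le(2)[OF t] .
      show "card {V \<in> words N ls. gaps c V = as} \<le> ?C" for as
        using card_words_gaps[OF c, of N ls as] assms by simp
      show "{V \<in> words N ls. gaps c V ! t = v} \<subseteq> {V \<in> words N ls. \<exists>b\<in>?A. gaps c V = b}"
        using length_gaps sum_gaps[of c] c assms by (auto simp: words_def)
    qed (rule finite_words)
    also have "\<dots> \<le> ?G * ?C" using card_gap_vectors_le(1)[OF t] by (rule mult_right_mono) simp
    finally show ?thesis .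
  qed
  have "card {V \<in> words N ls. \<not> generic V} \<le> card ?I * (?G * ?C)"
  proof (rule card_le_fixed_union[where S = "words N ls" and P = "\<lambda>i V. case i of (c, t, v) \<Rightarrow> gaps c V ! t = v"])
    show "card {V \<in> words N ls. case i of (c, t, v) \<Rightarrow> gaps c V ! t = v} \<le> ?G * ?C" if "i \<in> ?I" for i
      using that one[of LP LQ] one[of LQ LP] by (auto split: prod.splits)
    show "{V \<in> words N ls. \<not> generic V} \<subseteq> {V \<in> words N ls. \<exists>i\<in>?I. case i of (c, t, v) \<Rightarrow> gaps c V ! t = v}"
    proof
      fix V assume V: "V \<in> {V \<in> words N ls. \<not> generic V}"
      then obtain t where t: "0 < t" "t < r" "\<not> (gaps LP V ! t \<ge> 2 \<and> gaps LQ V ! t \<ge> 2)"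
        using genericI[of V] assms by (auto simp: words_def)
      then obtain c where c: "c \<in> {LP, LQ}" "gaps c V ! t < 2" by (auto simp: not_le)
      then have "gaps c V ! t \<in> {0, 1}" by auto
      then have "(c, t, gaps c V ! t) \<in> ?I" using c t by auto
      then show "V \<in> {V \<in> words N ls. \<exists>i\<in>?I. case i of (c, t, v) \<Rightarrow> gaps c V ! t = v}"
        using V by (intro CollectI conjI bexI[of _ "(c, t, gaps c V ! t)"]) auto
    qed
  qed (auto simp: finite_words)
  also have "card ?I \<le> 4 * r" by (simp add: card_cartesian_product)
  finally have "card {V \<in> words N ls. \<not> generic V} \<le> 4 * r * (?G * ?C)"
    by (meson le_trans mult_right_mono zero_le)
  then have h1: "(N + r) * card {V \<in> words N ls. \<not> generic V} \<le> 4 * r * ((N + r) * ?G) * ?C"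
    by (metis (no_types, lifting) mult.assoc mult.left_commute mult_le_mono2)
  have h2: "(N + r) * ?G = r * ((N + r) choose r)" if "r > 0"
    using binomial_absorption[of "r - 1" "N + r"] that by simp
  have "(N + r) * card {V \<in> words N ls. \<not> generic V} \<le> 4 * r * (r * ((N + r) choose r)) * ?C"
  proof (cases "r > 0")
    case True
    show ?thesis using h1 unfolding h2[OF True] .
  next
    case False
    then have "r = 0" by simp
    then show ?thesis using h1 by simp
  qed
  also have "\<dots> = 4 * r ^ 2 * card (words N ls)"
    unfolding card_words assms[symmetric] by (simp add: power2_eq_square)
  finally show ?thesis .
qed

section \<open>The weight of a pattern of runs\<close>

lemma has_sum_prod_list_length:
  fixes h :: "nat \<Rightarrow> real"
  assumes h: "\<And>l. h l \<ge> 0" "(h has_sum S) UNIV"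
  shows "((\<lambda>ls. prod_list (map h ls)) has_sum S ^ r) {ls. length ls = r}"
proof (induction r)
  case 0
  have "{ls :: nat list. length ls = 0} = {[]}" by auto
  then show ?case by (simp add: has_sum_finiteI)
next
  case (Suc r)
  let ?f = "\<lambda>(l, ls). h l * prod_list (map h ls)"
  have pos: "prod_list (map h ls) \<ge> 0" for ls using h(1) by (induction ls) auto
  have f1: "((\<lambda>ls. ?f (l, ls)) has_sum h l * S ^ r) {ls. length ls = r}" for l
    using has_sum_cmult_right[OF Suc] by simp
  have g: "((\<lambda>l. h l * S ^ r) has_sum S * S ^ r) UNIV" by (rule has_sum_cmult_left[OF h(2)])
  have "?f summable_on Sigma UNIV (\<lambda>_. {ls. length ls = r})"
    by (rule summable_on_SigmaI[OF f1]) (use g h(1) pos in \<open>auto simp: summable_on_def\<close>)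
  then have "(?f has_sum S * S ^ r) (Sigma UNIV (\<lambda>_. {ls. length ls = r}))"
    by (rule has_sum_SigmaI[OF f1 g])
  moreover have "bij_betw (\<lambda>(l, ls). l # ls) (Sigma UNIV (\<lambda>_. {ls :: nat list. length ls = r})) {ls. length ls = Suc r}"
    by (rule bij_betwI[of _ _ _ "\<lambda>ls. (hd ls, tl ls)"]) (auto simp: length_Suc_conv)
  ultimately show ?case
    using has_sum_reindex_bij_betw[of "\<lambda>(l, ls). l # ls" "Sigma UNIV (\<lambda>_. {ls. length ls = r})"
        "{ls. length ls = Suc r}" "\<lambda>ls. prod_list (map h ls)" "S ^ Suc r"]
    by (simp add: case_prod_unfold)
qed

lemma has_sum_exp_series:
  fixes S :: real
  assumes "S \<ge> 0"
  shows "((\<lambda>r. S ^ r / fact r) has_sum exp S) UNIV"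
proof (rule norm_summable_imp_has_sum)
  have "(\<lambda>r. S ^ r / fact r) sums exp S"
    using exp_converges[of S] by (simp add: divide_inverse mult.commute)
  then show "(\<lambda>r. S ^ r / fact r) sums exp S" "summable (\<lambda>r. norm (S ^ r / fact r))"
    using assms by (auto simp: sums_iff)
qed

text \<open>Grouping by length gives the exponential series in \<open>S\<close>. The lemma is used
  both for the limit of the terms and for the function dominating them.\<close>

lemma has_sum_prod_list_exp:
  fixes h :: "nat \<Rightarrow> real"
  assumes h: "\<And>l. h l \<ge> 0" "(h has_sum S) UNIV"
  shows "((\<lambda>ls. prod_list (map h ls) / fact (length ls)) has_sum exp S) UNIV"
proof -
  let ?f = "\<lambda>(r, ls). prod_list (map h ls) / fact r"
  have pos: "prod_list (map h ls) \<ge> 0" for ls using h(1) by (induction ls) auto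
  have S: "S \<ge> 0" using has_sum_nonneg[OF h(2)] h(1) by auto
  have f1: "((\<lambda>ls. ?f (r, ls)) has_sum S ^ r / fact r) {ls. length ls = r}" for r
    using has_sum_cmult_left[OF has_sum_prod_list_length[OF h, of r], of "1 / fact r"] by simp
  note g = has_sum_exp_series[OF S]
  have "?f summable_on Sigma UNIV (\<lambda>r. {ls. length ls = r})"
    by (rule summable_on_SigmaI[OF f1]) (use g pos in \<open>auto simp: summable_on_def\<close>)
  then have "(?f has_sum exp S) (Sigma UNIV (\<lambda>r. {ls. length ls = r}))"
    by (rule has_sum_SigmaI[OF f1 g])
  moreover have "bij_betw (\<lambda>ls. (length ls, ls)) UNIV (Sigma UNIV (\<lambda>r. {ls :: nat list. length ls = r}))"
    by (rule bij_betwI[of _ _ _ snd]) auto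
  ultimately show ?thesis
    using has_sum_reindex_bij_betw[of "\<lambda>ls. (length ls, ls)" UNIV
        "Sigma UNIV (\<lambda>r. {ls. length ls = r})" ?f "exp S"]
    by simp
qed

section \<open>Limit and uniform bound of the main term\<close>

lemma fact_add_ratio: "a \<le> b \<Longrightarrow> (fact (M + b) :: real) = fact (M + a) * (\<Prod>i\<in>{a<..b}. real (M + i))"
proof (induction b rule: dec_induct)
  case (step b)
  have "{a<..Suc b} = insert (Suc b) {a<..b}" using step by auto
  then show ?case using step by (simp add: algebra_simps)
qed simp

text \<open>Moving factors from one factorial to the other multiplies the product by ratios that
  tend to 1 for fixed \<open>r\<close>.\<close>

lemma fact_times_fact:
  "r \<le> Suc N \<Longrightarrow> (fact (N + r) :: real) * fact (Suc N - r) =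
     real (Suc N) * fact N * fact N * (\<Prod>i\<in>{1..<r}. (real N + 1 + real i) / (real N + 1 - real i))"
proof (induction r)
  case (Suc r)
  show ?case
  proof (cases "r = 0")
    case False
    have "fact (Suc N - r) = real (Suc N - r) * fact (N - r)"
      using Suc.prems by (simp add: Suc_diff_le)
    then have a: "(fact (N - r) :: real) = fact (Suc N - r) / (real N + 1 - real r)"
      using Suc.prems by (simp add: field_simps)
    have "(fact (N + Suc r) :: real) * fact (Suc N - Suc r) =
        fact (N + r) * fact (Suc N - r) * ((real N + 1 + real r) / (real N + 1 - real r))"
      using a by (simp add: field_simps)
    moreover have "{1..<Suc r} = insert r {1..<r}" using False by auto
    ultimately show ?thesis using Suc by simp
  qed simp
qed simp

text \<open>Each ratio decreases in \<open>N\<close>. In the worst case \<open>N = r - 1\<close> the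
  product is the binomial coefficient \<open>(2 * r - 1) choose r\<close>, which is at most
  \<open>4 ^ r\<close>.\<close>

lemma prod_ratio_le_pow4:
  assumes "r \<le> Suc N"
  shows "(\<Prod>i\<in>{1..<r}. (real N + 1 + real i) / (real N + 1 - real i)) \<le> 4 ^ r"
proof (cases r)
  case (Suc s)
  have "(\<Prod>i\<in>{1..<r}. (real N + 1 + real i) / (real N + 1 - real i))
     \<le> (\<Prod>i\<in>{1..<r}. (real s + 1 + real i) / (real s + 1 - real i))"
  proof (rule prod_mono, safe)
    fix i assume i: "i \<in> {1..<r}"
    then have d: "real s + 1 - real i > 0" "real N + 1 - real i > 0" and le: "real s \<le> real N"
      using assms Suc by auto
    then show "0 \<le> (real N + 1 + real i) / (real N + 1 - real i)" by simp
    have "(real N + 1 + real i) * (real s + 1 - real i) \<le> (real s + 1 + real i) * (real N + 1 - real i)"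
      using mult_left_mono[OF le, of "2 * real i"] by (simp add: algebra_simps)
    then show "(real N + 1 + real i) / (real N + 1 - real i) \<le> (real s + 1 + real i) / (real s + 1 - real i)"
      using d by (simp add: divide_simps)
  qed
  also have "\<dots> = fact (s + r) / (fact r * fact s)"
  proof -
    define P where "P = (\<Prod>i\<in>{1..<r}. (real s + 1 + real i) / (real s + 1 - real i))"
    have "fact (s + r) * fact (Suc s - r) = real (Suc s) * fact s * fact s * P"
      using fact_times_fact[of r s] Suc unfolding P_def by blast
    then have "fact (s + r) = fact r * fact s * P" using Suc by simp
    then show ?thesis unfolding P_def[symmetric] by simp
  qed
  also have "\<dots> = real ((s + r) choose r)" by (simp add: binomial_fact)
  also have "\<dots> \<le> real (2 ^ (s + r))" using binomial_le_pow2 by (rule of_nat_mono)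
  also have "real (2 ^ (s + r)) = 2 ^ (s + r)" by simp
  also have "\<dots> \<le> 2 ^ (2 * r)" using Suc by (intro power_increasing) auto
  also have "\<dots> = 4 ^ r" by (simp add: power_mult)
  finally show ?thesis .
qed simp

text \<open>The value of \<open>(contribution of the run lengths ls) / n\<^sup>2\<close> if every word were realized by the maximal
  possible number of permutations.\<close>

definition main_term :: "nat \<Rightarrow> nat list \<Rightarrow> real" where
  "main_term n ls = real (num_orient ls) * fact n * real (card (words (n - 1 - num_shared ls) ls)) * fact (n - num_fixed ls)
     / fact (2 * (n - 1) - num_shared ls) / (real n)\<^sup>2"

lemma card_words_fact:
  "real (card (words N ls)) = fact (2 * N + length ls) / (fact N * fact N * fact (length ls))"
  unfolding card_words of_nat_mult by (subst (1 2) binomial_fact) (auto simp: mult_2)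

text \<open>In this form the limit is visible: the last product has \<open>sum_list ls\<close>
  factors, each tending to 1/2, and all other ratios tend to 1. Both products also admit bounds
  uniform in \<open>n\<close>.\<close>

lemma main_term_eq:
  assumes "num_fixed ls \<le> n" "n = N + 1 + num_shared ls"
  shows "main_term n ls = real (num_orient ls) / fact (length ls) * ((real N + 1) / real n)
     * (\<Prod>i\<in>{1..<length ls}. (real N + 1 + real i) / (real N + 1 - real i))
     * (\<Prod>i\<in>{length ls<..num_shared ls}. (real N + real i) / (2 * real N + real i))"
proof -
  let ?r = "length ls" and ?k = "num_shared ls"
  define P where "P = (\<Prod>i\<in>{1..<?r}. (real N + 1 + real i) / (real N + 1 - real i))"
  define A where "A = (\<Prod>i\<in>{?r<..?k}. real (N + i))"
  define B where "B = (\<Prod>i\<in>{?r<..?k}. real (2 * N + i))"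
  have rk: "?r \<le> ?k" by (simp add: num_shared_def)
  have rN: "?r \<le> Suc N" using assms by simp
  have AB: "(\<Prod>i\<in>{?r<..?k}. (real N + real i) / (2 * real N + real i)) = A / B"
    unfolding A_def B_def by (simp add: prod_dividef)
  have B0: "B \<noteq> 0" unfolding B_def by auto
  have f1: "(fact n :: real) = real n * (fact (N + ?r) * A)"
    using fact_add_ratio[OF rk, of N] assms(2) by (simp add: A_def)
  have f2: "(fact (2 * (n - 1) - ?k) :: real) = fact (2 * N + ?r) * B"
  proof -
    have "2 * (n - 1) - ?k = 2 * N + ?k" using assms(2) by simp
    then show ?thesis unfolding B_def by (simp only: fact_add_ratio[OF rk, of "2 * N"])
  qed
  have f3: "(fact (n - num_fixed ls) :: real) = fact (Suc N - ?r)" using assms(2) by simp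
  have f4: "fact (N + ?r) * fact (Suc N - ?r) = (real N + 1) * fact N * fact N * P"
    using fact_times_fact[OF rN] by (simp add: P_def add.commute)
  have N: "n - 1 - ?k = N" using assms(2) by simp
  have alg: "w * (n' * (f * A)) * (F / (g * g * h)) * e / (F * B) / n'\<^sup>2 = w / h * (m / n') * P * (A / B)"
    if "f * e = m * g * g * P" "F \<noteq> 0" "g \<noteq> 0" "n' \<noteq> 0" for w n' f F g h e m :: real
  proof -
    have "w * (n' * (f * A)) * (F / (g * g * h)) * e / (F * B) / n'\<^sup>2 = w * A * (f * e) / (g * g * h * B * n')"
      using that(2-) by (simp add: field_simps power2_eq_square)
    also have "\<dots> = w / h * (m / n') * P * (A / B)" unfolding that(1) using that(2-) by (simp add: mult_ac)
    finally show ?thesis .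
  qed
  show ?thesis
    unfolding main_term_def N card_words_fact AB P_def[symmetric] f1 f2 f3
    by (rule alg[OF f4]) (use assms(2) in auto)
qed

lemma main_term_tendsto:
  "(\<lambda>n. main_term n ls) \<longlonglongrightarrow> real (num_orient ls) / fact (length ls) * (1 / 2) ^ sum_list ls"
proof -
  let ?r = "length ls" and ?k = "num_shared ls"
  let ?g = "\<lambda>N. real (num_orient ls) / fact ?r * ((real N + 1) / (real N + 1 + real ?k))
     * (\<Prod>i\<in>{1..<?r}. (real N + 1 + real i) / (real N + 1 - real i))
     * (\<Prod>i\<in>{?r<..?k}. (real N + real i) / (2 * real N + real i))"
  have "?g \<longlonglongrightarrow> real (num_orient ls) / fact ?r * 1 * (\<Prod>i\<in>{1..<?r}. 1) * (\<Prod>i\<in>{?r<..?k}. 1 / 2)"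
  proof (intro tendsto_mult tendsto_prod tendsto_const)
    show "(\<lambda>N. (real N + 1) / (real N + 1 + real ?k)) \<longlonglongrightarrow> 1" by real_asymp
    show "(\<lambda>N. (real N + 1 + real i) / (real N + 1 - real i)) \<longlonglongrightarrow> 1" for i by real_asymp
    show "(\<lambda>N. (real N + real i) / (2 * real N + real i)) \<longlonglongrightarrow> 1 / 2" for i by real_asymp
  qed
  then have "?g \<longlonglongrightarrow> real (num_orient ls) / fact ?r * (1 / 2) ^ sum_list ls" by (simp add: num_shared_def)
  moreover have "filterlim (\<lambda>n. n - (1 + ?k)) at_top sequentially" by (rule filterlim_minus_const_nat_at_top)
  ultimately have lim: "(\<lambda>n. ?g (n - (1 + ?k))) \<longlonglongrightarrow> real (num_orient ls) / fact ?r * (1 / 2) ^ sum_list ls"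
    by (rule filterlim_compose)
  have "\<forall>\<^sub>F n in sequentially. ?g (n - (1 + ?k)) = main_term n ls"
    using eventually_ge_at_top[of "1 + num_fixed ls"]
  proof eventually_elim
    case (elim n)
    have "n = (n - (1 + ?k)) + 1 + ?k" using elim by simp
    moreover have "real (n - (1 + ?k)) + 1 + real ?k = real n" using elim by simp
    ultimately show ?case using main_term_eq[of ls n "n - (1 + ?k)"] elim by simp
  qed
  from Lim_transform_eventually[OF lim this] show ?thesis .
qed

definition wt_seq :: "nat \<Rightarrow> real" where
  "wt_seq l = (if l = 0 then 2 else 1)"

lemma prod_list_wt: "prod_list (map (\<lambda>l. a * wt_seq l * x ^ l) ls) = a ^ length ls * real (num_orient ls) * x ^ sum_list ls"
  by (induction ls) (auto simp: num_orient_def wt_seq_def power_add)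

text \<open>With \<open>N\<close> unshared edges and \<open>n \<le> 128 * N\<close>, all indices
  satisfy \<open>i \<le> 127 * N\<close>. As \<open>(N + i) / (2 * N + i)\<close> increases in
  \<open>i\<close>, it stays below 128 / 129. The resulting bound is independent of \<open>n\<close>
  and a product over the runs.\<close>

lemma main_term_le:
  assumes "num_fixed ls \<le> n" "num_shared ls < n" "n \<le> 128 * (n - 1 - num_shared ls)"
  shows "main_term n ls \<le> prod_list (map (\<lambda>l. 4 * wt_seq l * (128 / 129) ^ l) ls) / fact (length ls)"
proof -
  let ?r = "length ls" and ?k = "num_shared ls"
  define N where "N = n - 1 - ?k"
  have A: "n \<le> 128 * N" using assms(3) by (simp add: N_def)
  have n: "n = N + 1 + ?k" using assms by (simp add: N_def)
  have rN: "?r \<le> Suc N" using assms(1) n by simp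
  have N0: "N > 0" using A n by (cases N) auto
  have "(\<Prod>i\<in>{?r<..?k}. (real N + real i) / (2 * real N + real i)) \<le> (\<Prod>i\<in>{?r<..?k}. 128 / 129)"
  proof (rule prod_mono, safe)
    fix i assume "i \<in> {?r<..?k}"
    then have "i \<le> 127 * N" using A n by auto
    then have "real i \<le> 127 * real N" by (metis of_nat_le_iff of_nat_mult of_nat_numeral)
    then show "(real N + real i) / (2 * real N + real i) \<le> 128 / 129"
      using N0 by (simp add: divide_simps)
  qed simp
  also have "\<dots> = (128 / 129) ^ sum_list ls" by (simp add: num_shared_def)
  finally have 1: "(\<Prod>i\<in>{?r<..?k}. (real N + real i) / (2 * real N + real i)) \<le> (128 / 129) ^ sum_list ls" .
  have pos: "0 \<le> (\<Prod>i\<in>{1..<?r}. (real N + 1 + real i) / (real N + 1 - real i))"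
    using rN by (intro prod_nonneg) auto
  have "main_term n ls \<le> real (num_orient ls) / fact ?r * 1 * 4 ^ ?r * (128 / 129) ^ sum_list ls"
    unfolding main_term_eq[OF assms(1) n]
    using n 1 prod_ratio_le_pow4[OF rN] pos rN
    by (intro mult_mono prod_nonneg mult_nonneg_nonneg) auto
  then show ?thesis unfolding prod_list_wt by (simp add: mult_ac)
qed

section \<open>Patterns with few unshared edges\<close>

lemma wt_le: "num_orient ls \<le> 2 ^ length ls"
proof (induction ls)
  case (Cons l ls)
  have "num_orient (l # ls) \<le> 2 * num_orient ls" by (simp add: num_orient_def)
  then show ?case using Cons by simp
qed (simp add: num_orient_def)

lemma fact_le_power_diff: "(fact (N - s) :: real) \<le> real N ^ (N - s)"
proof -
  have "(fact (N - s) :: real) \<le> real (N - s) ^ (N - s)" using fact_le_power[where n = "N - s" and 'a = real] by simp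
  also have "\<dots> \<le> real N ^ (N - s)" by (intro power_mono) auto
  finally show ?thesis .
qed

lemma fact_add_ge: "(fact (m + N) :: real) \<ge> fact m * real (Suc m) ^ N"
proof (induction N)
  case (Suc N)
  have "fact m * real (Suc m) ^ Suc N = (fact m * real (Suc m) ^ N) * real (Suc m)" by simp
  also have "\<dots> \<le> fact (m + N) * real (Suc (m + N))" using Suc by (intro mult_mono) auto
  also have "\<dots> = fact (m + Suc N)" by simp
  finally show ?case .
qed simp

text \<open>Meant for \<open>N\<close> small compared with \<open>n\<close>, where factors
  exponential in \<open>N\<close> are affordable: binomial coefficients are replaced by powers of 2,
  and \<open>8 ^ s\<close> by \<open>8 ^ N\<close> since \<open>s \<le> N\<close>. The gain comes
  from \<open>2 * (n - 1) - num_shared ls = (n - 1) + N\<close>, which leaves \<open>N\<close>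
  factors of size at least \<open>n\<close> in the denominator.\<close>

lemma main_term_le_long:
  assumes "num_fixed ls \<le> n" "n = N + 1 + num_shared ls" "length ls = Suc s"
  shows "main_term n ls \<le> 8 / real n * (64 ^ N * (real N / real n) ^ (N - s)) / real n ^ s"
proof -
  have sN: "s \<le> N" using assms by simp
  have n0: "real n > 0" using assms by simp
  have w: "real (card (words N ls)) \<le> 2 ^ (N + Suc s) * 2 ^ (2 * N + Suc s)"
  proof -
    have "card (words N ls) \<le> 2 ^ (N + Suc s) * 2 ^ (2 * N + Suc s)"
      unfolding card_words assms(3) by (intro mult_mono binomial_le_pow2) auto
    then have "real (card (words N ls)) \<le> real (2 ^ (N + Suc s) * 2 ^ (2 * N + Suc s))" by (rule of_nat_mono)
    then show ?thesis by simp
  qed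
  have v: "real (num_orient ls) \<le> 2 ^ Suc s"
    using of_nat_mono[OF wt_le[of ls], where 'a = real] assms(3) by simp
  have m: "n - 1 = N + num_shared ls" "2 * (n - 1) - num_shared ls = (n - 1) + N" "n - 1 - num_shared ls = N" "n - num_fixed ls = N - s"
    using assms by auto
  have "fact n = real n * fact (n - 1)" using assms by simp
  moreover have "fact (n - 1) * real n ^ N \<le> (fact ((n - 1) + N) :: real)"
    using fact_add_ge[of "n - 1" N] assms(2) by simp
  ultimately have f: "fact n / (fact ((n - 1) + N) :: real) \<le> real n / real n ^ N"
    using n0 by (simp add: field_simps mult_left_mono)
  have "main_term n ls = real (num_orient ls) * real (card (words N ls)) * fact (N - s) * (fact n / fact ((n - 1) + N)) / (real n)\<^sup>2"
    unfolding main_term_def m(2-4) by simp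
  also have "\<dots> \<le> 2 ^ Suc s * (2 ^ (N + Suc s) * 2 ^ (2 * N + Suc s)) * real N ^ (N - s) * (real n / real n ^ N) / (real n)\<^sup>2"
    using v w f fact_le_power_diff[of N s]
    by (intro divide_right_mono mult_mono mult_nonneg_nonneg) auto
  also have "2 ^ Suc s * (2 ^ (N + Suc s) * 2 ^ (2 * N + Suc s)) = (8 * (8 ^ N * 8 ^ s) :: real)"
  proof -
    have "(8 :: real) ^ N = 2 ^ N * 2 ^ (2 * N)" by (simp add: power_mult flip: power_mult_distrib)
    moreover have "(8 :: real) ^ s = 2 ^ s * 2 ^ s * 2 ^ s" by (simp flip: power_mult_distrib)
    ultimately show ?thesis by (simp add: power_add)
  qed
  also have "8 * (8 ^ N * 8 ^ s) * real N ^ (N - s) * (real n / real n ^ N) / (real n)\<^sup>2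
      \<le> 8 * (8 ^ N * 8 ^ N) * real N ^ (N - s) * (real n / real n ^ N) / (real n)\<^sup>2"
    using sN by (intro divide_right_mono mult_right_mono mult_left_mono power_increasing) auto
  also have "real n ^ N = real n ^ (N - s) * real n ^ s" using sN by (simp flip: power_add)
  also have "8 * (8 ^ N * 8 ^ N) * real N ^ (N - s) * (real n / (real n ^ (N - s) * real n ^ s)) / (real n)\<^sup>2
      = 8 / real n * (64 ^ N * (real N / real n) ^ (N - s)) / real n ^ s"
    using n0 by (simp add: power_divide power2_eq_square flip: power_mult_distrib)
  finally show ?thesis .
qed

text \<open>Adding 1 to each entry gives the compositions of \<open>k\<close> into
  \<open>Suc s\<close> positive parts, of which there are \<open>(k - 1) choose s\<close>. The power
  \<open>k ^ s\<close> will cancel against \<open>real n ^ s\<close> in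
  \<open>main_term_le_long\<close>, and \<open>fact s\<close> makes the sum over \<open>s\<close>
  converge.\<close>

lemma card_lists_nk:
  shows "card {ls. length ls = Suc s \<and> num_shared ls = k} * fact s \<le> k ^ s"
    and "finite {ls. length ls = Suc s \<and> num_shared ls = k}"
proof -
  let ?A = "{ls. length ls = Suc s \<and> num_shared ls = k}"
  have "finite {as :: nat list. set as \<subseteq> {..k} \<and> length as = Suc s}" by (rule finite_lists_length_eq) simp
  then show "finite ?A" by (rule rev_finite_subset) (auto simp: num_shared_def dest: member_le_sum_list)
  show "card ?A * fact s \<le> k ^ s"
  proof (cases "Suc s \<le> k")
    case True
    then have "?A = {ls. length ls = Suc s \<and> sum_list ls = k - Suc s}" by (auto simp: num_shared_def)
    then have "card ?A = (k - Suc s + Suc s - 1) choose (k - Suc s)" by (simp only: card_length_sum_list)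
    also have "\<dots> = (k - 1) choose s" using True by (subst binomial_symmetric) auto
    finally have "card ?A * fact s = fact s * ((k - 1) choose s)" by simp
    also have "\<dots> \<le> (k - 1) ^ s" using binomial_fact_pow[of "k - 1" s] by (simp add: mult.commute)
    also have "\<dots> \<le> k ^ s" by (intro power_mono) auto
    finally show ?thesis .
  next
    case False
    then have "?A = {}" by (auto simp: num_shared_def)
    then show ?thesis by (simp only: card.empty)
  qed
qed

text \<open>For \<open>N = n - 1 - k\<close> unshared edges and \<open>s + 1\<close> runs, the terms sum up to at most
  \<open>8 / n * 64\<^sup>N * (N / n)\<^sup>N\<^sup>-\<^sup>s / s!\<close>; the threshold \<open>N / n < 1 / 128\<close> turns this into a convergent
  double series.\<close>

lemma sum_main_term_long_le:
  assumes "n \<ge> 2"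
  shows "(\<Sum>ls | num_fixed ls \<le> n \<and> num_shared ls < n \<and> \<not> n \<le> 128 * (n - 1 - num_shared ls). main_term n ls)
     \<le> 16 * exp 128 / real n" (is "sum _ ?A \<le> _")
proof -
  have n0: "real n > 0" using assms by simp
  have finA: "finite ?A"
  proof -
    have "finite {ls :: nat list. set ls \<subseteq> {..n} \<and> length ls \<le> n}" by (rule finite_lists_length_le) simp
    then show ?thesis by (rule rev_finite_subset) (auto simp: num_shared_def dest: member_le_sum_list)
  qed
  let ?g = "\<lambda>ls. (n - 1 - num_shared ls, length ls - 1)"
  let ?T = "{..<n} \<times> {..<n}"
  have inner: "(\<Sum>ls\<in>{ls \<in> ?A. ?g ls = (N, s)}. main_term n ls) \<le> 8 / real n * ((1 / 2) ^ N * (128 ^ s / fact s))" for N s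
  proof (cases "{ls \<in> ?A. ?g ls = (N, s)} = {}")
    case True
    then show ?thesis unfolding True by simp
  next
    case False
    let ?B = "{ls \<in> ?A. ?g ls = (N, s)}"
    have B: "length ls = Suc s" "num_shared ls = n - 1 - N" "n = N + 1 + num_shared ls" "num_fixed ls \<le> n" "128 * N < n" if "ls \<in> ?B" for ls
    proof -
      have "ls \<noteq> []" using that assms by (auto simp: num_shared_def)
      then have "length ls \<noteq> 0" by simp
      then show "length ls = Suc s" "num_shared ls = n - 1 - N" "n = N + 1 + num_shared ls" "num_fixed ls \<le> n" "128 * N < n" using that by auto
    qed
    obtain ls0 where ls0: "ls0 \<in> ?B" using False by blast
    have sN: "s \<le> N" and Nn: "128 * real N \<le> real n" using B[OF ls0] by auto
    let ?C = "{ls. length ls = Suc s \<and> num_shared ls = n - 1 - N}"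
    let ?t = "8 / real n * (64 ^ N * (real N / real n) ^ (N - s)) / real n ^ s"
    have "(\<Sum>ls\<in>?B. main_term n ls) \<le> (\<Sum>ls\<in>?B. ?t)"
      by (rule sum_mono, rule main_term_le_long) (use B in blast)+
    also have "\<dots> = real (card ?B) * ?t" by (rule sum_constant)
    also have "\<dots> \<le> (real n ^ s / fact s) * ?t"
    proof (rule mult_right_mono)
      have "card ?B \<le> card ?C" by (rule card_mono[OF card_lists_nk(2)]) (use B(1,2) in blast)
      then have "card ?B * fact s \<le> card ?C * fact s" by simp
      also have "\<dots> \<le> (n - 1 - N) ^ s" by (rule card_lists_nk(1))
      also have "\<dots> \<le> n ^ s" by (intro power_mono) auto
      finally have "real (card ?B * fact s) \<le> real (n ^ s)" by (rule of_nat_mono)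
      then show "real (card ?B) \<le> real n ^ s / fact s" by (simp add: field_simps)
    qed simp
    also have "\<dots> = 8 / real n * ((64 ^ N * (real N / real n) ^ (N - s)) * (1 / fact s))" using n0 by simp
    also have "\<dots> \<le> 8 / real n * ((64 ^ N * (1 / 128) ^ (N - s)) * (1 / fact s))"
      using n0 Nn by (intro mult_left_mono mult_right_mono power_mono) (auto simp: field_simps)
    also have "(64 :: real) ^ N * (1 / 128) ^ (N - s) = (1 / 2) ^ N * 128 ^ s"
    proof -
      have "(128 :: real) ^ N = 128 ^ (N - s) * 128 ^ s" using sN by (simp flip: power_add)
      moreover have "(64 :: real) ^ N = (1 / 2) ^ N * 128 ^ N" by (simp flip: power_mult_distrib)
      ultimately show ?thesis by (simp add: power_divide)
    qed
    finally show ?thesis by simp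
  qed
  have "sum (main_term n) ?A = (\<Sum>y\<in>?T. \<Sum>ls\<in>{ls \<in> ?A. ?g ls = y}. main_term n ls)"
  proof (rule sum.group[symmetric, OF finA])
    show "?g ` ?A \<subseteq> ?T" using assms by (auto simp: num_shared_def)
  qed simp
  also have "\<dots> \<le> (\<Sum>(N, s)\<in>?T. 8 / real n * ((1 / 2) ^ N * (128 ^ s / fact s)))"
    by (rule sum_mono) (use inner in auto)
  also have "\<dots> = 8 / real n * ((\<Sum>N<n. (1 / 2) ^ N) * (\<Sum>s<n. 128 ^ s / fact s))"
    by (subst sum_product) (simp only: sum.cartesian_product sum_distrib_left case_prod_unfold)
  also have "\<dots> \<le> 8 / real n * (2 * exp 128)"
  proof (intro mult_left_mono mult_mono)
    have "(\<Sum>N<n. (1 / 2 :: real) ^ N) \<le> (\<Sum>N. (1 / 2) ^ N)" by (intro sum_le_suminf) auto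
    then show "(\<Sum>N<n. (1 / 2 :: real) ^ N) \<le> 2" by (simp add: suminf_geometric)
    have e: "(\<lambda>s. 128 ^ s / fact s :: real) sums exp 128"
      using exp_converges[of "128 :: real"] by (simp add: divide_inverse mult.commute)
    then have "(\<Sum>s<n. 128 ^ s / fact s :: real) \<le> (\<Sum>s. 128 ^ s / fact s)"
      by (intro sum_le_suminf) (auto simp: sums_iff)
    then show "(\<Sum>s<n. 128 ^ s / fact s :: real) \<le> exp 128" using e by (simp add: sums_iff)
  qed (auto intro: sum_nonneg)
  finally show ?thesis by simp
qed

section \<open>The second moment as a sum over patterns of runs\<close>

definition path_edges :: "nat list \<Rightarrow> nat set list" where
  "path_edges p = map (\<lambda>i. {p ! i, p ! Suc i}) [0..<length p - 1]"

lemma length_path_edges [simp]: "length (path_edges p) = length p - 1"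
  by (simp add: path_edges_def)

lemma nth_path_edges: "i < length p - 1 \<Longrightarrow> path_edges p ! i = {p ! i, p ! Suc i}"
  by (simp add: path_edges_def)

lemma increasing_path_iff_sorted:
  "increasing_path f p \<longleftrightarrow> sorted_wrt (<) (map f (path_edges p))"
  by (subst sorted_wrt_iff_nth_Suc_transp)
    (auto simp: increasing_path_def nth_path_edges less_diff_conv)

lemma hamiltonian_pathD:
  assumes "p \<in> hamiltonian_paths n"
  shows "distinct p" "set p = {1..n}" "length p = n"
  using assms distinct_card[of p] by (auto simp: hamiltonian_paths_def vertices_K_def permutations_of_set_def)

lemma distinct_path_edges:
  assumes "distinct p" shows "distinct (path_edges p)"
  unfolding distinct_conv_nth
proof (intro allI impI)
  fix i j assume ij: "i < length (path_edges p)" "j < length (path_edges p)" "i \<noteq> j"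
  then have "{p ! i, p ! Suc i} \<noteq> {p ! j, p ! Suc j}"
    using assms by (auto simp: doubleton_eq_iff nth_eq_iff_index_eq)
  then show "path_edges p ! i \<noteq> path_edges p ! j" using ij by (simp add: nth_path_edges)
qed

lemma path_edges_subset:
  assumes "p \<in> hamiltonian_paths n" shows "set (path_edges p) \<subseteq> edges_K n"
proof
  fix e assume "e \<in> set (path_edges p)"
  then obtain i where i: "i < length p - 1" "e = {p ! i, p ! Suc i}" by (auto simp: path_edges_def)
  note p = hamiltonian_pathD[OF assms]
  have "p ! i \<noteq> p ! Suc i" using i p by (auto simp: nth_eq_iff_index_eq)
  moreover have "p ! i \<in> set p" "p ! Suc i \<in> set p" using i by auto
  ultimately show "e \<in> edges_K n"
    using i p unfolding edges_K_def vertices_K_def nsets_def by auto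
qed

text \<open>Describing the second path relative to the first makes the count of pairs independent of
  the first path.\<close>

lemma bij_betw_permute_list:
  assumes "p \<in> hamiltonian_paths n"
  shows "bij_betw (\<lambda>Q. permute_list Q p) {Q. Q permutes {..<n}} (hamiltonian_paths n)"
proof -
  note p = hamiltonian_pathD[OF assms]
  have inj: "inj_on (\<lambda>Q. permute_list Q p) {Q. Q permutes {..<n}}"
  proof (rule inj_onI)
    fix Q R assume Q: "Q \<in> {Q. Q permutes {..<n}}" "R \<in> {Q. Q permutes {..<n}}"
      and e: "permute_list Q p = permute_list R p"
    show "Q = R"
    proof
      fix i
      show "Q i = R i"
      proof (cases "i < n")
        case True
        then have "p ! Q i = p ! R i"
          using arg_cong[OF e, of "\<lambda>xs. xs ! i"] Q p by (simp add: permute_list_nth)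
        moreover have "Q i < n" "R i < n"
          using True Q permutes_in_image[of Q "{..<n}" i] permutes_in_image[of R "{..<n}" i] by auto
        ultimately show ?thesis using p by (simp add: nth_eq_iff_index_eq)
      qed (use Q in \<open>auto simp: permutes_def\<close>)
    qed
  qed
  have sub: "(\<lambda>Q. permute_list Q p) ` {Q. Q permutes {..<n}} \<subseteq> hamiltonian_paths n"
  proof safe
    fix Q assume "Q permutes {..<n}"
    then have Q: "Q permutes {..<length p}" using p by simp
    show "permute_list Q p \<in> hamiltonian_paths n"
      unfolding hamiltonian_paths_def vertices_K_def
      using set_permute_list[OF Q] distinct_permute_list[OF Q] p by (intro permutations_of_setI) simp_all
  qed
  have "card ((\<lambda>Q. permute_list Q p) ` {Q. Q permutes {..<n}}) = card (hamiltonian_paths n)"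
    using inj by (simp add: card_image card_permutations hamiltonian_paths_def vertices_K_def)
  then have "(\<lambda>Q. permute_list Q p) ` {Q. Q permutes {..<n}} = hamiltonian_paths n"
    using sub by (intro card_subset_eq) (auto simp: hamiltonian_paths_def)
  with inj show ?thesis by (simp add: bij_betw_def)
qed

text \<open>Here the path \<open>p\<close> disappears: the pattern of common edges depends on
  \<open>Q\<close> alone.\<close>

lemma coincidences_path_edges:
  assumes "p \<in> hamiltonian_paths n" "Q permutes {..<n}"
  shows "coincidences (path_edges p) (path_edges (permute_list Q p)) 0 0 = shared n Q"
proof -
  note p = hamiltonian_pathD[OF assms(1)]
  have "path_edges p ! a = path_edges (permute_list Q p) ! b \<longleftrightarrow> {Q b, Q (Suc b)} = {a, Suc a}"
    if "Suc a < n" "Suc b < n" for a b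
  proof -
    have q: "Q b < n" "Q (Suc b) < n"
      using that assms(2) permutes_in_image[of Q "{..<n}" b] permutes_in_image[of Q "{..<n}" "Suc b"] by auto
    have inj: "inj_on ((!) p) {..<n}" using p by (auto simp: inj_on_def nth_eq_iff_index_eq)
    have "path_edges p ! a = path_edges (permute_list Q p) ! b
       \<longleftrightarrow> (!) p ` {a, Suc a} = (!) p ` {Q b, Q (Suc b)}"
      using that p assms(2) by (simp add: nth_path_edges permute_list_nth)
    also have "\<dots> \<longleftrightarrow> {a, Suc a} = {Q b, Q (Suc b)}"
      using that q by (intro inj_on_image_eq_iff[OF inj]) auto
    finally show ?thesis by (simp only: eq_commute)
  qed
  then show ?thesis using p by (auto simp: coincidences_def shared_def less_diff_conv)
qed

lemma card_set_Un_coincidences: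
  assumes "distinct xs" "distinct ys"
  shows "card (set xs \<union> set ys) + card (coincidences xs ys 0 0) = length xs + length ys"
proof -
  have "bij_betw (\<lambda>(a, b). xs ! a) (coincidences xs ys 0 0) (set xs \<inter> set ys)"
    unfolding bij_betw_def
  proof
    show "inj_on (\<lambda>(a, b). xs ! a) (coincidences xs ys 0 0)"
    proof (rule inj_onI)
      fix z z' assume z: "z \<in> coincidences xs ys 0 0" "z' \<in> coincidences xs ys 0 0"
        and e: "(\<lambda>(a, b). xs ! a) z = (\<lambda>(a, b). xs ! a) z'"
      then obtain a b a' b' where ab: "z = (a, b)" "z' = (a', b')" "a < length xs" "a' < length xs"
        "b < length ys" "b' < length ys" "xs ! a = ys ! b" "xs ! a' = ys ! b'"
        by (auto simp: coincidences_def)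
      then have x: "xs ! a = xs ! a'" using e by simp
      have "a = a'" using nth_eq_iff_index_eq[OF assms(1) ab(3,4)] x by simp
      moreover have "b = b'" using nth_eq_iff_index_eq[OF assms(2) ab(5,6)] x ab(7,8) by simp
      ultimately show "z = z'" using ab(1,2) by simp
    qed
    show "(\<lambda>(a, b). xs ! a) ` coincidences xs ys 0 0 = set xs \<inter> set ys"
    proof (intro equalityI subsetI)
      fix x assume "x \<in> set xs \<inter> set ys"
      then obtain a b where "a < length xs" "b < length ys" "xs ! a = x" "ys ! b = x"
        by (auto simp: in_set_conv_nth)
      then show "x \<in> (\<lambda>(a, b). xs ! a) ` coincidences xs ys 0 0"
        by (intro image_eqI[of _ _ "(a, b)"]) (auto simp: coincidences_def)
    next
      fix x assume "x \<in> (\<lambda>(a, b). xs ! a) ` coincidences xs ys 0 0"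
      then obtain a b where "a < length xs" "b < length ys" "x = xs ! a" "x = ys ! b"
        by (auto simp: coincidences_def)
      then show "x \<in> set xs \<inter> set ys" by (metis IntI nth_mem)
    qed
  qed
  then have "card (coincidences xs ys 0 0) = card (set xs \<inter> set ys)" by (rule bij_betw_same_card)
  moreover have "card (set xs) = length xs" "card (set ys) = length ys" using assms by (simp_all add: distinct_card)
  ultimately show ?thesis using card_Un_Int[of "set xs" "set ys"] by simp
qed

lemma filter_expand:
  "length (filter (\<lambda>s. s \<noteq> SQ) (expand V)) = count_list V LP + num_shared (run_lens V)"
  "length (filter (\<lambda>s. s \<noteq> SP) (expand V)) = count_list V LQ + num_shared (run_lens V)"
  "length (filter (\<lambda>s. s = SD) (expand V)) = num_shared (run_lens V)"
  by (induction V rule: expand.induct) (auto simp: num_shared_def)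

lemma finite_cells [simp]: "finite (cells w i j)"
  by (induction w i j rule: cells.induct) auto

lemma card_cells: "card (cells w i j) = length (filter (\<lambda>s. s = SD) w)"
proof (induction w i j rule: cells.induct)
  case (4 w i j)
  have "(i, j) \<notin> cells w (Suc i) (Suc j)" using cells_ge by fastforce
  then show ?case using 4 by simp
qed auto

definition normal_words :: "nat \<Rightarrow> letter list set" where
  "normal_words n = {V. normal V \<and> count_list V LP + num_shared (run_lens V) = n - 1 \<and> count_list V LQ + num_shared (run_lens V) = n - 1}"

lemma card_compat_eq:
  assumes "p \<in> hamiltonian_paths n" "Q permutes {..<n}"
  shows "card {w. merge_word w (path_edges p) (path_edges (permute_list Q p))}
     = card {V \<in> normal_words n. Q \<in> compat_perms n V}"
proof -
  note p = hamiltonian_pathD[OF assms(1)]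
  have q: "permute_list Q p \<in> hamiltonian_paths n"
    using bij_betw_permute_list[OF assms(1)] assms(2) by (auto simp: bij_betw_def)
  have "{w. merge_word w (path_edges p) (path_edges (permute_list Q p))}
     = expand ` {V \<in> normal_words n. Q \<in> compat_perms n V}" (is "?L = expand ` ?R")
  proof -
    have iff: "merge_word (expand V) (path_edges p) (path_edges (permute_list Q p))
       \<longleftrightarrow> count_list V LP + num_shared (run_lens V) = n - 1 \<and> count_list V LQ + num_shared (run_lens V) = n - 1
         \<and> cells (expand V) 0 0 = shared n Q" for V
      using merge_word_iff_cells[OF distinct_path_edges[OF p(1)] distinct_path_edges[OF hamiltonian_pathD(1)[OF q]],
          of "expand V" 0 0] p hamiltonian_pathD(3)[OF q]
      by (simp add: filter_expand coincidences_path_edges[OF assms])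
    have "w \<in> ?L \<longleftrightarrow> w \<in> expand ` ?R" for w
    proof
      assume "w \<in> ?L"
      then have "compress w \<in> ?R"
        using iff[of "compress w"] assms(2)
        by (auto simp: expand_compress normal_compress normal_words_def compat_perms_def)
      then show "w \<in> expand ` ?R" by (metis expand_compress image_eqI)
    next
      assume "w \<in> expand ` ?R"
      then show "w \<in> ?L" using iff by (auto simp: normal_words_def compat_perms_def)
    qed
    then show ?thesis by blast
  qed
  moreover have "inj_on expand ?R"
    using bij_betw_expand by (auto simp: bij_betw_def normal_words_def intro: inj_on_subset)
  ultimately show ?thesis by (simp add: card_image)
qed

section \<open>Expansion of the second moment\<close>

text \<open>The contribution of the run lengths \<open>ls\<close> to the second moment, divided by
  \<open>(real n)\<^sup>2\<close>: \<open>fact n\<close> counts the first paths, and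
  \<open>2 * (n - 1) - num_shared ls\<close> is the number of distinct edges in the two
  paths.\<close>

definition run_term :: "nat \<Rightarrow> nat list \<Rightarrow> real" where
  "run_term n ls = fact n * (\<Sum>V | V \<in> words (n - 1 - num_shared ls) ls \<and> normal V. real (card (compat_perms n V)))
     / fact (2 * (n - 1) - num_shared ls) / (real n)\<^sup>2"

lemma finite_nk_less: "finite {ls. num_shared ls < n}"
proof -
  have "finite {ls :: nat list. set ls \<subseteq> {..n} \<and> length ls \<le> n}" by (rule finite_lists_length_le) simp
  then show ?thesis by (rule rev_finite_subset) (auto simp: num_shared_def dest: member_le_sum_list)
qed

lemma normal_words_eq:
  assumes "n > 0"
  shows "normal_words n = (\<Union>ls\<in>{ls. num_shared ls < n}. {V. V \<in> words (n - 1 - num_shared ls) ls \<and> normal V})"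
  using assms by (auto simp: normal_words_def words_def)

lemma card_orderings_increasing_pair:
  assumes "p \<in> hamiltonian_paths n" "Q permutes {..<n}"
  shows "real (card {f \<in> edge_orderings n. increasing_path f p \<and> increasing_path f (permute_list Q p)})
     = real (card (edge_orderings n))
       * (\<Sum>V | V \<in> normal_words n \<and> Q \<in> compat_perms n V. 1 / fact (2 * (n - 1) - num_shared (run_lens V)))"
proof -
  let ?q = "permute_list Q p"
  let ?xs = "path_edges p" and ?ys = "path_edges ?q"
  note p = hamiltonian_pathD[OF assms(1)]
  have q: "?q \<in> hamiltonian_paths n"
    using bij_betw_permute_list[OF assms(1)] assms(2) by (auto simp: bij_betw_def)
  have d: "distinct ?xs" "distinct ?ys"
    using distinct_path_edges p(1) hamiltonian_pathD(1)[OF q] by auto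
  have U: "card (set ?xs \<union> set ?ys) = 2 * (n - 1) - card (shared n Q)"
    using card_set_Un_coincidences[OF d] p(3) hamiltonian_pathD(3)[OF q] coincidences_path_edges[OF assms]
    by simp
  have "card {f \<in> edge_orderings n. increasing_path f p \<and> increasing_path f ?q} * fact (card (set ?xs \<union> set ?ys))
      = card (edge_orderings n) * card {V \<in> normal_words n. Q \<in> compat_perms n V}"
    unfolding increasing_path_iff_sorted card_compat_eq[OF assms, symmetric] card_merges[OF d, symmetric]
    using card_orderings_increasing_two[OF d, of n] path_edges_subset[OF assms(1)] path_edges_subset[OF q] by simp
  from arg_cong[OF this, of real]
  have "real (card {f \<in> edge_orderings n. increasing_path f p \<and> increasing_path f ?q})
     = real (card (edge_orderings n)) * (real (card {V \<in> normal_words n. Q \<in> compat_perms n V}) / fact (2 * (n - 1) - card (shared n Q)))"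
    unfolding U by (simp add: field_simps)
  also have "real (card {V \<in> normal_words n. Q \<in> compat_perms n V}) / fact (2 * (n - 1) - card (shared n Q))
     = (\<Sum>V | V \<in> normal_words n \<and> Q \<in> compat_perms n V. 1 / fact (2 * (n - 1) - card (shared n Q)))"
    by simp
  also have "\<dots> = (\<Sum>V | V \<in> normal_words n \<and> Q \<in> compat_perms n V. 1 / fact (2 * (n - 1) - num_shared (run_lens V)))"
    by (rule sum.cong) (auto simp: compat_perms_def card_cells filter_expand)
  finally show ?thesis .
qed

text \<open>Expand the square over pairs of paths and write the second path as a permutation of the
  first. Exchanging the sums over permutations and words leaves, for each word, the number of its
  compatible permutations.\<close>

lemma second_moment_eq:
  assumes n: "n > 0"
  shows "measure_pmf.expectation (random_edge_ordering n) (\<lambda>f. (real (num_increasing_paths n f))\<^sup>2)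
     = (real n)\<^sup>2 * (\<Sum>ls | num_shared ls < n. run_term n ls)"
proof -
  let ?F = "edge_orderings n" and ?H = "hamiltonian_paths n" and ?P = "{Q. Q permutes {..<n}}"
  have finH: "finite ?H" by (simp add: hamiltonian_paths_def)
  have finP: "finite ?P" by (simp add: finite_permutations)
  have cH: "card ?H = fact n" by (simp add: hamiltonian_paths_def vertices_K_def)
  have F0: "real (card ?F) \<noteq> 0" using edge_orderings_nonempty finite_edge_orderings by simp
  have finW: "finite (normal_words n)"
    unfolding normal_words_eq[OF n] using finite_nk_less finite_words by auto
  have sq: "(real (num_increasing_paths n f))\<^sup>2
     = (\<Sum>p\<in>?H. \<Sum>q\<in>?H. if increasing_path f p \<and> increasing_path f q then 1 else 0)" for f
  proof -
    have "real (num_increasing_paths n f) = (\<Sum>p\<in>?H. if increasing_path f p then 1 else 0)"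
      using finH by (simp add: num_increasing_paths_def sum.If_cases Int_def)
    then have "(real (num_increasing_paths n f))\<^sup>2
      = (\<Sum>p\<in>?H. \<Sum>q\<in>?H. (if increasing_path f p then 1 else 0) * (if increasing_path f q then 1 else 0))"
      by (simp add: power2_eq_square sum_product)
    also have "\<dots> = (\<Sum>p\<in>?H. \<Sum>q\<in>?H. if increasing_path f p \<and> increasing_path f q then 1 else 0)"
      by (intro sum.cong) auto
    finally show ?thesis .
  qed
  have inner: "(\<Sum>f\<in>?F. if increasing_path f p \<and> increasing_path f q then 1 else 0 :: real)
     = real (card {f \<in> ?F. increasing_path f p \<and> increasing_path f q})" for p q
    using finite_edge_orderings by (simp add: sum.If_cases Int_def)
  let ?w = "\<lambda>V. 1 / fact (2 * (n - 1) - num_shared (run_lens V)) :: real"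
  have pair: "(\<Sum>q\<in>?H. real (card {f \<in> ?F. increasing_path f p \<and> increasing_path f q}))
     = real (card ?F) * (\<Sum>V\<in>normal_words n. real (card (compat_perms n V)) * ?w V)" if p: "p \<in> ?H" for p
  proof -
    have "(\<Sum>q\<in>?H. real (card {f \<in> ?F. increasing_path f p \<and> increasing_path f q}))
       = (\<Sum>Q\<in>?P. real (card {f \<in> ?F. increasing_path f p \<and> increasing_path f (permute_list Q p)}))"
      by (rule sum.reindex_bij_betw[OF bij_betw_permute_list[OF p], symmetric])
    also have "\<dots> = (\<Sum>Q\<in>?P. real (card ?F) * (\<Sum>V | V \<in> normal_words n \<and> Q \<in> compat_perms n V. ?w V))"
      by (rule sum.cong) (use card_orderings_increasing_pair[OF p] in auto)
    also have "\<dots> = real (card ?F) * (\<Sum>Q\<in>?P. \<Sum>V\<in>normal_words n. if Q \<in> compat_perms n V then ?w V else 0)"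
      unfolding sum_distrib_left[symmetric] sum.inter_filter[OF finW] ..
    also have "(\<Sum>Q\<in>?P. \<Sum>V\<in>normal_words n. if Q \<in> compat_perms n V then ?w V else 0)
       = (\<Sum>V\<in>normal_words n. \<Sum>Q\<in>?P. if Q \<in> compat_perms n V then ?w V else 0)"
      by (rule sum.swap)
    also have "\<dots> = (\<Sum>V\<in>normal_words n. real (card (compat_perms n V)) * ?w V)"
    proof (rule sum.cong)
      fix V
      have "?P \<inter> compat_perms n V = compat_perms n V" by (auto simp: compat_perms_def)
      then show "(\<Sum>Q\<in>?P. if Q \<in> compat_perms n V then ?w V else 0) = real (card (compat_perms n V)) * ?w V"
        using finP by (simp add: sum.If_cases)
    qed simp
    finally show ?thesis .
  qed
  have "measure_pmf.expectation (random_edge_ordering n) (\<lambda>f. (real (num_increasing_paths n f))\<^sup>2)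
     = (\<Sum>f\<in>?F. (real (num_increasing_paths n f))\<^sup>2) / real (card ?F)"
    unfolding random_edge_ordering_def
    by (rule integral_pmf_of_set[OF edge_orderings_nonempty finite_edge_orderings])
  also have "(\<Sum>f\<in>?F. (real (num_increasing_paths n f))\<^sup>2)
     = (\<Sum>p\<in>?H. \<Sum>q\<in>?H. \<Sum>f\<in>?F. if increasing_path f p \<and> increasing_path f q then 1 else 0)"
    unfolding sq by (subst sum.swap, rule sum.cong[OF refl], rule sum.swap)
  also have "\<dots> = (\<Sum>p\<in>?H. real (card ?F) * (\<Sum>V\<in>normal_words n. real (card (compat_perms n V)) * ?w V))"
    unfolding inner by (rule sum.cong) (use pair in auto)
  also have "\<dots> / real (card ?F) = fact n * (\<Sum>V\<in>normal_words n. real (card (compat_perms n V)) * ?w V)"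
    using F0 cH by simp
  also have "(\<Sum>V\<in>normal_words n. real (card (compat_perms n V)) * ?w V)
    = (\<Sum>ls | num_shared ls < n. \<Sum>V | V \<in> words (n - 1 - num_shared ls) ls \<and> normal V. real (card (compat_perms n V)) * ?w V)"
    unfolding normal_words_eq[OF n]
  proof (rule sum.UNION_disjoint[OF finite_nk_less])
    show "\<forall>ls\<in>{ls. num_shared ls < n}. finite {V. V \<in> words (n - 1 - num_shared ls) ls \<and> normal V}"
      using finite_words by simp
  qed (auto simp: words_def)
  also have "fact n * \<dots> = (\<Sum>ls | num_shared ls < n. (real n)\<^sup>2 * run_term n ls)"
    unfolding sum_distrib_left
  proof (rule sum.cong[OF refl])
    fix ls
    have "(\<Sum>V | V \<in> words (n - 1 - num_shared ls) ls \<and> normal V. fact n * (real (card (compat_perms n V)) * ?w V))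
      = (\<Sum>V | V \<in> words (n - 1 - num_shared ls) ls \<and> normal V. fact n * real (card (compat_perms n V)) / fact (2 * (n - 1) - num_shared ls))"
      by (rule sum.cong) (auto simp: words_def)
    also have "\<dots> = (real n)\<^sup>2 * run_term n ls"
      using n by (simp add: run_term_def sum_distrib_left sum_divide_distrib)
    finally show "(\<Sum>V | V \<in> words (n - 1 - num_shared ls) ls \<and> normal V. fact n * (real (card (compat_perms n V)) * ?w V))
      = (real n)\<^sup>2 * run_term n ls" .
  qed
  also have "\<dots> = (real n)\<^sup>2 * (\<Sum>ls | num_shared ls < n. run_term n ls)" by (simp add: sum_distrib_left)
  finally show ?thesis .
qed

section \<open>Comparison with the main term\<close>

lemma run_term_nonneg: "run_term n ls \<ge> 0"
  by (simp add: run_term_def sum_nonneg)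

text \<open>More than \<open>n\<close> entries cannot be prescribed. Such patterns must be discarded
  before passing to \<open>main_term\<close>, which need not vanish there because
  \<open>n - num_fixed ls\<close> is truncated.\<close>

lemma run_term_eq_0: "\<not> num_fixed ls \<le> n \<Longrightarrow> run_term n ls = 0"
  using compat_perms_nonempty[of _ n] by (force simp: run_term_def words_def intro!: sum.neutral)

text \<open>The constant stays open for two uses: \<open>C = 1\<close> yields the domination, and
  \<open>C = exp (- 2) + \<epsilon>\<close> the upper half of the limit.\<close>

lemma run_term_le_aux:
  assumes C: "C \<ge> 0"
    "\<And>D g. pinj n D g \<Longrightarrow> card D = num_fixed ls \<Longrightarrow> real (card {Q \<in> exts n D g. free_adj n D Q = {}}) \<le> C * fact (n - num_fixed ls)"
  shows "run_term n ls \<le> C * main_term n ls"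
proof -
  let ?W = "words (n - 1 - num_shared ls) ls"
  have "(\<Sum>V | V \<in> ?W \<and> normal V. real (card (compat_perms n V)))
     \<le> (\<Sum>V | V \<in> ?W \<and> normal V. real (num_orient ls) * (C * fact (n - num_fixed ls)))"
  proof (rule sum_mono)
    fix V assume "V \<in> {V. V \<in> ?W \<and> normal V}"
    then have V: "normal V" "run_lens V = ls" by (auto simp: words_def)
    show "real (card (compat_perms n V)) \<le> real (num_orient ls) * (C * fact (n - num_fixed ls))"
      using card_compat_perms_le[OF V(1), of "C * fact (n - num_fixed ls)" n] C V(2) by simp
  qed
  also have "\<dots> \<le> (\<Sum>V\<in>?W. real (num_orient ls) * (C * fact (n - num_fixed ls)))"
    using C finite_words by (intro sum_mono2) auto
  also have "\<dots> = real (card ?W) * (real (num_orient ls) * (C * fact (n - num_fixed ls)))" by simp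
  finally have "run_term n ls \<le> fact n * (real (card ?W) * (real (num_orient ls) * (C * fact (n - num_fixed ls)))) / fact (2 * (n - 1) - num_shared ls) / (real n)\<^sup>2"
    unfolding run_term_def by (intro divide_right_mono mult_left_mono) auto
  then show ?thesis by (simp add: main_term_def mult_ac)
qed

lemma run_term_le: "run_term n ls \<le> main_term n ls"
proof -
  have "run_term n ls \<le> 1 * main_term n ls"
  proof (rule run_term_le_aux)
    fix D g assume "pinj n D g" "card D = num_fixed ls"
    then have "card (exts n D g) = fact (n - num_fixed ls)" using card_ext by metis
    moreover have "card {Q \<in> exts n D g. free_adj n D Q = {}} \<le> card (exts n D g)"
      by (rule card_mono[OF finite_ext]) auto
    ultimately have "real (card {Q \<in> exts n D g. free_adj n D Q = {}}) \<le> real (fact (n - num_fixed ls))"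
      by (simp only: of_nat_le_iff)
    then show "real (card {Q \<in> exts n D g. free_adj n D Q = {}}) \<le> 1 * fact (n - num_fixed ls)" by simp
  qed simp
  then show ?thesis by simp
qed

text \<open>Only generic words are kept; by \<open>card_not_generic\<close> this costs at most the
  factor in parentheses.\<close>

lemma run_term_ge_aux:
  assumes C: "C \<ge> 0" and n: "num_fixed ls \<le> n" "num_shared ls < n"
    "\<And>D g. pinj n D g \<Longrightarrow> card D = num_fixed ls \<Longrightarrow> C * fact (n - num_fixed ls) \<le> real (card {Q \<in> exts n D g. outer_adj n D Q = {}})"
  shows "C * (1 - 4 * real (length ls) ^ 2 / real (n - 1 - num_shared ls + length ls)) * main_term n ls \<le> run_term n ls"
proof -
  let ?N = "n - 1 - num_shared ls" and ?r = "length ls"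
  let ?W = "words ?N ls"
  let ?c = "real (num_orient ls) * (C * fact (n - num_fixed ls))"
  have c0: "?c \<ge> 0" using C by simp
  have fin: "finite {V. V \<in> ?W \<and> generic V}" "finite {V. V \<in> ?W \<and> normal V}" using finite_words by auto
  have "real (card ?W) * (1 - 4 * real ?r ^ 2 / real (?N + ?r)) \<le> real (card {V \<in> ?W. generic V})"
  proof -
    have "card ?W = card ({V \<in> ?W. generic V} \<union> {V \<in> ?W. \<not> generic V})" by (rule arg_cong[where f = card]) auto
    also have "\<dots> = card {V \<in> ?W. generic V} + card {V \<in> ?W. \<not> generic V}"
      using finite_words by (intro card_Un_disjoint) auto
    finally have 1: "real (card ?W) = real (card {V \<in> ?W. generic V}) + real (card {V \<in> ?W. \<not> generic V})" by simp
    show ?thesis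
    proof (cases "?N + ?r = 0")
      \<comment> \<open>Without runs every word is generic, and the correction vanishes because
        \<open>length ls = 0\<close>.\<close>
      case True
      then have "?r = 0" by simp
      have "generic V" if "V \<in> ?W" for V
        using that \<open>?r = 0\<close> by (intro genericI) (auto simp: words_def)
      then have W: "{V \<in> ?W. generic V} = ?W" by auto
      show ?thesis unfolding W \<open>?r = 0\<close> by simp
    next
      case False
      have "real ((?N + ?r) * card {V \<in> ?W. \<not> generic V}) \<le> real (4 * ?r ^ 2 * card ?W)"
        using card_not_generic[of ?r ls ?N] by (intro of_nat_mono) simp
      then have "real (card {V \<in> ?W. \<not> generic V}) \<le> real (card ?W) * (4 * real ?r ^ 2 / real (?N + ?r))"
      proof -
        have *: "x \<le> c * (d / a)" if "a * x \<le> d * c" "a > 0" for a x c d :: real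
          using that by (simp add: field_simps)
        have pos: "real (?N + ?r) > 0" using False by (metis gr0I of_nat_0_less_iff)
        from \<open>real _ \<le> real _\<close> show ?thesis
          unfolding of_nat_mult of_nat_power of_nat_numeral by (rule *[OF _ pos])
      qed
      then show ?thesis using 1 unfolding right_diff_distrib mult_1_right by linarith
    qed
  qed
  then have "real (card ?W) * (1 - 4 * real ?r ^ 2 / real (?N + ?r)) * ?c \<le> real (card {V \<in> ?W. generic V}) * ?c"
    using c0 by (rule mult_right_mono)
  also have "\<dots> = (\<Sum>V | V \<in> ?W \<and> generic V. ?c)" by simp
  also have "\<dots> \<le> (\<Sum>V | V \<in> ?W \<and> generic V. real (card (compat_perms n V)))"
  proof (rule sum_mono)
    fix V assume "V \<in> {V. V \<in> ?W \<and> generic V}"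
    then have V: "generic V" "run_lens V = ls" "count_list V LP = ?N" "count_list V LQ = ?N" by (auto simp: words_def)
    show "?c \<le> real (card (compat_perms n V))"
      using card_compat_perms_ge[OF V(1), of n "C * fact (n - num_fixed ls)"] V n by simp
  qed
  also have "\<dots> \<le> (\<Sum>V | V \<in> ?W \<and> normal V. real (card (compat_perms n V)))"
    using fin generic_normal by (intro sum_mono2) auto
  finally have "fact n * (real (card ?W) * (1 - 4 * real ?r ^ 2 / real (?N + ?r)) * ?c) / fact (2 * (n - 1) - num_shared ls) / (real n)\<^sup>2 \<le> run_term n ls"
    unfolding run_term_def by (intro divide_right_mono mult_left_mono) auto
  then show ?thesis by (simp add: main_term_def mult_ac)
qed

section \<open>The limit\<close>

lemma no_outer_adj_ge:
  assumes "\<epsilon> > 0"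
  shows "\<forall>\<^sub>F n in sequentially. \<forall>D g. pinj n D g \<longrightarrow> card D = d \<longrightarrow>
    (exp (- 2) - \<epsilon>) * fact (n - d) \<le> real (card {Q \<in> exts n D g. outer_adj n D Q = {}})"
proof -
  have "(\<lambda>n. 8 * real d / (real n - real d)) \<longlonglongrightarrow> 0" by real_asymp
  then have "\<forall>\<^sub>F n in sequentially. 8 * real d / (real n - real d) < \<epsilon> / 2"
    using assms by (intro order_tendstoD) auto
  moreover have "\<forall>\<^sub>F n in sequentially. \<forall>D g. pinj n D g \<and> card D = d \<longrightarrow>
    \<bar>real (card {Q \<in> exts n D g. free_adj n D Q = {}}) / fact (n - d) - exp (- 2)\<bar> \<le> \<epsilon> / 2"
    using assms by (intro card_ext_no_free_adj_approx) auto
  ultimately show ?thesis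
    using eventually_gt_at_top[of d]
  proof eventually_elim
    case (elim n)
    show ?case
    proof (intro allI impI)
      fix D g assume P: "pinj n D g" and c: "card D = d"
      let ?F = "real (card {Q \<in> exts n D g. free_adj n D Q = {}})"
      let ?O = "real (card {Q \<in> exts n D g. outer_adj n D Q = {}})"
      have "\<bar>?F / fact (n - d) - exp (- 2)\<bar> \<le> \<epsilon> / 2" using elim(2) P c by blast
      then have "?F / fact (n - d) \<ge> exp (- 2) - \<epsilon> / 2" by linarith
      then have 1: "(exp (- 2) - \<epsilon> / 2) * fact (n - d) \<le> ?F" by (simp add: pos_le_divide_eq)
      have 2: "?F \<le> ?O + 8 * real d * fact (n - d - 1)"
        using of_nat_mono[OF card_ext_no_outer_adj[OF P], where 'a = real] c by simp
      have "fact (n - d) = (real n - real d) * fact (n - d - 1)"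
        using elim(3) by (subst fact_reduce) (auto simp: of_nat_diff)
      then have "8 * real d * fact (n - d - 1) = 8 * real d / (real n - real d) * fact (n - d)"
        using elim(3) by simp
      also have "\<dots> \<le> \<epsilon> / 2 * fact (n - d)" using elim(1) by (intro mult_right_mono) auto
      finally have "(exp (- 2) - \<epsilon> / 2) * fact (n - d) - \<epsilon> / 2 * fact (n - d) \<le> ?O" using 1 2 by linarith
      moreover have "(exp (- 2) - \<epsilon>) * fact (n - d) = (exp (- 2) - \<epsilon> / 2) * fact (n - d) - \<epsilon> / 2 * fact (n - d)"
        by (simp add: left_diff_distrib)
      ultimately show "(exp (- 2) - \<epsilon>) * fact (n - d) \<le> ?O" by linarith
    qed
  qed
qed

lemma main_term_pos: "num_fixed ls \<le> n \<Longrightarrow> num_shared ls < n \<Longrightarrow> main_term n ls > 0"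
proof -
  assume n: "num_fixed ls \<le> n" "num_shared ls < n"
  have "num_orient ls > 0" by (induction ls) (auto simp: num_orient_def)
  then show ?thesis using n by (auto simp: main_term_def card_words intro!: divide_pos_pos mult_pos_pos)
qed

lemma run_ratio_tendsto: "(\<lambda>n. run_term n ls / main_term n ls) \<longlonglongrightarrow> exp (- 2)"
proof (rule LIMSEQ_I)
  fix \<eta> :: real assume "\<eta> > 0"
  \<comment> \<open>The bound by \<open>exp (- 2) / 2\<close> keeps
    \<open>exp (- 2) - \<epsilon>\<close> nonnegative, as \<open>run_term_ge_aux\<close>
    demands.\<close>
  define \<epsilon> where "\<epsilon> = min (\<eta> / 3) (exp (- 2) / 2)"
  have \<epsilon>: "\<epsilon> > 0" "\<epsilon> \<le> \<eta> / 3" "\<epsilon> \<le> exp (- 2)" using \<open>\<eta> > 0\<close> by (auto simp: \<epsilon>_def min_def)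
  let ?r = "real (length ls)"
  have "(\<lambda>n. 4 * ?r ^ 2 / (real n - 1 - real (num_shared ls) + ?r)) \<longlonglongrightarrow> 0" by real_asymp
  then have "\<forall>\<^sub>F n in sequentially. 4 * ?r ^ 2 / (real n - 1 - real (num_shared ls) + ?r) < \<eta> / 3"
    using \<open>\<eta> > 0\<close> by (intro order_tendstoD) auto
  then have "\<forall>\<^sub>F n in sequentially. norm (run_term n ls / main_term n ls - exp (- 2)) < \<eta>"
    using no_outer_adj_ge[OF \<epsilon>(1), of "num_fixed ls"] card_ext_no_free_adj_approx[OF \<epsilon>(1), of "num_fixed ls"]
      eventually_gt_at_top[of "num_fixed ls"]
  proof eventually_elim
    case (elim n)
    have n: "num_fixed ls \<le> n" "num_shared ls < n" using elim(4) by auto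
    note pos = main_term_pos[OF n]
    have r: "real (n - 1 - num_shared ls + length ls) = real n - 1 - real (num_shared ls) + ?r" using n by simp
    let ?t = "4 * ?r ^ 2 / (real n - 1 - real (num_shared ls) + ?r)"
    have "(exp (- 2) - \<epsilon>) * (1 - ?t) * main_term n ls \<le> run_term n ls"
      using run_term_ge_aux[of "exp (- 2) - \<epsilon>" ls n] elim(2) n \<epsilon> unfolding r by auto
    then have lo: "(exp (- 2) - \<epsilon>) * (1 - ?t) \<le> run_term n ls / main_term n ls"
      using pos by (simp add: pos_le_divide_eq)
    have "run_term n ls \<le> (exp (- 2) + \<epsilon>) * main_term n ls"
    proof (rule run_term_le_aux)
      fix D g assume "pinj n D g" "card D = num_fixed ls"
      then have "\<bar>real (card {Q \<in> exts n D g. free_adj n D Q = {}}) / fact (n - num_fixed ls) - exp (- 2)\<bar> \<le> \<epsilon>"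
        using elim(3) by blast
      then have "real (card {Q \<in> exts n D g. free_adj n D Q = {}}) / fact (n - num_fixed ls) \<le> exp (- 2) + \<epsilon>"
        by linarith
      then show "real (card {Q \<in> exts n D g. free_adj n D Q = {}}) \<le> (exp (- 2) + \<epsilon>) * fact (n - num_fixed ls)"
        by (simp add: pos_divide_le_eq)
    qed (use \<epsilon> in \<open>simp add: add_nonneg_nonneg\<close>)
    then have hi: "run_term n ls / main_term n ls \<le> exp (- 2) + \<epsilon>"
      using pos by (simp add: pos_divide_le_eq)
    have t0: "?t \<ge> 0" using n by (intro divide_nonneg_nonneg) auto
    have "(exp (- 2) - \<epsilon>) * ?t \<le> 1 * ?t"
      using t0 \<epsilon> by (intro mult_right_mono) (auto simp: diff_le_eq intro: order.trans[of _ 1])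
    then have "exp (- 2) - \<epsilon> - ?t \<le> (exp (- 2) - \<epsilon>) * (1 - ?t)" by (simp add: right_diff_distrib)
    then show ?case using lo hi elim(1) \<epsilon> \<open>\<eta> > 0\<close> unfolding real_norm_def abs_less_iff by linarith
  qed
  then show "\<exists>no. \<forall>n\<ge>no. norm (run_term n ls / main_term n ls - exp (- 2)) < \<eta>"
    by (simp add: eventually_sequentially)
qed

text \<open>The factor 1 makes this an instance of \<open>prod_list_wt\<close> and
  \<open>has_sum_wt_seq\<close> with \<open>a = 1\<close> and \<open>x = 1 / 2\<close>.\<close>

definition run_limit :: "nat list \<Rightarrow> real" where
  "run_limit ls = prod_list (map (\<lambda>l. 1 * wt_seq l * (1 / 2) ^ l) ls) / fact (length ls)"

lemma run_term_tendsto: "(\<lambda>n. run_term n ls) \<longlonglongrightarrow> exp (- 2) * run_limit ls"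
proof -
  have "(\<lambda>n. run_term n ls / main_term n ls * main_term n ls) \<longlonglongrightarrow>
      exp (- 2) * (real (num_orient ls) / fact (length ls) * (1 / 2) ^ sum_list ls)"
    by (intro tendsto_mult run_ratio_tendsto main_term_tendsto)
  moreover have "\<forall>\<^sub>F n in sequentially. run_term n ls / main_term n ls * main_term n ls = run_term n ls"
    using eventually_gt_at_top[of "num_fixed ls"]
  proof eventually_elim
    case (elim n)
    then show ?case using main_term_pos[of ls n] by simp
  qed
  ultimately have "(\<lambda>n. run_term n ls) \<longlonglongrightarrow> exp (- 2) * (real (num_orient ls) / fact (length ls) * (1 / 2) ^ sum_list ls)"
    by (rule Lim_transform_eventually)
  then show ?thesis unfolding run_limit_def prod_list_wt by simp
qed

section \<open>Interchange of limit and sum\<close>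

text \<open>A geometric series plus an extra \<open>a\<close> at \<open>l = 0\<close> for the second
  orientation. The sum is 3 for the limit and 4 * 130 = 520 for the dominating function with
  \<open>a = 4\<close>, \<open>x = 128 / 129\<close>.\<close>

lemma has_sum_wt_seq:
  assumes "0 \<le> x" "x < 1" "0 \<le> a"
  shows "((\<lambda>l. a * wt_seq l * x ^ l) has_sum a * (1 + 1 / (1 - x))) UNIV"
proof (rule sums_nonneg_imp_has_sum)
  have "(\<lambda>l. x ^ l) sums (1 / (1 - x))" using assms by (intro geometric_sums) auto
  from sums_mult[OF this, of a] have g: "(\<lambda>l. a * x ^ l) sums (a * (1 / (1 - x)))" .
  have "(\<lambda>l. if l = 0 then a else 0) sums a" using sums_single[of 0 "\<lambda>_. a"] by simp
  from sums_add[OF g this]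
  have "(\<lambda>l. a * x ^ l + (if l = 0 then a else 0)) sums (a * (1 / (1 - x)) + a)" .
  moreover have "(\<lambda>l. a * x ^ l + (if l = 0 then a else 0)) = (\<lambda>l. a * wt_seq l * x ^ l)"
    by (auto simp: wt_seq_def)
  moreover have "a * (1 / (1 - x)) + a = a * (1 + 1 / (1 - x))" by (simp add: distrib_left)
  ultimately show "(\<lambda>l. a * wt_seq l * x ^ l) sums (a * (1 + 1 / (1 - x)))" by simp
qed (use assms in \<open>auto simp: wt_seq_def\<close>)

text \<open>Turns sums over lists into integrals for the counting measure, to which dominated
  convergence applies.\<close>

lemma has_sum_nonneg_integral:
  fixes f :: "'a \<Rightarrow> real"
  assumes "\<And>x. f x \<ge> 0" "(f has_sum S) UNIV"
  shows "integrable (count_space UNIV) f" "integral\<^sup>L (count_space UNIV) f = S"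
proof -
  have "Infinite_Sum.abs_summable_on f UNIV"
    using assms by (auto simp: summable_on_def)
  then have abs: "Infinite_Set_Sum.abs_summable_on f UNIV" by (simp only: abs_summable_equivalent)
  then show "integrable (count_space UNIV) f" by (simp add: Infinite_Set_Sum.abs_summable_on_def)
  have "infsetsum f UNIV = S" using infsetsum_infsum[OF abs] assms(2) by (simp add: infsumI)
  then show "integral\<^sup>L (count_space UNIV) f = S" by (simp add: infsetsum_def)
qed

lemma sum_run_term_tendsto: "(\<lambda>n. \<Sum>ls | num_shared ls < n. run_term n ls) \<longlonglongrightarrow> exp 1"
proof -
  let ?R = "\<lambda>n ls. num_shared ls < n \<and> n \<le> 128 * (n - 1 - num_shared ls)"
  \<comment> \<open>Extension by 0 gives all \<open>n\<close> the same index set and excludes the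
    patterns that have no summable majorant.\<close>
  define s where "s n ls = (if ?R n ls then run_term n ls else 0)" for n ls
  define w where "w ls = prod_list (map (\<lambda>l. 4 * wt_seq l * (128 / 129) ^ l) ls) / fact (length ls)" for ls :: "nat list"
  have seq_nonneg: "a * wt_seq l * x ^ l \<ge> 0" if "a \<ge> 0" "x \<ge> 0" for a x :: real and l
    using that by (auto simp: wt_seq_def)
  have list_nonneg: "prod_list (map (\<lambda>l. a * wt_seq l * x ^ l) ls) / fact (length ls) \<ge> 0"
    if "a \<ge> 0" "x \<ge> 0" for a x :: real and ls
    unfolding prod_list_wt using that by simp
  have w: "integrable (count_space UNIV) w"
    unfolding w_def[abs_def]
    by (rule has_sum_nonneg_integral[OF list_nonneg has_sum_prod_list_exp[OF seq_nonneg has_sum_wt_seq]]) auto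
  have "(run_limit has_sum exp (1 * (1 + 1 / (1 - 1 / 2)))) UNIV"
    unfolding run_limit_def[abs_def]
    by (rule has_sum_prod_list_exp[OF seq_nonneg has_sum_wt_seq]) auto
  then have "((\<lambda>ls. exp (- 2) * run_limit ls) has_sum exp (- 2) * exp 3) UNIV"
    by (intro has_sum_cmult_right) simp
  moreover have "exp (- 2) * run_limit ls \<ge> 0" for ls
    unfolding run_limit_def using list_nonneg[of 1 "1 / 2"] by (intro mult_nonneg_nonneg) auto
  ultimately have lim_int: "integral\<^sup>L (count_space UNIV) (\<lambda>ls. exp (- 2) * run_limit ls) = exp 1"
    using has_sum_nonneg_integral(2)[of "\<lambda>ls. exp (- 2) * run_limit ls"] by (simp flip: exp_add)
  have "(\<lambda>n. integral\<^sup>L (count_space UNIV) (s n)) \<longlonglongrightarrow> integral\<^sup>L (count_space UNIV) (\<lambda>ls. exp (- 2) * run_limit ls)"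
  proof (rule integral_dominated_convergence[OF _ _ w])
    show "AE ls in count_space UNIV. (\<lambda>n. s n ls) \<longlonglongrightarrow> exp (- 2) * run_limit ls"
    proof (rule AE_I2)
      fix ls
      have "\<forall>\<^sub>F n in sequentially. run_term n ls = s n ls"
        \<comment> \<open>From this point on \<open>n - 1 - num_shared ls\<close> is at least
          \<open>n / 2\<close>, so a fixed pattern satisfies \<open>?R\<close>.\<close>
        using eventually_ge_at_top[of "2 * (1 + num_shared ls)"]
      proof eventually_elim
        case (elim n)
        then show ?case by (auto simp: s_def)
      qed
      then show "(\<lambda>n. s n ls) \<longlonglongrightarrow> exp (- 2) * run_limit ls"
        using run_term_tendsto by (rule Lim_transform_eventually[rotated])
    qed
    show "AE ls in count_space UNIV. norm (s n ls) \<le> w ls" for n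
    proof (rule AE_I2)
      fix ls
      have w0: "w ls \<ge> 0" unfolding w_def by (rule list_nonneg) auto
      show "norm (s n ls) \<le> w ls"
      proof (cases "?R n ls \<and> num_fixed ls \<le> n")
        case True
        then have "run_term n ls \<le> w ls"
          using run_term_le[of n ls] main_term_le[of ls n] by (auto simp: w_def)
        then show ?thesis using True run_term_nonneg by (simp add: s_def)
      next
        case False
        then show ?thesis using w0 run_term_eq_0 by (auto simp: s_def)
      qed
    qed
  qed auto
  then have lim1: "(\<lambda>n. integral\<^sup>L (count_space UNIV) (s n)) \<longlonglongrightarrow> exp 1" unfolding lim_int .
  let ?L = "\<lambda>n. {ls. num_shared ls < n \<and> \<not> n \<le> 128 * (n - 1 - num_shared ls)}"
  have fin: "finite (?L n)" for n by (rule finite_subset[OF _ finite_nk_less[of n]]) auto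
  have int_eq: "integral\<^sup>L (count_space UNIV) (s n) = (\<Sum>ls | ?R n ls. run_term n ls)" for n
  proof -
    have "finite {ls. ?R n ls}" by (rule finite_subset[OF _ finite_nk_less[of n]]) auto
    moreover have sub: "{ls \<in> UNIV. s n ls \<noteq> 0} \<subseteq> {ls. ?R n ls}" by (auto simp: s_def)
    ultimately have f: "finite {ls \<in> UNIV. s n ls \<noteq> 0}" by (rule rev_finite_subset)
    have "integral\<^sup>L (count_space UNIV) (s n) = (\<Sum>ls | ls \<in> UNIV \<and> s n ls \<noteq> 0. s n ls)"
      by (rule lebesgue_integral_count_space_finite_support[OF f])
    also have "\<dots> = (\<Sum>ls | ?R n ls. s n ls)"
      by (rule sum.mono_neutral_left) (use sub \<open>finite {ls. ?R n ls}\<close> in auto)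
    also have "\<dots> = (\<Sum>ls | ?R n ls. run_term n ls)" by (rule sum.cong) (auto simp: s_def)
    finally show ?thesis .
  qed
  have lim2: "(\<lambda>n. \<Sum>ls\<in>?L n. run_term n ls) \<longlonglongrightarrow> 0"
  proof (rule Lim_null_comparison)
    show "\<forall>\<^sub>F n in sequentially. norm (\<Sum>ls\<in>?L n. run_term n ls) \<le> 16 * exp 128 / real n"
      using eventually_ge_at_top[of 2]
    proof eventually_elim
      case (elim n)
      have "(\<Sum>ls\<in>?L n. run_term n ls) = (\<Sum>ls | num_fixed ls \<le> n \<and> num_shared ls < n \<and> \<not> n \<le> 128 * (n - 1 - num_shared ls). run_term n ls)"
        by (rule sum.mono_neutral_right[OF fin]) (use run_term_eq_0 in auto)
      also have "\<dots> \<le> (\<Sum>ls | num_fixed ls \<le> n \<and> num_shared ls < n \<and> \<not> n \<le> 128 * (n - 1 - num_shared ls). main_term n ls)"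
        by (rule sum_mono) (rule run_term_le)
      also have "\<dots> \<le> 16 * exp 128 / real n" by (rule sum_main_term_long_le[OF elim])
      finally show ?case by (simp add: sum_nonneg run_term_nonneg)
    qed
    show "(\<lambda>n. 16 * exp 128 / real n) \<longlonglongrightarrow> 0" by real_asymp
  qed
  have "(\<Sum>ls | num_shared ls < n. run_term n ls) = integral\<^sup>L (count_space UNIV) (s n) + (\<Sum>ls\<in>?L n. run_term n ls)" for n
  proof -
    have eq: "{ls. num_shared ls < n} = {ls. ?R n ls} \<union> ?L n" by auto
    have finR: "finite {ls. ?R n ls}" by (rule finite_subset[OF _ finite_nk_less[of n]]) auto
    show ?thesis unfolding int_eq eq by (rule sum.union_disjoint[OF finR fin]) blast
  qed
  then show ?thesis using tendsto_add[OF lim1 lim2] by simp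
qed

theorem mainTheorem3:
  shows "(\<lambda>n::nat. measure_pmf.expectation (random_edge_ordering n)
            (\<lambda>f. (real (num_increasing_paths n f))\<^sup>2))
         \<sim>[sequentially] (\<lambda>n. exp 1 * (real n)\<^sup>2)"
proof (rule asymp_equivI')
  have "(\<lambda>n. (\<Sum>ls | num_shared ls < n. run_term n ls) / exp 1) \<longlonglongrightarrow> exp 1 / exp (1 :: real)"
    by (intro tendsto_divide sum_run_term_tendsto tendsto_const) simp
  then have "(\<lambda>n. (\<Sum>ls | num_shared ls < n. run_term n ls) / exp 1) \<longlonglongrightarrow> (1 :: real)" by simp
  moreover have "\<forall>\<^sub>F n in sequentially. (\<Sum>ls | num_shared ls < n. run_term n ls) / exp 1 =
     measure_pmf.expectation (random_edge_ordering n) (\<lambda>f. (real (num_increasing_paths n f))\<^sup>2) / (exp 1 * (real n)\<^sup>2)"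
    using eventually_gt_at_top[of 0]
  proof eventually_elim
    case (elim n)
    then show ?case by (simp add: second_moment_eq)
  qed
  ultimately show "(\<lambda>n. measure_pmf.expectation (random_edge_ordering n) (\<lambda>f. (real (num_increasing_paths n f))\<^sup>2)
      / (exp 1 * (real n)\<^sup>2)) \<longlonglongrightarrow> 1"
    by (rule Lim_transform_eventually)
qed

end
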